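(* Consider the system $$\dot{x}(t) = f(x(t)) + B_0(x(t)) u(t) + B_1(x(t)) u(t-h) + \int_{-h}^0 B_{\mathrm{int}}(\theta, x(t)) u(t+\theta)\,d\theta \qquad (\mathrm{P})$$ under the standing assumptions given in the context (with constants $M_f$ and $R\in(0,\infty]$), and let the maps $Y(x,\varphi)$ and $B(y,\varphi)$ be as defined in the context. If for all $(y,\varphi)\in\mathcal{O}(R)$ it is possible to define smooth functions $v_0(y)$ and $w_0(y)$ and a mapping $\kappa(y,\varphi)$ which satisfy the inequalities $$m_{v_0}\|y\|^2 \leq v_0(y) \leq M_{v_0}\|y\|^2,$$ $$w_0(y) \geq m_{w_0}\|y\|^2,$$ $$\|\kappa(y,\varphi)\| \leq M_\kappa \|y\|,$$ $$\big( f(y)+B(y,\varphi)\kappa(y,\varphi) \big)^T \nabla v_0(y) \leq -w_0(y),$$ where $m_{v_0}$, $M_{v_0}$, $m_{w_0}$, $M_\kappa$ are constants with $m_{v_0}>0$ and $m_{w_0}>0$, then: 1. the origin is exponentially stable in the loop of (P) closed by the feedback $$u(t) = \kappa\big(Y(x(t), u_t), u_t\big);$$ 2. the stability is global if $R=\infty$ or local if $R<\infty$ with the region of attraction containing at least the ball $$\big(x(t),u_t\big)\in\mathcal{O}\left( \sqrt{\frac{m_v}{M_v}}\, \frac{R}{\rho} \right),$$ where $$\rho = \sqrt{2}\,e^{M_fh} \max\Big\{ 1,\ h\max_{\theta\in[-h,0],\,x\in\mathcal{O}(R)} \|B_{\mathrm{int}}(\theta, x)\| + \max_{x\in\mathcal{O}(R)}\|B_1(x)\|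 \Big\},$$ $$m_v = \frac{1}{2\rho^2}\min\big\{ m_{v_0},\ \gamma e^{-\sigma h},\ \rho^2 \gamma e^{-\sigma h} \big\},\qquad M_v = \gamma+\rho^2 M_{v_0},\qquad \gamma = \frac{m_{w_0}}{2M_\kappa^2},\qquad \sigma = \frac{m_{w_0}}{2M_{v_0}};$$ 3. solutions of the closed loop, i.e. of (P) with the feedback of item 1, exhibit the exponential decay property $$\|x(t)\|^2 + \|u_t\|^2 \leq \frac{M_v}{m_v}\, e^{-\sigma t} \big( \|x(0)\|^2 + \|u_0\|^2 \big).$$
   Context: Notation. $PC(T,X)$ is the space of piecewise continuous functions from $T\subset\mathbb{R}$ to a Euclidean space $X$. For $\varphi\in PC([-h,0),\mathbb{R}^m)$, $\|\varphi\|^2=\int_{-h}^0\|\varphi(\theta)\|^2d\theta$, and $\varphi_i$ is the $i$-th component of $\varphi$. For a piecewise continuous input $u$, $u_t$ denotes the function $u_t(\theta)=u(t+\theta)$, $\theta\in[-h,0)$. $\mathcal{O}(R)$ is the closed ball of radius $R$ about the origin: $x\in\mathcal{O}(R)\Leftrightarrow\|x\|^2\le R^2$, and $(x,\varphi)\in\mathcal{O}(R)\Leftrightarrow\|x\|^2+\|\varphi\|^2\le R^2$; for $R=\infty$ it is the whole space. Standing assumptions. $x\in\mathbb{R}^n$, $u\in\mathbb{R}^m$, $h>0$, and there are $M_f<\infty$ and $R\in(0,\infty]$ such that: 1) for all $x,x_0\in\mathcal{O}(R)$: $\|f(x)\|\le M_f\|x\|$ and $f(x)=f(x_0)+A(x_0)(x-x_0)+o(x-x_0)$,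 with $A\in C^0(\mathcal{O}(R),\mathbb{R}^{n\times n})$; 2) $B_1$ ($n\times m$ matrix-valued) is bounded on $\mathcal{O}(R)$ and, for all $x,x_0\in\mathcal{O}(R)$, $B_1(x)=B_1(x_0)+\big(\mathcal{B}_1^1(x_0)(x-x_0),\dots,\mathcal{B}_1^m(x_0)(x-x_0)\big)+o(x-x_0)$, with $\mathcal{B}_1^i\in C^0(\mathcal{O}(R),\mathbb{R}^{n\times n})$ for $i=1,\dots,m$ (the bracket lists the columns of an $n\times m$ matrix); 3) $B_{\mathrm{int}}$ is bounded on $[-h,0]\times\mathcal{O}(R)$, $B_{\mathrm{int}}(\cdot,x)\in PC([-h,0],\mathbb{R}^{n\times m})$, and, for all $x,x_0\in\mathcal{O}(R)$ and $\theta\in[-h,0]$, $B_{\mathrm{int}}(\theta,x)=B_{\mathrm{int}}(\theta,x_0)+\big(\mathcal{B}_{\mathrm{int}}^1(\theta,x_0)(x-x_0),\dots,\mathcal{B}_{\mathrm{int}}^m(\theta,x_0)(x-x_0)\big)+o(x-x_0)$, with $\mathcal{B}_{\mathrm{int}}^i(\theta,\cdot)\in C^0(\mathcal{O}(R),\mathbb{R}^{n\times n})$ for $i=1,\dots,m$. Predictor map. For $x\in\mathbb{R}^n$ and piecewise continuous $\varphi:[-h,0)\to\mathbb{R}^m$, $Y(x,\varphi)=\xi(h)$, where $\xi$ solves, for $s\in[0,h]$, $$\xi'(s)=f(\xi(s))+B_1(\xi(s))\varphi(s-h)+\int_{-h}^{-s}B_{\mathrm{int}}(\theta,\xi(s))\varphi(s+\theta)\,d\theta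 \qquad ( * )$$ with $\xi(0)=x$. Input matrix of the transformed system. For given $y$ and $\varphi$, let $\xi$ solve $( * )$ with the terminal condition $\xi(h)=y$ (granted that it exists on $[0,h]$), and set $B(y,\varphi)=B_1(\xi(h))+\beta(h)$, where $$\beta'(s)=\tilde A(s,\xi(s),\varphi)\beta(s)+B_{\mathrm{int}}(-s,\xi(s)),\qquad \beta(0)=B_0(\xi(0)),$$ $$\tilde A(s,\xi,\varphi)=A(\xi)+\sum_{i=1}^m\mathcal{B}_1^i(\xi)\varphi_i(s-h)+\sum_{i=1}^m\int_{-h}^{-s}\mathcal{B}_{\mathrm{int}}^i(\theta,\xi)\varphi_i(s+\theta)\,d\theta.$$ (The transformation $y(t)=Y(x(t),u_t)$ puts (P) into the form $\dot y(t)=f(y(t))+B(y(t),u_t)u(t)$.)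
   Formalization: In ρ the term h·max‖B_int‖+max‖B_1‖ is multiplied by max{1,√h}, since the printed decay bound fails for some h>1; and the derivatives of B_int in x are assumed bounded on [-h,0]×K for compact K in O(R), without which Y need not be well defined. *)

theory Defs
  imports "HOL-Analysis.Analysis"
begin

(* Intended for bounded intervals T. Limits are required on the closure of T, so a piecewise
   continuous function on a half-open interval stays bounded at the missing endpoint. At a point
   with no neighbours on one side the filter is bot and that requirement is void. *)
definition piecewise_continuous_on :: "real set \<Rightarrow> (real \<Rightarrow> 'a::topological_space) \<Rightarrow> bool" where
  "piecewise_continuous_on T g \<longleftrightarrow>
     finite {t \<in> T. \<not> continuous (at t within T) g} \<and>
     (\<forall>t \<in> closure T. (\<exists>l. (g \<longlongrightarrow> l) (at t within (T \<inter> {..<t}))) \<and>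
                     (\<exists>l. (g \<longlongrightarrow> l) (at t within (T \<inter> {t<..}))))"

(* The space PC([-h,0), X); a function on [-h,0) is represented extensionally. *)
definition PC_hist :: "real \<Rightarrow> (real \<Rightarrow> 'a::topological_space) set" where
  "PC_hist h = {\<phi> \<in> extensional {-h..<0}. piecewise_continuous_on {-h..<0} \<phi>}"

(* u_t. The restriction matters: a functional of u_t must not see u outside [t-h,t). *)
definition segment :: "real \<Rightarrow> (real \<Rightarrow> 'a) \<Rightarrow> real \<Rightarrow> (real \<Rightarrow> 'a)" where
  "segment h u t = (\<lambda>\<theta>\<in>{-h..<0}. u (t + \<theta>))"

definition hist_sqnorm :: "real \<Rightarrow> (real \<Rightarrow> 'a::real_normed_vector) \<Rightarrow> real" where
  "hist_sqnorm h \<phi> = integral {-h..0} (\<lambda>\<theta>. (norm (\<phi> \<theta>))\<^sup>2)"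

definition state_sqnorm ::
    "real \<Rightarrow> 'a::real_normed_vector \<Rightarrow> (real \<Rightarrow> 'b::real_normed_vector) \<Rightarrow> real" where
  "state_sqnorm h x \<phi> = (norm x)\<^sup>2 + hist_sqnorm h \<phi>"

definition origin_ball :: "ereal \<Rightarrow> 'a::real_normed_vector set" where
  "origin_ball r = {x. ereal ((norm x)\<^sup>2) \<le> r\<^sup>2}"

definition state_ball ::
    "real \<Rightarrow> ereal \<Rightarrow> ('a::real_normed_vector \<times> (real \<Rightarrow> 'b::real_normed_vector)) set" where
  "state_ball h r = {(x, \<phi>). \<phi> \<in> PC_hist h \<and> ereal (state_sqnorm h x \<phi>) \<le> r\<^sup>2}"

definition matrix_of_columns :: "('m \<Rightarrow> real^'n) \<Rightarrow> real^'m^'n" where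
  "matrix_of_columns c = (\<chi> j i. c i $ j)"

(* Induced (spectral) norm; the library's norm on matrices is the Frobenius norm. *)
definition matrix_norm :: "real^'m^'n \<Rightarrow> real" where
  "matrix_norm M = onorm ((*v) M)"

definition C1_with_gradient ::
    "'a::real_inner set \<Rightarrow> ('a \<Rightarrow> real) \<Rightarrow> ('a \<Rightarrow> 'a) \<Rightarrow> bool" where
  "C1_with_gradient S v g \<longleftrightarrow>
     continuous_on S g \<and> (\<forall>y \<in> S. (v has_derivative (\<lambda>d. g y \<bullet> d)) (at y within S))"

(* z' = F(t,z) on I for right-hand sides with jumps in t: z is continuous and the equation may
   fail at countably many points. *)
definition solves_on ::
    "real set \<Rightarrow> (real \<Rightarrow> 'a::real_normed_vector \<Rightarrow> 'a) \<Rightarrow> (real \<Rightarrow> 'a) \<Rightarrow> bool" where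
  "solves_on I F z \<longleftrightarrow> continuous_on I z \<and>
     (\<exists>S. countable S \<and>
        (\<forall>t \<in> I - S. (z has_vector_derivative F t (z t)) (at t within I)))"

(* f, B1, Bint are only specified on the ball of radius R (A, DB1, DBint below are their
   derivatives there), so trajectories of the predictor equation are taken in that ball. *)
definition predictor_trajectory ::
    "real \<Rightarrow> ereal \<Rightarrow> (real^'n \<Rightarrow> real^'n) \<Rightarrow> (real^'n \<Rightarrow> real^'m^'n)
     \<Rightarrow> (real \<Rightarrow> real^'n \<Rightarrow> real^'m^'n) \<Rightarrow> (real \<Rightarrow> real^'m) \<Rightarrow> (real \<Rightarrow> real^'n) \<Rightarrow> bool" where
  "predictor_trajectory h R f B1 Bint \<phi> \<xi> \<longleftrightarrow>
     (\<forall>s \<in> {0..h}. \<xi> s \<in> origin_ball R) \<and>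
     solves_on {0..h}
       (\<lambda>s z. f z + B1 z *v \<phi> (s - h) + integral {-h..-s} (\<lambda>\<theta>. Bint \<theta> z *v \<phi> (s + \<theta>))) \<xi>"

definition predictor_map ::
    "real \<Rightarrow> ereal \<Rightarrow> (real^'n \<Rightarrow> real^'n) \<Rightarrow> (real^'n \<Rightarrow> real^'m^'n)
     \<Rightarrow> (real \<Rightarrow> real^'n \<Rightarrow> real^'m^'n) \<Rightarrow> real^'n \<Rightarrow> (real \<Rightarrow> real^'m) \<Rightarrow> real^'n" where
  "predictor_map h R f B1 Bint x \<phi> =
     (THE y. \<exists>\<xi>. predictor_trajectory h R f B1 Bint \<phi> \<xi> \<and> \<xi> 0 = x \<and> \<xi> h = y)"

definition variational_matrix ::
    "real \<Rightarrow> (real^'n \<Rightarrow> real^'n^'n) \<Rightarrow> ('m::finite \<Rightarrow> real^'n \<Rightarrow> real^'n^'n)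
     \<Rightarrow> ('m \<Rightarrow> real \<Rightarrow> real^'n \<Rightarrow> real^'n^'n) \<Rightarrow> real \<Rightarrow> real^'n \<Rightarrow> (real \<Rightarrow> real^'m) \<Rightarrow> real^'n^'n" where
  "variational_matrix h A DB1 DBint s z \<phi> =
     A z + (\<Sum>i\<in>UNIV. (\<phi> (s - h) $ i) *\<^sub>R DB1 i z)
         + (\<Sum>i\<in>UNIV. integral {-h..-s} (\<lambda>\<theta>. (\<phi> (s + \<theta>) $ i) *\<^sub>R DBint i \<theta> z))"

definition input_matrix ::
    "real \<Rightarrow> ereal \<Rightarrow> (real^'n \<Rightarrow> real^'n) \<Rightarrow> (real^'n \<Rightarrow> real^'n^'n)
     \<Rightarrow> (real^'n \<Rightarrow> real^'m^'n) \<Rightarrow> (real^'n \<Rightarrow> real^'m^'n) \<Rightarrow> ('m::finite \<Rightarrow> real^'n \<Rightarrow> real^'n^'n)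
     \<Rightarrow> (real \<Rightarrow> real^'n \<Rightarrow> real^'m^'n) \<Rightarrow> ('m \<Rightarrow> real \<Rightarrow> real^'n \<Rightarrow> real^'n^'n)
     \<Rightarrow> real^'n \<Rightarrow> (real \<Rightarrow> real^'m) \<Rightarrow> real^'m^'n" where
  "input_matrix h R f A B0 B1 DB1 Bint DBint y \<phi> =
     (THE M. \<exists>\<xi> \<beta>. predictor_trajectory h R f B1 Bint \<phi> \<xi> \<and> \<xi> h = y \<and>
        solves_on {0..h}
          (\<lambda>s b. variational_matrix h A DB1 DBint s (\<xi> s) \<phi> ** b + Bint (-s) (\<xi> s)) \<beta> \<and>
        \<beta> 0 = B0 (\<xi> 0) \<and> M = B1 (\<xi> h) + \<beta> h)"

definition standing_assumptions ::
    "real \<Rightarrow> ereal \<Rightarrow> real \<Rightarrow> (real^'n \<Rightarrow> real^'n) \<Rightarrow> (real^'n \<Rightarrow> real^'n^'n)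
     \<Rightarrow> (real^'n \<Rightarrow> real^'m^'n) \<Rightarrow> ('m::finite \<Rightarrow> real^'n \<Rightarrow> real^'n^'n)
     \<Rightarrow> (real \<Rightarrow> real^'n \<Rightarrow> real^'m^'n) \<Rightarrow> ('m \<Rightarrow> real \<Rightarrow> real^'n \<Rightarrow> real^'n^'n) \<Rightarrow> bool" where
  "standing_assumptions h R M_f f A B1 DB1 Bint DBint \<longleftrightarrow>
     h > 0 \<and> R > 0 \<and>
     (\<forall>x \<in> origin_ball R. norm (f x) \<le> M_f * norm x) \<and>
     (\<forall>x0 \<in> origin_ball R. (f has_derivative (\<lambda>d. A x0 *v d)) (at x0 within origin_ball R)) \<and>
     continuous_on (origin_ball R) A \<and>
     bounded (B1 ` origin_ball R) \<and>
     (\<forall>x0 \<in> origin_ball R.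
        (B1 has_derivative (\<lambda>d. matrix_of_columns (\<lambda>i. DB1 i x0 *v d)))
          (at x0 within origin_ball R)) \<and>
     (\<forall>i. continuous_on (origin_ball R) (DB1 i)) \<and>
     bounded ((\<lambda>(\<theta>, x). Bint \<theta> x) ` ({-h..0} \<times> origin_ball R)) \<and>
     (\<forall>x \<in> origin_ball R. piecewise_continuous_on {-h..0} (\<lambda>\<theta>. Bint \<theta> x)) \<and>
     (\<forall>\<theta> \<in> {-h..0}. \<forall>x0 \<in> origin_ball R.
        (Bint \<theta> has_derivative (\<lambda>d. matrix_of_columns (\<lambda>i. DBint i \<theta> x0 *v d)))
          (at x0 within origin_ball R)) \<and>
     (\<forall>i. \<forall>\<theta> \<in> {-h..0}. continuous_on (origin_ball R) (DBint i \<theta>)) \<and>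
     \<comment> \<open>Local uniformity in \<open>\<theta>\<close>. Without it the integral of \<open>DBint\<close> over \<open>\<theta>\<close> need not exist and the
        predictor equation can lose uniqueness.\<close>
     (\<forall>i. \<forall>K \<subseteq> origin_ball R. compact K \<longrightarrow>
        bounded ((\<lambda>(\<theta>, x). DBint i \<theta> x) ` ({-h..0} \<times> K)))"

(* Solution on [0,T), 0 < T \<le> \<infinity>, with u given on [-h,T). *)
definition closed_loop_solution ::
    "real \<Rightarrow> ereal \<Rightarrow> (real^'n \<Rightarrow> real^'n) \<Rightarrow> (real^'n \<Rightarrow> real^'m^'n) \<Rightarrow> (real^'n \<Rightarrow> real^'m^'n)
     \<Rightarrow> (real \<Rightarrow> real^'n \<Rightarrow> real^'m^'n) \<Rightarrow> (real^'n \<Rightarrow> (real \<Rightarrow> real^'m) \<Rightarrow> real^'m)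
     \<Rightarrow> ereal \<Rightarrow> (real \<Rightarrow> real^'n) \<Rightarrow> (real \<Rightarrow> real^'m) \<Rightarrow> bool" where
  "closed_loop_solution h R f B0 B1 Bint \<kappa> T x u \<longleftrightarrow>
     T > 0 \<and>
     (\<forall>t\<ge>0. ereal t < T \<longrightarrow> piecewise_continuous_on {-h..t} u) \<and>
     solves_on {t. 0 \<le> t \<and> ereal t < T}
       (\<lambda>t z. f z + B0 z *v u t + B1 z *v u (t - h)
              + integral {-h..0} (\<lambda>\<theta>. Bint \<theta> z *v u (t + \<theta>))) x \<and>
     (\<forall>t\<ge>0. ereal t < T \<longrightarrow>
        u t = \<kappa> (predictor_map h R f B1 Bint (x t) (segment h u t)) (segment h u t))"

(* Below, Sol T x u is meant to say that (x,u) solves a system on [0,T), with u given on [-h,T). *)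

definition exp_estimate ::
    "real \<Rightarrow> (ereal \<Rightarrow> (real \<Rightarrow> 'a::real_normed_vector) \<Rightarrow> (real \<Rightarrow> 'b::real_normed_vector) \<Rightarrow> bool)
     \<Rightarrow> ereal \<Rightarrow> real \<Rightarrow> real \<Rightarrow> bool" where
  "exp_estimate h Sol r C \<omega> \<longleftrightarrow>
     (\<forall>T x u. Sol T x u \<and> (x 0, segment h u 0) \<in> state_ball h r \<longrightarrow>
        (\<forall>t\<ge>0. ereal t < T \<longrightarrow>
           sqrt (state_sqnorm h (x t) (segment h u t))
             \<le> C * exp (- \<omega> * t) * sqrt (state_sqnorm h (x 0) (segment h u 0))))"

definition exponentially_stable ::
    "real \<Rightarrow> (ereal \<Rightarrow> (real \<Rightarrow> 'a::real_normed_vector) \<Rightarrow> (real \<Rightarrow> 'b::real_normed_vector) \<Rightarrow> bool) \<Rightarrow> bool" where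
  "exponentially_stable h Sol \<longleftrightarrow> Sol \<infinity> (\<lambda>_. 0) (\<lambda>_. 0) \<and>
     (\<exists>\<delta>>0. \<exists>C>0. \<exists>\<omega>>0. exp_estimate h Sol \<delta> C \<omega>)"

definition globally_exponentially_stable ::
    "real \<Rightarrow> (ereal \<Rightarrow> (real \<Rightarrow> 'a::real_normed_vector) \<Rightarrow> (real \<Rightarrow> 'b::real_normed_vector) \<Rightarrow> bool) \<Rightarrow> bool" where
  "globally_exponentially_stable h Sol \<longleftrightarrow> Sol \<infinity> (\<lambda>_. 0) (\<lambda>_. 0) \<and>
     (\<exists>C>0. \<exists>\<omega>>0. exp_estimate h Sol \<infinity> C \<omega>)"

definition region_of_attraction ::
    "real \<Rightarrow> (ereal \<Rightarrow> (real \<Rightarrow> 'a::real_normed_vector) \<Rightarrow> (real \<Rightarrow> 'b::real_normed_vector) \<Rightarrow> bool)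
     \<Rightarrow> ('a \<times> (real \<Rightarrow> 'b)) set" where
  "region_of_attraction h Sol = {(x0, \<phi>). \<phi> \<in> PC_hist h \<and>
     (\<forall>x u. Sol \<infinity> x u \<and> x 0 = x0 \<and> segment h u 0 = \<phi> \<longrightarrow>
        ((\<lambda>t. state_sqnorm h (x t) (segment h u t)) \<longlongrightarrow> 0) at_top)}"

(* The bound on the predictor trajectories needs the L1-norm of \<phi> on [-h,0), which is at most
   sqrt h times its L2-norm; the factor max 1 (sqrt h) accounts for this. It is 1 if h \<le> 1. For
   h > 1 it cannot be dropped: for x'(t) = u(t-h), h = 100, \<kappa>(y,\<phi>) = -y/50, v0(y) = y^2,
   w0(y) = y^2/25, x(0) = 0, u = 1 on [-h,0), one has x(h) = 100, but the decay estimate with the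
   factor replaced by 1 would give x(h)^2 < 2900. *)
definition transform_gain ::
    "real \<Rightarrow> ereal \<Rightarrow> real \<Rightarrow> (real^'n \<Rightarrow> real^'m^'n) \<Rightarrow> (real \<Rightarrow> real^'n \<Rightarrow> real^'m^'n) \<Rightarrow> real" where
  "transform_gain h R M_f B1 Bint =
     sqrt 2 * exp (M_f * h) *
     max 1 (max 1 (sqrt h) *
       (h * (SUP (\<theta>, x) \<in> {-h..0} \<times> origin_ball R. matrix_norm (Bint \<theta> x))
        + (SUP x \<in> origin_ball R. matrix_norm (B1 x))))"

end

(* The predicted state y(t) = Y(x(t), u_t) obeys y' = f(y) + B(y, u_t) u(t), so
   V = v0(y) + gamma * (integral of exp(sigma theta) |u(t + theta)|^2 over [-h, 0]) satisfies V' <= -sigma V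
   along the loop. Gronwall estimates for the predictor equation, forwards and backwards in time, bound
   |y| by |x| and |x| by |y| up to the history term; this makes V equivalent to |x|^2 + |u_t|^2.

   The inputs are only piecewise continuous and the equations may fail at countably many points, so
   the differential inequality is used in the form: a continuous function whose right derivative is
   nonpositive off a countable set is nonincreasing. The right derivative of y comes from comparing the
   predictor trajectory started at time t + e with the one started at time t, corrected by e beta u(t). *)

theory Submission
  imports Defs
begin

subsection \<open>Integral equations and differential inequalities\<close>

text \<open>One input in absolute time drives every predictor trajectory, so the trajectories
  started at \<open>t\<close> and at \<open>t + e\<close> obey, on their common interval, equations
  that differ only in the window of the distributed delay. The later one also sees the input on
  \<open>[t, t + e]\<close>, which enters at three places: through the start value, giving
  \<open>B0\<close>, the initial value of \<open>\<beta>\<close>; through the widened window, giving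
  the source term \<open>Bint (-s)\<close> of \<open>\<beta>\<close>; and through the last stretch
  of length \<open>e\<close>, giving \<open>B1\<close>. Hence the input matrix is
  \<open>B1 + \<beta> h\<close>.

  For finite \<open>R\<close> the difficulty is circular: the estimates need \<open>(y, u_t)\<close>
  in the ball of radius \<open>R\<close>, which is ensured while
  \<open>|x|^2 + |u_t|^2 \<le> R^2 / (rho^2 + 5/8)\<close>, and this in turn has to be deduced from
  the estimates. A first-exit argument closes the circle. Its constant must be large enough to bound
  \<open>|y|^2 + |u_t|^2\<close> and small enough that \<open>(rho^2 + 5/8)^2 < 2 rho^4\<close>; the
  obvious \<open>rho^2 + 1\<close> fails at \<open>rho^2 = 2\<close>.\<close>

lemma bounded_bilinear_matrix_vector_mult:
  "bounded_bilinear ((*v) :: real^'n^'m \<Rightarrow> real^'n \<Rightarrow> real^'m)"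
  unfolding bilinear_conv_bounded_bilinear[symmetric] bilinear_def linear_iff
  by (auto simp: matrix_vector_mult_add_rdistrib matrix_vector_right_distrib
      scaleR_matrix_vector_assoc matrix_vector_mult_scaleR)

lemma bounded_bilinear_matrix_matrix_mult:
  "bounded_bilinear ((**) :: real^'n^'m \<Rightarrow> real^'k^'n \<Rightarrow> real^'k^'m)"
  unfolding bilinear_conv_bounded_bilinear[symmetric] bilinear_def linear_iff
  by (auto simp: matrix_add_ldistrib matrix_matrix_mult_def vec_eq_iff sum.distrib algebra_simps
      sum_distrib_left)

text \<open>Continuity off a countable set gives Borel measurability, and a bounded measurable
  function on a compact interval is integrable. Extending \<open>f\<close> by zero may create jumps
  at the endpoints, so \<open>a\<close> and \<open>b\<close> join the exceptional set.\<close>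

lemma integrable_countable_discontinuities:
  fixes f :: "real \<Rightarrow> 'a::euclidean_space"
  assumes S: "countable S"
    and cont: "\<And>t. t \<in> {a..b} - S \<Longrightarrow> continuous (at t within {a..b}) f"
    and bound: "\<And>t. t \<in> {a..b} \<Longrightarrow> norm (f t) \<le> C"
  shows "f integrable_on {a..b}"
proof (rule measurable_bounded_by_integrable_imp_integrable[where g = "\<lambda>_. C"])
  let ?g = "\<lambda>t. if t \<in> {a..b} then f t else 0"
  have "?g \<in> borel_measurable borel"
  proof (rule borel_measurable_continuous_countable_exceptions)
    show "countable (S \<union> {a, b})" using S by simp
    have "isCont ?g t" if t: "t \<notin> S \<union> {a, b}" for t
    proof (cases "t \<in> {a<..<b}")
      case True
      have "isCont f t"
      proof -
        have "continuous (at t within {a<..<b}) f"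
          by (rule continuous_within_subset[OF cont[of t]]) (use t True in auto)
        then show ?thesis
          using True by (simp only: at_within_open[OF True open_greaterThanLessThan])
      qed
      moreover have "\<forall>\<^sub>F s in nhds t. f s = ?g s"
        using eventually_nhds_in_open[of "{a<..<b}" t] True by (auto elim!: eventually_mono)
      ultimately show ?thesis
        by (simp add: isCont_cong)
    next
      case False
      then have "t \<in> - {a..b}" using t by auto
      then have "\<forall>\<^sub>F s in nhds t. ?g s = 0"
        using eventually_nhds_in_open[of "- {a..b}" t] by (auto simp: open_Compl elim!: eventually_mono)
      then show ?thesis
        using isCont_cong[of ?g "\<lambda>_. 0" t] by simp
    qed
    then show "continuous_on (- (S \<union> {a, b})) ?g"
      by (simp add: continuous_at_imp_continuous_on)
  qed
  then have "?g \<in> borel_measurable lebesgue"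
    by (intro measurable_completion) simp
  then show "f \<in> borel_measurable (lebesgue_on {a..b})"
    by (rule borel_measurable_if_D)
qed (use bound in auto)

text \<open>A limit along \<open>at p0 within S\<close> is tested on sequences, which is where first
  countability enters; dominated convergence applies to each of them. Resetting the integrands to 0
  on the negligible set \<open>N\<close> turns convergence off \<open>N\<close> into convergence
  everywhere.\<close>

lemma tendsto_integral_dominated:
  fixes f :: "'p::first_countable_topology \<Rightarrow> real \<Rightarrow> 'a::euclidean_space"
  assumes N: "countable N"
    and int: "\<And>p. p \<in> insert p0 S \<Longrightarrow> f p integrable_on {a..b}"
    and bound: "\<And>p w. p \<in> S \<Longrightarrow> w \<in> {a..b} \<Longrightarrow> norm (f p w) \<le> C"
    and lim: "\<And>w. w \<in> {a..b} - N \<Longrightarrow> ((\<lambda>p. f p w) \<longlongrightarrow> f p0 w) (at p0 within S)"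
  shows "((\<lambda>p. integral {a..b} (f p)) \<longlongrightarrow> integral {a..b} (f p0)) (at p0 within S)"
  unfolding tendsto_at_iff_sequentially
proof (intro allI impI)
  fix X assume X: "\<forall>i. X i \<in> S - {p0}" and lX: "X \<longlonglongrightarrow> p0"
  have neg: "negligible N"
    unfolding negligible_iff_null_sets
    by (intro null_sets_completionI countable_imp_null_set_lborel N)
  let ?g = "\<lambda>p w. if w \<in> N then 0 else f p w"
  have intg: "?g p integrable_on {a..b}" if "p \<in> insert p0 S" for p
    by (rule integrable_spike[OF int[OF that] neg]) auto
  have eq: "integral {a..b} (?g p) = integral {a..b} (f p)" for p
    by (rule integral_spike[OF neg]) auto
  have lim': "((\<lambda>k. f (X k) w) \<longlonglongrightarrow> f p0 w)" if "w \<in> {a..b} - N" for w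
    using lim[OF that] X lX unfolding tendsto_at_iff_sequentially o_def by blast
  have "(\<lambda>k. integral {a..b} (?g (X k))) \<longlonglongrightarrow> integral {a..b} (?g p0)"
  proof (rule dominated_convergence(2)[where h = "\<lambda>_. \<bar>C\<bar>"])
    show "norm (?g (X k) w) \<le> \<bar>C\<bar>" if "w \<in> {a..b}" for k w
      using bound[of "X k" w] X that by force
    show "(\<lambda>k. ?g (X k) w) \<longlonglongrightarrow> ?g p0 w" if "w \<in> {a..b}" for w
      using lim'[of w] that by auto
  qed (use intg X in auto)
  then show "((\<lambda>p. integral {a..b} (f p)) \<circ> X) \<longlonglongrightarrow> integral {a..b} (f p0)"
    by (simp add: eq o_def)
qed

text \<open>Zygmund's argument: if \<open>g\<close> increased, then after adding a slope the last point at which it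
  takes a given intermediate value would be exceptional, for uncountably many values.\<close>

lemma dini_nonincreasing:
  fixes g :: "real \<Rightarrow> real"
  assumes ab: "a \<le> b" and cont: "continuous_on {a..b} g" and S: "countable S"
    and dini: "\<And>t e. t \<in> {a..<b} - S \<Longrightarrow> e > 0 \<Longrightarrow> \<forall>\<^sub>F s in at_right t. g s - g t \<le> e * (s - t)"
  shows "g b \<le> g a"
proof (rule ccontr)
  assume "\<not> g b \<le> g a"
  then have gt: "g b > g a" by simp
  then have "a < b" using ab by (cases "a = b") auto
  \<comment> \<open>Half the mean slope: subtracting it leaves \<open>k\<close> with a positive net
    increase, while the Dini bound with \<open>e / 2\<close> forces \<open>k\<close> to decrease to
    the right of every non-exceptional point.\<close>
  define e where "e = (g b - g a) / (2 * (b - a))"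
  have e: "e > 0" "e * (b - a) < g b - g a"
    using gt \<open>a < b\<close> by (simp_all add: e_def divide_simps)
  define k where "k t = g t - g a - e * (t - a)" for t
  have k: "k a = 0" "k b > 0" using e by (auto simp: k_def)
  have contk: "continuous_on {a..b} k"
    unfolding k_def by (intro continuous_intros cont)
  have "\<exists>s\<in>S. k s = c" if c: "0 < c" "c < k b" for c
  proof -
    \<comment> \<open>The maximum of \<open>Z\<close> is the last point at which \<open>k\<close> is
      at most \<open>c\<close>. Since \<open>k > c\<close> to its right, it has to be
      exceptional.\<close>
    define Z where "Z = {t \<in> {a..b}. k t \<le> c}"
    have Z: "compact Z" "Z \<noteq> {}"
    proof -
      have "closed Z"
        unfolding Z_def by (intro continuous_on_closed_Collect_le continuous_on_const contk closed_atLeastAtMost)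
      moreover have "bounded Z" unfolding Z_def by (rule bounded_subset[of "{a..b}"]) auto
      ultimately show "compact Z" by (simp add: compact_eq_bounded_closed)
      show "Z \<noteq> {}" using k c ab unfolding Z_def by force
    qed
    obtain s where s: "s \<in> Z" "\<And>t. t \<in> Z \<Longrightarrow> t \<le> s"
      using compact_attains_sup[OF Z] by blast
    have sb: "a \<le> s" "s < b" "k s \<le> c"
      using s(1) c unfolding Z_def by (auto simp: order.order_iff_strict)
    have above: "k t > c" if "s < t" "t \<le> b" for t
      using s(2)[of t] that sb unfolding Z_def by fastforce
    have "k s = c"
    proof (rule ccontr)
      assume "k s \<noteq> c"
      then have "k s < c" using sb by simp
      then obtain t where "s \<le> t" "t \<le> b" "k t = c"
        using IVT'[of k s c b] c sb continuous_on_subset[OF contk, of "{s..b}"] by auto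
      with above[of t] \<open>k s < c\<close> show False by (cases "t = s") auto
    qed
    moreover have "s \<in> S"
    proof (rule ccontr)
      assume "s \<notin> S"
      then have "\<forall>\<^sub>F r in at_right s. g r - g s \<le> e / 2 * (r - s)"
        using dini[of s "e / 2"] sb e by auto
      moreover have "\<forall>\<^sub>F r in at_right s. r \<in> {s<..<b}"
        by (rule eventually_at_right_real) (use sb in auto)
      ultimately have "\<forall>\<^sub>F r in at_right s. False"
      proof eventually_elim
        case (elim r)
        then have "k r > k s" using above[of r] \<open>k s = c\<close> by auto
        moreover have "k r - k s = g r - g s - e * (r - s)" by (simp add: k_def algebra_simps)
        moreover have "e / 2 * (r - s) < e * (r - s)" using elim e by auto
        ultimately show False using elim by linarith
      qed
      then show False by simp
    qed
    ultimately show ?thesis by blast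
  qed
  \<comment> \<open>Every level in an open interval is attained on \<open>S\<close>, so the
    countable set \<open>S\<close> would have an uncountable image.\<close>
  then have "{0<..<k b} \<subseteq> k ` S" by force
  then have "countable {0<..<k b}" using S countable_subset by blast
  then show False using k(2) uncountable_open_interval by blast
qed

text \<open>\<open>dini_nonincreasing\<close> is applied to the real function
  \<open>norm (z t - z a)\<close>, whose increments are at most those of \<open>z\<close>; it
  vanishes at \<open>a\<close>, hence also at \<open>b\<close>.\<close>

lemma zero_derivative_countable_exceptions:
  fixes z :: "real \<Rightarrow> 'a::real_normed_vector"
  assumes ab: "a \<le> b" and cont: "continuous_on {a..b} z" and S: "countable S"
    and der: "\<And>t. t \<in> {a..b} - S \<Longrightarrow> (z has_vector_derivative 0) (at t within {a..b})"
  shows "z b = z a"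
proof -
  have "norm (z b - z a) \<le> norm (z a - z a)"
  proof (rule dini_nonincreasing[where g = "\<lambda>t. norm (z t - z a)", OF ab _ S])
    show "continuous_on {a..b} (\<lambda>t. norm (z t - z a))" by (intro continuous_intros cont)
  next
    fix t e :: real assume t: "t \<in> {a..<b} - S" and e: "e > 0"
    have "(z has_derivative (\<lambda>_. 0)) (at t within {a..b})"
      using der[of t] t by (auto simp: has_vector_derivative_def)
    then obtain d where d: "d > 0" "\<And>s. s \<in> {a..b} \<Longrightarrow> norm (s - t) < d \<Longrightarrow> norm (z s - z t) \<le> e * norm (s - t)"
      using e by (auto simp: has_derivative_within_alt)
    have "\<forall>\<^sub>F s in at_right t. s \<in> {t<..<min b (t + d)}"
      by (rule eventually_at_right_real) (use t d in auto)
    then show "\<forall>\<^sub>F s in at_right t. norm (z s - z a) - norm (z t - z a) \<le> e * (s - t)"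
    proof eventually_elim
      case (elim s)
      have "norm (z s - z a) - norm (z t - z a) \<le> norm (z s - z t)"
        using norm_triangle_ineq2[of "z s - z a" "z t - z a"] by simp
      also have "\<dots> \<le> e * (s - t)" using d(2)[of s] elim t by auto
      finally show ?case .
    qed
  qed
  then show ?thesis by simp
qed

section \<open>Differential equations in integral form\<close>

lemma integral_has_vector_derivative_at:
  fixes f :: "real \<Rightarrow> 'a::banach"
  assumes "f integrable_on {a..b}" "t \<in> {a..b}" "continuous (at t within {a..b}) f"
  shows "((\<lambda>u. integral {a..u} f) has_vector_derivative f t) (at t within {a..b})"
  using integral_has_vector_derivative_continuous_at[of f a b t "{}"] assms by simp

text \<open>The curve minus the indefinite integral has derivative zero off two countable sets: the
  exceptions allowed by \<open>solves_on\<close> and the jumps \<open>D\<close> of the right-hand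
  side along the curve. Together with the converse \<open>integral_imp_solves_on\<close>, this lets
  the estimates work with integral equations.\<close>

lemma solves_on_imp_integral:
  fixes z :: "real \<Rightarrow> 'a::euclidean_space"
  assumes sol: "solves_on {a..b} F z" and D: "countable D"
    and cont: "\<And>t. t \<in> {a..b} - D \<Longrightarrow> continuous (at t within {a..b}) (\<lambda>s. F s (z s))"
    and int: "(\<lambda>s. F s (z s)) integrable_on {a..b}"
    and t: "t \<in> {a..b}"
  shows "z t = z a + integral {a..t} (\<lambda>s. F s (z s))"
proof -
  obtain S where S: "countable S" "continuous_on {a..b} z"
    "\<And>t. t \<in> {a..b} - S \<Longrightarrow> (z has_vector_derivative F t (z t)) (at t within {a..b})"
    using sol unfolding solves_on_def by auto
  let ?k = "\<lambda>t. z t - integral {a..t} (\<lambda>s. F s (z s))"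
  have "?k t = ?k a"
  proof (rule zero_derivative_countable_exceptions[where S = "S \<union> D"])
    have "continuous_on {a..b} ?k"
      by (intro continuous_intros S indefinite_integral_continuous_1 int)
    then show "continuous_on {a..t} ?k" by (rule continuous_on_subset) (use t in auto)
    fix s assume s: "s \<in> {a..t} - (S \<union> D)"
    have "(?k has_vector_derivative (F s (z s) - F s (z s))) (at s within {a..b})"
      using s t by (intro has_vector_derivative_diff S integral_has_vector_derivative_at int cont) auto
    then show "(?k has_vector_derivative 0) (at s within {a..t})"
      using t by (auto intro: has_vector_derivative_within_subset)
  qed (use t S D in auto)
  then show ?thesis by (simp add: algebra_simps)
qed

lemma integral_imp_solves_on:
  fixes z :: "real \<Rightarrow> 'a::euclidean_space"
  assumes D: "countable D"
    and cont: "\<And>t. t \<in> {a..b} - D \<Longrightarrow> continuous (at t within {a..b}) (\<lambda>s. F s (z s))"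
    and int: "(\<lambda>s. F s (z s)) integrable_on {a..b}"
    and eq: "\<And>t. t \<in> {a..b} \<Longrightarrow> z t = z0 + integral {a..t} (\<lambda>s. F s (z s))"
  shows "solves_on {a..b} F z"
  unfolding solves_on_def
proof (intro conjI exI[of _ D] ballI D)
  have "continuous_on {a..b} (\<lambda>t. z0 + integral {a..t} (\<lambda>s. F s (z s)))"
    by (intro continuous_intros indefinite_integral_continuous_1 int)
  then show "continuous_on {a..b} z"
    by (rule continuous_on_eq) (simp add: eq)
  fix t assume t: "t \<in> {a..b} - D"
  have "((\<lambda>t. z0 + integral {a..t} (\<lambda>s. F s (z s))) has_vector_derivative 0 + F t (z t)) (at t within {a..b})"
    using t by (intro has_vector_derivative_add has_vector_derivative_const
        integral_has_vector_derivative_at int cont) auto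
  then show "(z has_vector_derivative F t (z t)) (at t within {a..b})"
    using t by (auto intro: has_vector_derivative_transform[rotated 2] simp flip: eq)
qed

section \<open>Gronwall inequalities\<close>

text \<open>Integrating factor: \<open>W\<close> is the majorant of \<open>e\<close> times
  \<open>exp (- L * (t - a))\<close>, and the hypothesis makes its derivative nonpositive.\<close>

lemma gronwall:
  fixes e :: "real \<Rightarrow> real"
  assumes ab: "a \<le> b" and cont: "continuous_on {a..b} e" and L: "0 \<le> L"
    and le: "\<And>t. t \<in> {a..b} \<Longrightarrow> e t \<le> c + L * integral {a..t} e"
  shows "e b \<le> c * exp (L * (b - a))"
proof -
  define W where "W t = (c + L * integral {a..t} e) * exp (- L * (t - a))" for t
  have "W b \<le> W a"
  proof (rule DERIV_nonpos_imp_decreasing_open[OF ab])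
    show "continuous_on {a..b} W"
      unfolding W_def by (intro continuous_intros indefinite_integral_continuous_1 integrable_continuous_real cont)
    fix t assume t: "a < t" "t < b"
    have "((\<lambda>u. integral {a..u} e) has_real_derivative e t) (at t within {a..b})"
      using integral_has_real_derivative[OF cont, of t] t by auto
    then have I: "((\<lambda>u. integral {a..u} e) has_real_derivative e t) (at t)"
      using t at_within_Icc_at[of a t b] by simp
    have "(W has_real_derivative (L * e t - L * (c + L * integral {a..t} e)) * exp (- L * (t - a))) (at t)"
      unfolding W_def by (rule derivative_eq_intros I refl | simp add: algebra_simps)+
    moreover have "(L * e t - L * (c + L * integral {a..t} e)) * exp (- L * (t - a)) \<le> 0"
      using mult_left_mono[OF le[of t] L] t by (intro mult_nonpos_nonneg) auto
    ultimately show "\<exists>y. (W has_real_derivative y) (at t) \<and> y \<le> 0" by blast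
  qed
  then have "(c + L * integral {a..b} e) * exp (- (L * (b - a))) \<le> c"
    by (simp add: W_def)
  then have "c + L * integral {a..b} e \<le> c * exp (L * (b - a))"
    by (simp add: exp_minus divide_simps)
  with le[of b] ab show ?thesis by auto
qed

text \<open>As \<open>g\<close> is nonnegative, its integral up to \<open>t\<close> is at most the
  one over the whole interval, a constant that joins \<open>c\<close>.\<close>

lemma gronwall_forward:
  fixes e g :: "real \<Rightarrow> real"
  assumes ab: "a \<le> b" and cont: "continuous_on {a..b} e" and L: "0 \<le> L"
    and g: "g integrable_on {a..b}" "\<And>t. t \<in> {a..b} \<Longrightarrow> 0 \<le> g t"
    and le: "\<And>t. t \<in> {a..b} \<Longrightarrow> e t \<le> c + integral {a..t} (\<lambda>s. L * e s + g s)"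
  shows "e b \<le> (c + integral {a..b} g) * exp (L * (b - a))"
proof (rule gronwall[OF ab cont L])
  fix t assume t: "t \<in> {a..b}"
  have ie: "e integrable_on {a..t}"
    by (rule integrable_continuous_real, rule continuous_on_subset[OF cont]) (use t in auto)
  have ig: "g integrable_on {a..t}"
    by (rule integrable_on_subinterval[OF g(1)]) (use t in auto)
  have "integral {a..t} (\<lambda>s. L * e s + g s) = L * integral {a..t} e + integral {a..t} g"
    by (subst integral_add) (auto intro: integrable_on_mult_right ie ig)
  moreover have "integral {a..t} g \<le> integral {a..b} g"
    by (rule integral_subset_le) (use t g ig in auto)
  ultimately show "e t \<le> c + integral {a..b} g + L * integral {a..t} e"
    using le[OF t] by simp
qed

text \<open>Time reversal of \<open>gronwall_forward\<close>; it serves to bound and to identify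
  predictor trajectories by their terminal value.\<close>

lemma gronwall_backward:
  fixes e g :: "real \<Rightarrow> real"
  assumes ab: "a \<le> b" and cont: "continuous_on {a..b} e" and L: "0 \<le> L"
    and g: "g integrable_on {a..b}" "\<And>t. t \<in> {a..b} \<Longrightarrow> 0 \<le> g t"
    and le: "\<And>t. t \<in> {a..b} \<Longrightarrow> e t \<le> c + integral {t..b} (\<lambda>s. L * e s + g s)"
  shows "e a \<le> (c + integral {a..b} g) * exp (L * (b - a))"
proof -
  have "(e \<circ> uminus) (- a) \<le> (c + integral {-b..-a} (g \<circ> uminus)) * exp (L * (- a - (- b)))"
  proof (rule gronwall_forward)
    show "continuous_on {-b..-a} (e \<circ> uminus)"
      by (intro continuous_on_compose continuous_intros) (use cont in simp)
    fix t assume t: "t \<in> {-b..-a}"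
    have "integral {-b..t} (\<lambda>s. L * (e \<circ> uminus) s + (g \<circ> uminus) s) = integral {-t..b} (\<lambda>s. L * e s + g s)"
      using Henstock_Kurzweil_Integration.integral_reflect_real[of b "-t" "\<lambda>s. L * e s + g s"] by (simp add: o_def)
    then show "(e \<circ> uminus) t \<le> c + integral {-b..t} (\<lambda>s. L * (e \<circ> uminus) s + (g \<circ> uminus) s)"
      using le[of "-t"] t by simp
  qed (use ab L g in \<open>auto simp: o_def\<close>)
  then show ?thesis by (simp add: o_def)
qed


text \<open>\<open>F\<close> need only be integrable along continuous curves, so right-hand sides
  with jumps in time are covered. The Lipschitz bound is global in the state, so the solution exists
  on the whole interval; data given on a ball are handled later by composing with a
  projection.\<close>

lemma picard_lindelof:
  fixes F :: "real \<Rightarrow> 'a::euclidean_space \<Rightarrow> 'a"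
  assumes ab: "a \<le> b"
    and lip: "\<And>t z w. t \<in> {a..b} \<Longrightarrow> norm (F t z - F t w) \<le> L * norm (z - w)"
    and int: "\<And>z. continuous_on {a..b} z \<Longrightarrow> (\<lambda>t. F t (z t)) integrable_on {a..b}"
  obtains z where "continuous_on {a..b} z"
    "\<And>t. t \<in> {a..b} \<Longrightarrow> z t = z0 + integral {a..t} (\<lambda>s. F s (z s))"
proof -
  define K where "K = max L 1"
  have K: "K > 0" by (simp add: K_def)
  have lipK: "norm (F t z - F t w) \<le> K * norm (z - w)" if "t \<in> {a..b}" for t z w
    using lip[OF that, of z w] mult_right_mono[of L K "norm (z - w)"] by (simp add: K_def)
  define Z where "Z = rec_nat (\<lambda>_. z0) (\<lambda>n zn t. z0 + integral {a..t} (\<lambda>s. F s (zn s)))"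
  have Z0: "Z 0 = (\<lambda>_. z0)" and ZS: "Z (Suc n) = (\<lambda>t. z0 + integral {a..t} (\<lambda>s. F s (Z n s)))" for n
    by (simp_all add: Z_def)
  have contZ: "continuous_on {a..b} (Z n)" for n
    by (induction n) (auto simp: Z0 ZS intro!: continuous_intros indefinite_integral_continuous_1 int)
  have intZ: "(\<lambda>s. F s (z s)) integrable_on {a..t}" if "t \<in> {a..b}" "continuous_on {a..b} z" for z t
    by (rule integrable_on_subinterval[OF int[OF that(2)]]) (use that in auto)
  obtain M where M: "\<And>t. t \<in> {a..b} \<Longrightarrow> norm (Z 1 t - Z 0 t) \<le> M"
  proof -
    have "compact ((\<lambda>t. Z 1 t - Z 0 t) ` {a..b})"
      by (intro compact_continuous_image continuous_intros contZ) auto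
    then have "bounded ((\<lambda>t. Z 1 t - Z 0 t) ` {a..b})" by (rule compact_imp_bounded)
    then obtain M where "\<forall>y\<in>(\<lambda>t. Z 1 t - Z 0 t) ` {a..b}. norm y \<le> M"
      unfolding bounded_iff by blast
    then show ?thesis by (intro that[of M]) auto
  qed
  have M0: "M \<ge> 0" by (rule order_trans[OF norm_ge_zero M[of a]]) (use ab in simp)
  \<comment> \<open>Weighted bound: integrating \<open>K * exp (2 * K * (s - a))\<close> over
    \<open>[a, t]\<close> gives at most half of \<open>exp (2 * K * (t - a))\<close>, so each
    iteration gains a factor 1/2 whatever the length of the interval.\<close>
  have step: "norm (Z (Suc n) t - Z n t) \<le> M * (1/2)^n * exp (2 * K * (t - a))" if "t \<in> {a..b}" for n t
    using that
  proof (induction n arbitrary: t)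
    case 0
    have "1 \<le> exp (2 * K * (t - a))" using 0 K by simp
    then have "M * 1 \<le> M * exp (2 * K * (t - a))" by (rule mult_left_mono[OF _ M0])
    with M[OF 0] show ?case by simp
  next
    case (Suc n)
    define c where "c = M * (1/2)^n"
    have I: "((\<lambda>s. K * (c * exp (2 * K * (s - a)))) has_integral c/2 * exp (2 * K * (t - a)) - c/2 * exp (2 * K * (a - a))) {a..t}"
      by (rule fundamental_theorem_of_calculus)
        (use Suc.prems K in \<open>auto intro!: derivative_eq_intros
           simp: has_real_derivative_iff_has_vector_derivative[symmetric]\<close>)
    have "norm (Z (Suc (Suc n)) t - Z (Suc n) t) = norm (integral {a..t} (\<lambda>s. F s (Z (Suc n) s) - F s (Z n s)))"
      using integral_diff[OF intZ[OF Suc.prems contZ[of "Suc n"]] intZ[OF Suc.prems contZ[of n]]]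
      by (simp only: ZS[of "Suc n"] ZS[of n]) simp
    also have "\<dots> \<le> integral {a..t} (\<lambda>s. K * (c * exp (2 * K * (s - a))))"
    proof (rule integral_norm_bound_integral)
      show "(\<lambda>s. F s (Z (Suc n) s) - F s (Z n s)) integrable_on {a..t}"
        by (intro integrable_diff intZ contZ Suc.prems)
      fix s assume s: "s \<in> {a..t}"
      then have "norm (F s (Z (Suc n) s) - F s (Z n s)) \<le> K * norm (Z (Suc n) s - Z n s)"
        using Suc.prems by (intro lipK) auto
      also have "\<dots> \<le> K * (c * exp (2 * K * (s - a)))"
        using Suc.IH[of s] s Suc.prems K by (intro mult_left_mono) (auto simp: c_def)
      finally show "norm (F s (Z (Suc n) s) - F s (Z n s)) \<le> K * (c * exp (2 * K * (s - a)))" .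
    qed (use I in auto)
    also have "\<dots> \<le> c / 2 * exp (2 * K * (t - a))"
      unfolding integral_unique[OF I] using M0 by (simp add: c_def)
    finally show ?case by (simp add: c_def)
  qed
  define C where "C = M * exp (2 * K * (b - a))"
  have stepC: "norm (Z (Suc n) t - Z n t) \<le> C * (1/2)^n" if "t \<in> {a..b}" for n t
  proof -
    have "M * (1/2)^n * exp (2 * K * (t - a)) \<le> M * (1/2)^n * exp (2 * K * (b - a))"
      using that K M0 by (intro mult_left_mono) auto
    with step[OF that, of n] show ?thesis by (simp add: C_def mult_ac)
  qed
  define z where "z t = z0 + (\<Sum>n. Z (Suc n) t - Z n t)" for t
  have "uniform_limit {a..b} (\<lambda>n t. \<Sum>i<n. Z (Suc i) t - Z i t) (\<lambda>t. \<Sum>n. Z (Suc n) t - Z n t) sequentially"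
    by (rule Weierstrass_m_test[OF stepC]) (auto intro: summable_mult summable_geometric)
  then have "uniform_limit {a..b} (\<lambda>n t. z0 + (\<Sum>i<n. Z (Suc i) t - Z i t)) z sequentially"
    unfolding z_def by (intro uniform_limit_add uniform_limit_const)
  moreover have "z0 + (\<Sum>i<n. Z (Suc i) t - Z i t) = Z n t" for n t
    using sum_lessThan_telescope[of "\<lambda>i. Z i t" n] by (simp only: fun_cong[OF Z0]) simp
  ultimately have lim: "uniform_limit {a..b} Z z sequentially" by simp
  have contz: "continuous_on {a..b} z"
    by (rule uniform_limit_theorem[OF _ lim]) (use contZ in auto)
  have "z t = z0 + integral {a..t} (\<lambda>s. F s (z s))" if t: "t \<in> {a..b}" for t
  proof -
    let ?d = "norm (z t - (z0 + integral {a..t} (\<lambda>s. F s (z s))))"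
    have "?d \<le> e" if "e > 0" for e
    proof -
      define e' where "e' = e / (1 + K * (b - a))"
      have pos: "1 + K * (b - a) > 0" using K ab by (simp add: add_pos_nonneg)
      then have e': "e' > 0" "e' * (1 + K * (b - a)) = e" using \<open>e > 0\<close> by (auto simp: e'_def)
      obtain N where N: "\<And>n s. n \<ge> N \<Longrightarrow> s \<in> {a..b} \<Longrightarrow> dist (Z n s) (z s) < e'"
        using uniform_limitD[OF lim e'(1)] unfolding eventually_sequentially by blast
      have "norm (integral {a..t} (\<lambda>s. F s (Z N s)) - integral {a..t} (\<lambda>s. F s (z s)))
          = norm (integral {a..t} (\<lambda>s. F s (Z N s) - F s (z s)))"
        by (simp add: integral_diff intZ[OF t contZ] intZ[OF t contz])
      also have "\<dots> \<le> integral {a..t} (\<lambda>s. K * e')"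
      proof (rule integral_norm_bound_integral)
        fix s assume s: "s \<in> {a..t}"
        have "norm (F s (Z N s) - F s (z s)) \<le> K * norm (Z N s - z s)"
          using s t by (intro lipK) auto
        also have "\<dots> \<le> K * e'"
          using N[of N s] s t K by (intro mult_left_mono) (auto simp: dist_norm)
        finally show "norm (F s (Z N s) - F s (z s)) \<le> K * e'" .
      qed (auto intro!: integrable_diff intZ[OF t] contZ contz)
      also have "\<dots> \<le> K * e' * (b - a)"
        using t K e' by (auto simp: mult.commute[of _ "K * e'"] intro!: mult_left_mono)
      finally have "norm (integral {a..t} (\<lambda>s. F s (Z N s)) - integral {a..t} (\<lambda>s. F s (z s))) \<le> K * e' * (b - a)" .
      moreover have "norm (z t - Z (Suc N) t) < e'"
        using N[of "Suc N" t] t by (simp add: dist_norm norm_minus_commute)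
      moreover have "?d \<le> norm (z t - Z (Suc N) t) + norm (integral {a..t} (\<lambda>s. F s (Z N s)) - integral {a..t} (\<lambda>s. F s (z s)))"
        by (rule order_trans[OF _ norm_triangle_ineq]) (simp add: ZS algebra_simps)
      ultimately have "?d \<le> e' * (1 + K * (b - a))" by (simp add: algebra_simps)
      then show ?thesis by (simp add: e')
    qed
    then have "?d \<le> 0" by (rule field_le_epsilon[of _ 0, simplified])
    then show ?thesis by simp
  qed
  with contz show ?thesis by (rule that)
qed

subsection \<open>Piecewise continuous inputs\<close>

text \<open>The one-sided limits bound \<open>g\<close> near each point of the closure, and finitely
  many such neighbourhoods cover it. Points of the closure outside \<open>T\<close> count: without a
  limit there, \<open>g\<close> could blow up at a missing endpoint.\<close>

lemma piecewise_continuous_on_bounded: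
  fixes g :: "real \<Rightarrow> 'a::real_normed_vector"
  assumes pc: "piecewise_continuous_on T g" and T: "bounded T"
  shows "bounded (g ` T)"
proof -
  have ev: "\<exists>C. \<forall>\<^sub>F s in at t within A. norm (g s) \<le> C" if "\<exists>l. (g \<longlongrightarrow> l) (at t within A)" for t A
  proof -
    obtain l where "(g \<longlongrightarrow> l) (at t within A)" using \<open>\<exists>l. _ l\<close> by blast
    then have "((\<lambda>s. norm (g s)) \<longlongrightarrow> norm l) (at t within A)" by (rule tendsto_norm)
    then have "\<forall>\<^sub>F s in at t within A. norm (g s) < norm l + 1"
      by (rule order_tendstoD(2)) simp
    then show ?thesis by (intro exI[of _ "norm l + 1"]) (auto elim: eventually_mono)
  qed
  have "\<exists>V. open V \<and> t \<in> V \<and> bounded (g ` (T \<inter> V))" if t: "t \<in> closure T" for t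
  proof -
    obtain C1 C2 where "\<forall>\<^sub>F s in at t within (T \<inter> {..<t}). norm (g s) \<le> C1"
      "\<forall>\<^sub>F s in at t within (T \<inter> {t<..}). norm (g s) \<le> C2"
      using pc t ev unfolding piecewise_continuous_on_def by meson
    then obtain O1 O2 where O: "open O1" "t \<in> O1" "open O2" "t \<in> O2"
      "\<And>s. s \<in> O1 \<Longrightarrow> s \<in> T \<Longrightarrow> s < t \<Longrightarrow> norm (g s) \<le> C1"
      "\<And>s. s \<in> O2 \<Longrightarrow> s \<in> T \<Longrightarrow> s > t \<Longrightarrow> norm (g s) \<le> C2"
      unfolding eventually_at_topological by auto
    have "norm (g s) \<le> max (norm (g t)) (max C1 C2)" if "s \<in> T \<inter> (O1 \<inter> O2)" for s
      using O(5)[of s] O(6)[of s] that by (cases s t rule: linorder_cases) (auto simp: le_max_iff_disj)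
    then have "bounded (g ` (T \<inter> (O1 \<inter> O2)))"
      unfolding bounded_iff by blast
    then show ?thesis using O by (intro exI[of _ "O1 \<inter> O2"]) auto
  qed
  then obtain Op where Op: "\<And>t. t \<in> closure T \<Longrightarrow> open (Op t) \<and> t \<in> Op t \<and> bounded (g ` (T \<inter> Op t))"
    by metis
  have "compact (closure T)" using T by (simp add: compact_closure)
  then obtain D where D: "D \<subseteq> closure T" "finite D" "closure T \<subseteq> (\<Union>t\<in>D. Op t)"
    by (rule compactE_image[where f = Op and C = "closure T"]) (use Op in auto)
  have "bounded (\<Union>t\<in>D. g ` (T \<inter> Op t))" using D Op by (intro bounded_UN) auto
  then show ?thesis
    by (rule bounded_subset) (use D(3) closure_subset[of T] in blast)
qed

text \<open>A total function on the line with two-sided continuity: the histories at all times are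
  then translates of one function, and no statement has to carry the interval on which the input is
  given.\<close>

definition admissible_input :: "(real \<Rightarrow> 'a::real_normed_vector) \<Rightarrow> bool" where
  "admissible_input U \<longleftrightarrow> bounded (range U) \<and> finite {w. \<not> isCont U w}"

text \<open>Extension by zero can add discontinuities only at \<open>a\<close> and \<open>b\<close>,
  whether or not they belong to \<open>T\<close>.\<close>

lemma piecewise_continuous_on_admissible:
  assumes pc: "piecewise_continuous_on T g" and T: "{a<..<b} \<subseteq> T" "T \<subseteq> {a..b}"
  shows "admissible_input (\<lambda>w. if w \<in> T then g w else 0)"
proof -
  let ?U = "\<lambda>w. if w \<in> T then g w else 0"
  have "bounded (g ` T)"
    by (rule piecewise_continuous_on_bounded[OF pc bounded_subset[OF bounded_closed_interval T(2)]])
  then have "bounded (insert 0 (g ` T))" by simp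
  then have "bounded (range ?U)" by (rule bounded_subset) auto
  moreover have "isCont ?U w" if w: "w \<noteq> a" "w \<noteq> b" "w \<notin> {t \<in> T. \<not> continuous (at t within T) g}" for w
  proof (cases "w \<in> T")
    case True
    then have ab: "w \<in> {a<..<b}" using T w by force
    have "continuous (at w within T) g" using w True by blast
    then have "continuous (at w within {a<..<b}) g" by (rule continuous_within_subset[OF _ T(1)])
    then have "isCont g w" by (simp only: at_within_open[OF ab open_greaterThanLessThan])
    moreover have "\<forall>\<^sub>F s in nhds w. g s = ?U s"
      using eventually_nhds_in_open[OF open_greaterThanLessThan ab]
      by (rule eventually_mono) (use T in auto)
    ultimately show ?thesis by (simp add: isCont_cong)
  next
    case False
    then have ab: "w \<in> - {a..b}" using T w by force
    have "\<forall>\<^sub>F s in nhds w. ?U s = 0"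
      using eventually_nhds_in_open[OF open_Compl[OF closed_atLeastAtMost] ab]
      by (rule eventually_mono) (use T in auto)
    then show ?thesis using isCont_cong[of ?U "\<lambda>_. 0" w] by simp
  qed
  then have "{w. \<not> isCont ?U w} \<subseteq> {a, b} \<union> {t \<in> T. \<not> continuous (at t within T) g}" by blast
  then have "finite {w. \<not> isCont ?U w}"
    by (rule finite_subset) (use pc in \<open>auto simp: piecewise_continuous_on_def\<close>)
  ultimately show ?thesis by (simp add: admissible_input_def)
qed

lemma admissible_input_shift:
  assumes "admissible_input U"
  shows "admissible_input (\<lambda>w. U (t + w))"
proof -
  have "isCont (\<lambda>w. U (t + w)) w" if "isCont U (t + w)" for w
    using isCont_o2[of w "\<lambda>w. t + w" U] that by simp
  then have "{w. \<not> isCont (\<lambda>w. U (t + w)) w} \<subseteq> (\<lambda>w. w - t) ` {w. \<not> isCont U w}"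
    by (auto intro!: rev_image_eqI[of "t + _"])
  then have "finite {w. \<not> isCont (\<lambda>w. U (t + w)) w}"
    using assms by (auto simp: admissible_input_def intro: finite_subset)
  moreover have "bounded (range (\<lambda>w. U (t + w)))"
    using assms by (auto simp: admissible_input_def elim!: bounded_subset)
  ultimately show ?thesis by (simp add: admissible_input_def)
qed

lemma admissible_input_bound:
  assumes "admissible_input U"
  obtains C where "C \<ge> 0" "\<And>w. norm (U w) \<le> C"
proof -
  obtain C where C: "\<And>w. norm (U w) \<le> C"
    using assms by (auto simp: admissible_input_def bounded_iff)
  moreover have "C \<ge> 0" using order_trans[OF norm_ge_zero C] .
  ultimately show ?thesis using that by blast
qed

lemma admissible_input_integrable:
  fixes U :: "real \<Rightarrow> 'a::real_normed_vector" and g :: "real \<Rightarrow> 'a \<Rightarrow> 'b::euclidean_space"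
  assumes U: "admissible_input U"
    and cont: "\<And>w. isCont U w \<Longrightarrow> isCont (\<lambda>w. g w (U w)) w"
    and bound: "\<And>w. w \<in> {a..b} \<Longrightarrow> norm (g w (U w)) \<le> C"
  shows "(\<lambda>w. g w (U w)) integrable_on {a..b}"
proof (rule integrable_countable_discontinuities[where S = "{w. \<not> isCont U w}"])
  show "countable {w. \<not> isCont U w}" using U by (auto simp: admissible_input_def countable_finite)
qed (use bound cont in \<open>auto intro: continuous_at_imp_continuous_at_within\<close>)

lemma admissible_input_norm_integrable:
  assumes U: "admissible_input U"
  shows "(\<lambda>w. norm (U w)) integrable_on {a..b}"
proof -
  obtain C where C: "\<And>w. norm (U w) \<le> C" using admissible_input_bound[OF U] by blast
  show ?thesis
    by (rule admissible_input_integrable[OF U, of "\<lambda>_. norm" _ _ C]) (auto simp: C)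
qed

lemma admissible_input_sqnorm_integrable:
  assumes U: "admissible_input U"
  shows "(\<lambda>w. (norm (U w))\<^sup>2) integrable_on {a..b}"
proof -
  obtain C where C: "\<And>w. norm (U w) \<le> C" using admissible_input_bound[OF U] by blast
  show ?thesis
    by (rule admissible_input_integrable[OF U, of "\<lambda>_ x. (norm x)\<^sup>2" _ _ "C\<^sup>2"])
      (auto simp: C power_mono intro!: continuous_intros)
qed

text \<open>Cauchy-Schwarz, from integrating the square of \<open>norm (U w) - m\<close> with
  \<open>m\<close> the mean value of \<open>norm (U w)\<close>. With \<open>b - a = h\<close> it is
  the source of the factor \<open>sqrt h\<close> in \<open>transform_gain\<close>.\<close>

lemma L1_le_L2_norm:
  assumes U: "admissible_input U" and ab: "a \<le> b"
  shows "integral {a..b} (\<lambda>w. norm (U w)) \<le> sqrt (b - a) * sqrt (integral {a..b} (\<lambda>w. (norm (U w))\<^sup>2))"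
proof (cases "a = b")
  case False
  then have "b - a > 0" using ab by simp
  let ?I = "integral {a..b} (\<lambda>w. norm (U w))"
  let ?J = "integral {a..b} (\<lambda>w. (norm (U w))\<^sup>2)"
  note int = admissible_input_norm_integrable[OF U, of a b] admissible_input_sqnorm_integrable[OF U, of a b]
  define m where "m = ?I / (b - a)"
  have "0 \<le> integral {a..b} (\<lambda>w. (norm (U w))\<^sup>2 - 2 * m * norm (U w) + m\<^sup>2)"
  proof (rule integral_nonneg)
    show "(\<lambda>w. (norm (U w))\<^sup>2 - 2 * m * norm (U w) + m\<^sup>2) integrable_on {a..b}"
      by (intro integrable_add integrable_diff integrable_on_mult_right int) auto
    show "0 \<le> (norm (U w))\<^sup>2 - 2 * m * norm (U w) + m\<^sup>2" for w
      using zero_le_power2[of "norm (U w) - m"] by (simp add: power2_diff algebra_simps)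
  qed
  also have "\<dots> = integral {a..b} (\<lambda>w. (norm (U w))\<^sup>2 - 2 * m * norm (U w)) + integral {a..b} (\<lambda>w. m\<^sup>2)"
    by (intro integral_add integrable_diff integrable_on_mult_right int) auto
  also have "\<dots> = ?J - 2 * m * ?I + m\<^sup>2 * (b - a)"
    using ab by (subst integral_diff) (auto intro!: integrable_on_mult_right int)
  finally have "0 \<le> ?J - 2 * m * ?I + m * (m * (b - a))" by (simp add: power2_eq_square mult_ac)
  moreover have I: "m * (b - a) = ?I" using \<open>b - a > 0\<close> by (simp add: m_def)
  ultimately have "m * ?I \<le> ?J" by simp
  then have "(b - a) * (m * ?I) \<le> (b - a) * ?J" using \<open>b - a > 0\<close> by (intro mult_left_mono) auto
  also have "(b - a) * (m * ?I) = ?I\<^sup>2" by (simp add: power2_eq_square I[symmetric] mult_ac)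
  finally have "?I\<^sup>2 \<le> (b - a) * ?J" .
  then have "?I \<le> sqrt ((b - a) * ?J)" by (rule real_le_rsqrt)
  then show ?thesis by (simp add: real_sqrt_mult)
qed simp

text \<open>Translation by \<open>t\<close> carries continuity and one-sided limits over. The limit
  from the left at 0, a point only of the closure of the history interval, is the left limit of
  \<open>u\<close> at \<open>t\<close>.\<close>

lemma segment_in_PC_hist:
  assumes pc: "piecewise_continuous_on {-h..t} u" and t: "0 \<le> t" and h: "0 < h"
  shows "segment h u t \<in> PC_hist h"
proof -
  let ?S = "{-h..<0}" and ?T = "{-h..t}"
  have lim: "\<exists>l. (segment h u t \<longlongrightarrow> l) (at \<theta> within A)"
    if ex: "\<exists>l. (u \<longlongrightarrow> l) (at (t + \<theta>) within B)" and A: "A \<subseteq> ?S" "\<And>r. r \<in> A \<Longrightarrow> t + r \<in> B" for A B \<theta>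
  proof -
    obtain l where l: "(u \<longlongrightarrow> l) (at (t + \<theta>) within B)" using ex by blast
    have f: "filterlim (\<lambda>\<theta>. t + \<theta>) (at (t + \<theta>) within B) (at \<theta> within A)"
      unfolding filterlim_at
    proof
      show "\<forall>\<^sub>F r in at \<theta> within A. t + r \<in> B \<and> t + r \<noteq> t + \<theta>"
        using A by (auto simp: eventually_at_filter)
    qed (intro tendsto_intros)
    have "((\<lambda>r. u (t + r)) \<longlongrightarrow> l) (at \<theta> within A)"
      by (rule filterlim_compose[OF l f])
    moreover have "\<forall>\<^sub>F r in at \<theta> within A. u (t + r) = segment h u t r"
      using A by (auto simp: eventually_at_filter segment_def intro!: always_eventually dest!: subsetD)
    ultimately show ?thesis by (auto dest: Lim_transform_eventually)
  qed
  have cont: "continuous (at \<theta> within ?S) (segment h u t)"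
    if "continuous (at (t + \<theta>) within ?T) u" "\<theta> \<in> ?S" for \<theta>
  proof -
    have "continuous (at (t + \<theta>) within ((\<lambda>r. t + r) ` ?S)) u"
      by (rule continuous_within_subset[OF that(1)]) (use t in auto)
    then have "continuous (at \<theta> within ?S) (u \<circ> (\<lambda>r. t + r))"
      by (intro continuous_within_compose) (auto intro: continuous_intros)
    then show ?thesis
      by (rule continuous_transform_within[of _ _ _ 1]) (use that in \<open>auto simp: segment_def\<close>)
  qed
  have "{\<theta> \<in> ?S. \<not> continuous (at \<theta> within ?S) (segment h u t)}
      \<subseteq> (\<lambda>w. w - t) ` {w \<in> ?T. \<not> continuous (at w within ?T) u}"
  proof
    fix \<theta> assume "\<theta> \<in> {\<theta> \<in> ?S. \<not> continuous (at \<theta> within ?S) (segment h u t)}"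
    then have "t + \<theta> \<in> {w \<in> ?T. \<not> continuous (at w within ?T) u}" using cont[of \<theta>] t by auto
    then show "\<theta> \<in> (\<lambda>w. w - t) ` {w \<in> ?T. \<not> continuous (at w within ?T) u}"
      by (rule rev_image_eqI) simp
  qed
  moreover have "finite \<dots>" using pc by (auto simp: piecewise_continuous_on_def)
  ultimately have fin: "finite {\<theta> \<in> ?S. \<not> continuous (at \<theta> within ?S) (segment h u t)}"
    by (rule finite_subset)
  have "(\<exists>l. (segment h u t \<longlongrightarrow> l) (at \<theta> within (?S \<inter> {..<\<theta>}))) \<and>
        (\<exists>l. (segment h u t \<longlongrightarrow> l) (at \<theta> within (?S \<inter> {\<theta><..})))" if "\<theta> \<in> closure ?S" for \<theta>
  proof -
    have "t + \<theta> \<in> closure ?T" using that t h by simp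
    then have "(\<exists>l. (u \<longlongrightarrow> l) (at (t + \<theta>) within (?T \<inter> {..<t + \<theta>})))"
       "(\<exists>l. (u \<longlongrightarrow> l) (at (t + \<theta>) within (?T \<inter> {t + \<theta><..})))"
      using pc unfolding piecewise_continuous_on_def by blast+
    then show ?thesis by (intro conjI; elim lim) (use t in auto)
  qed
  with fin show ?thesis by (auto simp: PC_hist_def piecewise_continuous_on_def segment_def)
qed

text \<open>The integral runs over the closed interval, but a history is specified only on
  \<open>{-h..<0}\<close>; the point 0 is negligible.\<close>

lemma hist_sqnorm_cong:
  assumes "\<And>\<theta>. \<theta> \<in> {-h..<0} \<Longrightarrow> norm (\<phi> \<theta>) = norm (U (t + \<theta>))"
  shows "hist_sqnorm h \<phi> = integral {t-h..t} (\<lambda>w. (norm (U w))\<^sup>2)"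
proof -
  have "hist_sqnorm h \<phi> = integral {-h..0} (\<lambda>\<theta>. (norm (U (\<theta> + t)))\<^sup>2)"
    unfolding hist_sqnorm_def
    by (rule integral_spike[of "{0}"]) (use assms in \<open>auto simp: add.commute\<close>)
  also have "\<dots> = integral {t-h..t} (\<lambda>w. (norm (U w))\<^sup>2)"
    using integral_shift_real_ivl[of "t-h" t t "\<lambda>w. (norm (U w))\<^sup>2"] by simp
  finally show ?thesis .
qed

subsection \<open>The predictor equation\<close>

text \<open>Cauchy-Schwarz in each row; the norm of a matrix here is the Frobenius norm.\<close>

lemma norm_matrix_vector_mult_le:
  fixes M :: "real^'n^'m"
  shows "norm (M *v x) \<le> norm M * norm x"
proof -
  have "norm (M *v x) \<le> L2_set (\<lambda>i. norm (M $ i) * norm x) UNIV"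
    unfolding norm_vec_def[of "M *v x"]
    by (intro L2_set_mono) (simp_all add: matrix_vector_mul_component Cauchy_Schwarz_ineq2)
  also have "\<dots> = norm M * norm x"
    by (simp add: norm_vec_def[of M] L2_set_left_distrib)
  finally show ?thesis .
qed

lemma matrix_of_columns_mult_vec:
  "matrix_of_columns c *v x = (\<Sum>i\<in>UNIV. x $ i *\<^sub>R c i)"
  by (simp add: matrix_of_columns_def matrix_vector_mult_def vec_eq_iff mult.commute)

lemma norm_matrix_of_columns_le:
  fixes c :: "'m::finite \<Rightarrow> real^'n"
  assumes "\<And>i. norm (c i) \<le> C"
  shows "norm (matrix_of_columns c) \<le> real CARD('n) * real CARD('m) * C"
proof -
  have "norm (matrix_of_columns c $ j) \<le> real CARD('m) * C" for j
  proof -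
    have "norm (matrix_of_columns c $ j) \<le> (\<Sum>i\<in>UNIV. \<bar>matrix_of_columns c $ j $ i\<bar>)"
      by (rule norm_le_l1_cart)
    also have "\<dots> \<le> (\<Sum>i\<in>(UNIV::'m set). C)"
      using assms by (intro sum_mono) (auto simp: matrix_of_columns_def intro: order_trans[OF component_le_norm_cart])
    finally show ?thesis by simp
  qed
  then have "L2_set (\<lambda>j. norm (matrix_of_columns c $ j)) UNIV \<le> (\<Sum>j\<in>(UNIV::'n set). real CARD('m) * C)"
    by (intro order_trans[OF L2_set_le_sum] sum_mono) auto
  then show ?thesis by (simp add: norm_vec_def[of "matrix_of_columns c"])
qed

text \<open>\<open>R\<close> may be infinite, so compactness arguments are run on balls of a real
  radius \<open>r\<close> with \<open>ereal r \<le> R\<close>; this inclusion places them in the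
  domain of the data.\<close>

lemma cball_subset_origin_ball:
  assumes "ereal r \<le> R"
  shows "cball 0 r \<subseteq> origin_ball R"
proof
  fix x :: 'a assume "x \<in> cball 0 r"
  then have x: "norm x \<le> r" by simp
  show "x \<in> origin_ball R"
  proof (cases R)
    case (real s)
    then have "norm x \<le> s" using x assms by simp
    then show ?thesis using real by (simp add: origin_ball_def power_mono)
  qed (use assms x norm_ge_zero[of x] in \<open>auto simp: origin_ball_def power2_eq_square\<close>)
qed

lemma origin_ball_eq_cball: "r \<ge> 0 \<Longrightarrow> origin_ball (ereal r) = cball 0 r"
  by (auto simp: origin_ball_def abs_le_square_iff[symmetric])

lemma origin_ball_infinity: "origin_ball \<infinity> = UNIV"
  by (auto simp: origin_ball_def power2_eq_square)

lemma convex_closed_origin_ball: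
  assumes "R > 0"
  shows "convex (origin_ball R)" "closed (origin_ball R)"
  using assms by (cases R; auto simp: origin_ball_eq_cball origin_ball_infinity)+

text \<open>Trades a moving upper limit for a cut-off on a fixed interval, as dominated convergence
  requires.\<close>

lemma integral_indicator_Icc:
  fixes g :: "real \<Rightarrow> 'a::banach"
  assumes "c \<le> b"
  shows "integral {a..b} (\<lambda>x. if x \<le> c then g x else 0) = integral {a..c} g"
proof -
  have "{..c} \<inter> {a..b} = {a..c}" using assms by auto
  then show ?thesis using integral_restrict_Int[of "{a..b}" "{..c}" g] by (simp only: atMost_iff)
qed

text \<open>\<open>predictor_rhs U \<tau>\<close> is the right-hand side of the predictor equation in absolute time,
  for the input \<open>U\<close> and the initial time \<open>\<tau>\<close>; all trajectories below live on \<open>[\<tau>, \<tau> + h]\<close>.\<close>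

locale predictor_system =
  fixes h :: real and R :: ereal and M_f :: real
    and f :: "real^'n \<Rightarrow> real^'n" and A :: "real^'n \<Rightarrow> real^'n^'n"
    and B1 :: "real^'n \<Rightarrow> real^'m^'n" and DB1 :: "'m::finite \<Rightarrow> real^'n \<Rightarrow> real^'n^'n"
    and Bint :: "real \<Rightarrow> real^'n \<Rightarrow> real^'m^'n" and DBint :: "'m \<Rightarrow> real \<Rightarrow> real^'n \<Rightarrow> real^'n^'n"
  assumes standing: "standing_assumptions h R M_f f A B1 DB1 Bint DBint"
begin

lemma h_pos: "h > 0" and R_pos: "R > 0"
  and f_growth: "x \<in> origin_ball R \<Longrightarrow> norm (f x) \<le> M_f * norm x"
  and f_deriv: "x \<in> origin_ball R \<Longrightarrow> (f has_derivative (\<lambda>d. A x *v d)) (at x within origin_ball R)"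
  and A_cont: "continuous_on (origin_ball R) A"
  and B1_bounded: "bounded (B1 ` origin_ball R)"
  and B1_deriv: "x \<in> origin_ball R \<Longrightarrow>
        (B1 has_derivative (\<lambda>d. matrix_of_columns (\<lambda>i. DB1 i x *v d))) (at x within origin_ball R)"
  and DB1_cont: "continuous_on (origin_ball R) (DB1 i)"
  and Bint_bounded: "bounded ((\<lambda>(\<theta>, x). Bint \<theta> x) ` ({-h..0} \<times> origin_ball R))"
  and Bint_pc: "x \<in> origin_ball R \<Longrightarrow> piecewise_continuous_on {-h..0} (\<lambda>\<theta>. Bint \<theta> x)"
  and Bint_deriv: "\<theta> \<in> {-h..0} \<Longrightarrow> x \<in> origin_ball R \<Longrightarrow>
        (Bint \<theta> has_derivative (\<lambda>d. matrix_of_columns (\<lambda>i. DBint i \<theta> x *v d))) (at x within origin_ball R)"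
  and DBint_cont: "\<theta> \<in> {-h..0} \<Longrightarrow> continuous_on (origin_ball R) (DBint i \<theta>)"
  and DBint_bounded: "K \<subseteq> origin_ball R \<Longrightarrow> compact K \<Longrightarrow>
        bounded ((\<lambda>(\<theta>, x). DBint i \<theta> x) ` ({-h..0} \<times> K))"
proof -
  note c = standing[unfolded standing_assumptions_def]
  show "h > 0"
    by (use c[THEN conjunct1] in blast)
  show "R > 0"
    by (use c[THEN conjunct2, THEN conjunct1] in blast)
  show "x \<in> origin_ball R \<Longrightarrow> norm (f x) \<le> M_f * norm x"
    by (use c[THEN conjunct2, THEN conjunct2, THEN conjunct1] in blast)
  show "x \<in> origin_ball R \<Longrightarrow> (f has_derivative (\<lambda>d. A x *v d)) (at x within origin_ball R)"
    by (use c[THEN conjunct2, THEN conjunct2, THEN conjunct2, THEN conjunct1] in blast)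
  show "continuous_on (origin_ball R) A"
    by (use c[THEN conjunct2, THEN conjunct2, THEN conjunct2, THEN conjunct2, THEN conjunct1] in blast)
  show "bounded (B1 ` origin_ball R)"
    by (use c[THEN conjunct2, THEN conjunct2, THEN conjunct2, THEN conjunct2, THEN conjunct2, THEN conjunct1] in blast)
  show "x \<in> origin_ball R \<Longrightarrow>
        (B1 has_derivative (\<lambda>d. matrix_of_columns (\<lambda>i. DB1 i x *v d))) (at x within origin_ball R)"
    by (use c[THEN conjunct2, THEN conjunct2, THEN conjunct2, THEN conjunct2, THEN conjunct2, THEN conjunct2, THEN conjunct1] in blast)
  show "continuous_on (origin_ball R) (DB1 i)"
    by (use c[THEN conjunct2, THEN conjunct2, THEN conjunct2, THEN conjunct2, THEN conjunct2, THEN conjunct2, THEN conjunct2, THEN conjunct1] in blast)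
  show "bounded ((\<lambda>(\<theta>, x). Bint \<theta> x) ` ({-h..0} \<times> origin_ball R))"
    by (use c[THEN conjunct2, THEN conjunct2, THEN conjunct2, THEN conjunct2, THEN conjunct2, THEN conjunct2, THEN conjunct2, THEN conjunct2, THEN conjunct1] in blast)
  show "x \<in> origin_ball R \<Longrightarrow> piecewise_continuous_on {-h..0} (\<lambda>\<theta>. Bint \<theta> x)"
    by (use c[THEN conjunct2, THEN conjunct2, THEN conjunct2, THEN conjunct2, THEN conjunct2, THEN conjunct2, THEN conjunct2, THEN conjunct2, THEN conjunct2, THEN conjunct1] in blast)
  show "\<theta> \<in> {-h..0} \<Longrightarrow> x \<in> origin_ball R \<Longrightarrow>
        (Bint \<theta> has_derivative (\<lambda>d. matrix_of_columns (\<lambda>i. DBint i \<theta> x *v d))) (at x within origin_ball R)"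
    by (use c[THEN conjunct2, THEN conjunct2, THEN conjunct2, THEN conjunct2, THEN conjunct2, THEN conjunct2, THEN conjunct2, THEN conjunct2, THEN conjunct2, THEN conjunct2, THEN conjunct1] in blast)
  show "\<theta> \<in> {-h..0} \<Longrightarrow> continuous_on (origin_ball R) (DBint i \<theta>)"
    by (use c[THEN conjunct2, THEN conjunct2, THEN conjunct2, THEN conjunct2, THEN conjunct2, THEN conjunct2, THEN conjunct2, THEN conjunct2, THEN conjunct2, THEN conjunct2, THEN conjunct2, THEN conjunct1] in blast)
  show "K \<subseteq> origin_ball R \<Longrightarrow> compact K \<Longrightarrow>
        bounded ((\<lambda>(\<theta>, x). DBint i \<theta> x) ` ({-h..0} \<times> K))"
    by (use c[THEN conjunct2, THEN conjunct2, THEN conjunct2, THEN conjunct2, THEN conjunct2, THEN conjunct2, THEN conjunct2, THEN conjunct2, THEN conjunct2, THEN conjunct2, THEN conjunct2, THEN conjunct2] in blast)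
qed

lemma zero_in_ball: "0 \<in> origin_ball R"
  using cball_subset_origin_ball[of 0 R] less_imp_le[OF R_pos] by (auto simp: zero_ereal_def[symmetric])

text \<open>The growth bound is tested at a nonzero point of the ball, which exists because
  \<open>R > 0\<close>.\<close>

lemma M_f_nonneg: "M_f \<ge> 0"
proof -
  obtain r where r: "r > 0" "ereal r \<le> R"
  proof -
    obtain r where "0 < ereal r" "ereal r < R" using R_pos ereal_dense2 by blast
    then show ?thesis by (intro that[of r]) auto
  qed
  define x :: "real^'n" where "x = r *\<^sub>R axis undefined 1"
  have "norm x = r" using r by (simp add: x_def)
  then have "x \<in> origin_ball R" using cball_subset_origin_ball[OF r(2)] by auto
  then have "0 \<le> M_f * r" using order_trans[OF norm_ge_zero f_growth] \<open>norm x = r\<close> by metis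
  then show ?thesis using r by (simp add: zero_le_mult_iff)
qed

definition B1_sup :: real where
  "B1_sup = (SUP x \<in> origin_ball R. matrix_norm (B1 x))"

definition Bint_sup :: real where
  "Bint_sup = (SUP (\<theta>, x) \<in> {-h..0} \<times> origin_ball R. matrix_norm (Bint \<theta> x))"

lemma matrix_norm_le_norm: "matrix_norm (M :: real^'a^'b) \<le> norm M"
  unfolding matrix_norm_def by (rule onorm_bound) (auto simp: norm_matrix_vector_mult_le)

lemma norm_mult_le_matrix_norm: "norm ((M :: real^'a^'b) *v c) \<le> matrix_norm M * norm c"
  unfolding matrix_norm_def by (rule onorm) simp

text \<open>Boundedness is assumed in the Frobenius norm, which dominates the induced norm; hence
  the induced norms are bounded above and their supremum is a genuine bound.\<close>

lemma B1_sup: "x \<in> origin_ball R \<Longrightarrow> matrix_norm (B1 x) \<le> B1_sup"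
proof -
  assume x: "x \<in> origin_ball R"
  obtain C where "\<And>x. x \<in> origin_ball R \<Longrightarrow> norm (B1 x) \<le> C"
    using B1_bounded by (auto simp: bounded_iff)
  then have "bdd_above ((\<lambda>x. matrix_norm (B1 x)) ` origin_ball R)"
    by (intro bdd_aboveI2[where M = C]) (use matrix_norm_le_norm order_trans in blast)
  then show ?thesis unfolding B1_sup_def by (rule cSUP_upper[OF x])
qed

lemma Bint_sup: "\<theta> \<in> {-h..0} \<Longrightarrow> x \<in> origin_ball R \<Longrightarrow> matrix_norm (Bint \<theta> x) \<le> Bint_sup"
proof -
  assume x: "\<theta> \<in> {-h..0}" "x \<in> origin_ball R"
  obtain C where C: "\<And>\<theta> x. \<theta> \<in> {-h..0} \<Longrightarrow> x \<in> origin_ball R \<Longrightarrow> norm (Bint \<theta> x) \<le> C"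
    using Bint_bounded unfolding bounded_iff by force
  have "bdd_above ((\<lambda>(\<theta>, x). matrix_norm (Bint \<theta> x)) ` ({-h..0} \<times> origin_ball R))"
  proof (rule bdd_aboveI2[where M = C])
    fix p :: "real \<times> (real^'n)" assume "p \<in> {-h..0} \<times> origin_ball R"
    then show "(case p of (\<theta>, x) \<Rightarrow> matrix_norm (Bint \<theta> x)) \<le> C"
      using C[of "fst p" "snd p"] matrix_norm_le_norm[of "Bint (fst p) (snd p)"] by (auto simp: split_beta)
  qed
  then have "(case (\<theta>, x) of (\<theta>, x) \<Rightarrow> matrix_norm (Bint \<theta> x)) \<le> Bint_sup"
    unfolding Bint_sup_def by (rule cSUP_upper[rotated]) (use x in auto)
  then show ?thesis by simp
qed

lemma B1_mult_le: "x \<in> origin_ball R \<Longrightarrow> norm (B1 x *v c) \<le> B1_sup * norm c"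
  by (rule order_trans[OF norm_mult_le_matrix_norm mult_right_mono[OF B1_sup]]) auto

lemma Bint_mult_le: "\<theta> \<in> {-h..0} \<Longrightarrow> x \<in> origin_ball R \<Longrightarrow> norm (Bint \<theta> x *v c) \<le> Bint_sup * norm c"
  by (rule order_trans[OF norm_mult_le_matrix_norm mult_right_mono[OF Bint_sup]]) auto

lemma matrix_norm_nonneg: "matrix_norm (M :: real^'a^'b) \<ge> 0"
  unfolding matrix_norm_def by (rule onorm_pos_le) simp

lemma B1_sup_nonneg: "B1_sup \<ge> 0"
  by (rule order_trans[OF matrix_norm_nonneg B1_sup[OF zero_in_ball]])

lemma Bint_sup_nonneg: "Bint_sup \<ge> 0"
  by (rule order_trans[OF matrix_norm_nonneg Bint_sup[of 0, OF _ zero_in_ball]]) (use h_pos in auto)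

lemma f_cont: "continuous_on (origin_ball R) f"
  using has_derivative_continuous_on[OF f_deriv] .

lemma B1_cont: "continuous_on (origin_ball R) B1"
  using has_derivative_continuous_on[OF B1_deriv] .

lemma Bint_cont: "\<theta> \<in> {-h..0} \<Longrightarrow> continuous_on (origin_ball R) (Bint \<theta>)"
  using has_derivative_continuous_on[OF Bint_deriv] .

text \<open>Mean value inequality on a compact convex set. For \<open>f\<close> and
  \<open>B1\<close> the derivative is bounded by continuity; for \<open>Bint\<close> the bound has
  to be uniform in \<open>\<theta>\<close>, which is the local uniformity demanded of
  \<open>DBint\<close> in the standing assumptions.\<close>

lemma lipschitz_on_compact:
  assumes K: "K \<subseteq> origin_ball R" "compact K" "convex K"
  obtains L where "L \<ge> 0"
    "\<And>x y. x \<in> K \<Longrightarrow> y \<in> K \<Longrightarrow> norm (f x - f y) \<le> L * norm (x - y)"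
    "\<And>x y. x \<in> K \<Longrightarrow> y \<in> K \<Longrightarrow> norm (B1 x - B1 y) \<le> L * norm (x - y)"
    "\<And>\<theta> x y. \<theta> \<in> {-h..0} \<Longrightarrow> x \<in> K \<Longrightarrow> y \<in> K \<Longrightarrow> norm (Bint \<theta> x - Bint \<theta> y) \<le> L * norm (x - y)"
proof -
  have bdd: "bounded (g ` K)" if "continuous_on (origin_ball R) g" for g :: "real^'n \<Rightarrow> real^'n^'n"
    by (rule compact_imp_bounded compact_continuous_image continuous_on_subset[OF that] K)+
  obtain a where a: "\<And>x. x \<in> K \<Longrightarrow> norm (A x) \<le> a"
    using bdd[OF A_cont] by (auto simp: bounded_iff)
  have "\<exists>b. \<forall>x\<in>K. norm (DB1 i x) \<le> b" for i
    using bdd[OF DB1_cont] by (auto simp: bounded_iff)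
  then obtain b where b: "\<And>i x. x \<in> K \<Longrightarrow> norm (DB1 i x) \<le> b i" by metis
  have "\<exists>c. \<forall>\<theta>\<in>{-h..0}. \<forall>x\<in>K. norm (DBint i \<theta> x) \<le> c" for i
    using DBint_bounded[OF K(1,2), of i] unfolding bounded_iff by force
  then obtain c where c: "\<And>i \<theta> x. \<theta> \<in> {-h..0} \<Longrightarrow> x \<in> K \<Longrightarrow> norm (DBint i \<theta> x) \<le> c i" by metis
  define L0 where "L0 = max 0 a + (\<Sum>i\<in>UNIV. max 0 (b i)) + (\<Sum>i\<in>UNIV. max 0 (c i))"
  \<comment> \<open>The summand 1 serves \<open>A\<close>; the product of the two dimensions pays
    for assembling columns into a matrix in \<open>norm_matrix_of_columns_le\<close>.\<close>
  define L where "L = (1 + real CARD('n) * real CARD('m)) * L0"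
  have L0: "max 0 a \<le> L0" "b i \<le> L0" "c i \<le> L0" for i
  proof -
    have "max 0 (b i) \<le> (\<Sum>i\<in>UNIV. max 0 (b i))" "max 0 (c i) \<le> (\<Sum>i\<in>UNIV. max 0 (c i))"
      by (intro member_le_sum; simp)+
    moreover have "0 \<le> (\<Sum>i\<in>UNIV. max 0 (b i))" "0 \<le> (\<Sum>i\<in>UNIV. max 0 (c i))"
      by (intro sum_nonneg; simp)+
    ultimately show "max 0 a \<le> L0" "b i \<le> L0" "c i \<le> L0"
      unfolding L0_def by linarith+
  qed
  have L: "0 \<le> L0" "L0 \<le> L" "real CARD('n) * real CARD('m) * L0 \<le> L"
    using L0(1) by (auto simp: L_def algebra_simps)
  have dc: "norm (D *v d) \<le> L0 * norm d" if "norm D \<le> L0" for D :: "real^'n^'n" and d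
    by (rule order_trans[OF norm_matrix_vector_mult_le mult_right_mono[OF that]]) simp
  have col: "norm (matrix_of_columns (\<lambda>i. D i *v d)) \<le> L * norm d"
    if "\<And>i. norm (D i) \<le> L0" for D :: "'m \<Rightarrow> real^'n^'n" and d
  proof -
    have "norm (matrix_of_columns (\<lambda>i. D i *v d)) \<le> real CARD('n) * real CARD('m) * (L0 * norm d)"
      by (rule norm_matrix_of_columns_le) (rule dc[OF that])
    also have "\<dots> \<le> L * norm d"
      using mult_right_mono[OF L(3) norm_ge_zero[of d]] by (simp add: mult_ac)
    finally show ?thesis .
  qed
  show ?thesis
  proof (rule that[of L])
    show "L \<ge> 0" using L by simp
    fix x y assume xy: "x \<in> K" "y \<in> K"
    show "norm (f x - f y) \<le> L * norm (x - y)"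
    proof (rule differentiable_bound[OF K(3) _ _ xy])
      fix z assume z: "z \<in> K"
      show "(f has_derivative (\<lambda>d. A z *v d)) (at z within K)"
        using f_deriv K(1) z by (auto intro: has_derivative_subset)
      show "onorm ((*v) (A z)) \<le> L"
        using dc[of "A z"] a[OF z] L0(1) L
        by (intro onorm_bound) (auto intro!: order_trans[OF dc] mult_right_mono)
    qed
    show "norm (B1 x - B1 y) \<le> L * norm (x - y)"
    proof (rule differentiable_bound[OF K(3) _ _ xy])
      fix z assume z: "z \<in> K"
      show "(B1 has_derivative (\<lambda>d. matrix_of_columns (\<lambda>i. DB1 i z *v d))) (at z within K)"
        using B1_deriv K(1) z by (auto intro: has_derivative_subset)
      show "onorm (\<lambda>d. matrix_of_columns (\<lambda>i. DB1 i z *v d)) \<le> L"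
        using L b[OF z] L0(2) by (intro onorm_bound col) (auto intro: order_trans)
    qed
    fix \<theta> assume \<theta>: "\<theta> \<in> {-h..0}"
    show "norm (Bint \<theta> x - Bint \<theta> y) \<le> L * norm (x - y)"
    proof (rule differentiable_bound[OF K(3) _ _ xy])
      fix z assume z: "z \<in> K"
      show "(Bint \<theta> has_derivative (\<lambda>d. matrix_of_columns (\<lambda>i. DBint i \<theta> z *v d))) (at z within K)"
        using Bint_deriv[OF \<theta>] K(1) z by (auto intro: has_derivative_subset)
      show "onorm (\<lambda>d. matrix_of_columns (\<lambda>i. DBint i \<theta> z *v d)) \<le> L"
        using L c[OF \<theta> z] L0(3) by (intro onorm_bound col) (auto intro: order_trans)
    qed
  qed
qed

definition predictor_rhs :: "(real \<Rightarrow> real^'m) \<Rightarrow> real \<Rightarrow> real \<Rightarrow> real^'n \<Rightarrow> real^'n" where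
  "predictor_rhs U \<tau> a z =
     f z + B1 z *v U (a - h) + integral {-h..\<tau>-a} (\<lambda>\<theta>. Bint \<theta> z *v U (a + \<theta>))"

lemma Bint_input_integrable:
  assumes U: "admissible_input U" and z: "z \<in> origin_ball R" and bc: "-h \<le> b" "c \<le> 0"
  shows "(\<lambda>\<theta>. Bint \<theta> z *v U (a + \<theta>)) integrable_on {b..c}"
proof -
  let ?S = "{\<theta> \<in> {-h..0}. \<not> continuous (at \<theta> within {-h..0}) (\<lambda>\<theta>. Bint \<theta> z)}
      \<union> {\<theta>. \<not> isCont (\<lambda>\<theta>. U (a + \<theta>)) \<theta>}"
  obtain C where C: "C \<ge> 0" "\<And>w. norm (U w) \<le> C" using admissible_input_bound[OF U] by blast
  have "(\<lambda>\<theta>. Bint \<theta> z *v U (a + \<theta>)) integrable_on {-h..0}"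
  proof (rule integrable_countable_discontinuities[where S = ?S])
    show "countable ?S"
      using admissible_input_shift[OF U, of a] Bint_pc[OF z]
      by (auto simp: admissible_input_def piecewise_continuous_on_def intro!: countable_finite)
    fix \<theta> assume \<theta>: "\<theta> \<in> {-h..0} - ?S"
    have "continuous (at \<theta> within {-h..0}) (\<lambda>\<theta>. U (a + \<theta>))"
      using \<theta> by (auto intro: continuous_at_imp_continuous_at_within)
    with \<theta> show "continuous (at \<theta> within {-h..0}) (\<lambda>\<theta>. Bint \<theta> z *v U (a + \<theta>))"
      by (intro bounded_bilinear.continuous[OF bounded_bilinear_matrix_vector_mult]) auto
  next
    fix \<theta> assume \<theta>: "\<theta> \<in> {-h..0}"
    show "norm (Bint \<theta> z *v U (a + \<theta>)) \<le> Bint_sup * C"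
      by (rule order_trans[OF Bint_mult_le[OF \<theta> z]]) (simp add: mult_left_mono C Bint_sup_nonneg)
  qed
  then show ?thesis by (rule integrable_on_subinterval) (use bc in auto)
qed

text \<open>The constant depends on the input only through its bound \<open>C\<close>, so it is the
  same for every starting time and every translate of the input.\<close>

lemma predictor_rhs_lipschitz:
  assumes K: "K \<subseteq> origin_ball R" "compact K" "convex K" and C: "C \<ge> 0"
  obtains L where "L \<ge> 0"
    "\<And>U \<tau> a x y. admissible_input U \<Longrightarrow> (\<And>w. norm (U w) \<le> C) \<Longrightarrow> a \<in> {\<tau>..\<tau>+h} \<Longrightarrow> x \<in> K \<Longrightarrow> y \<in> K \<Longrightarrow>
       norm (predictor_rhs U \<tau> a x - predictor_rhs U \<tau> a y) \<le> L * norm (x - y)"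
proof -
  obtain l where l: "l \<ge> 0"
    "\<And>x y. x \<in> K \<Longrightarrow> y \<in> K \<Longrightarrow> norm (f x - f y) \<le> l * norm (x - y)"
    "\<And>x y. x \<in> K \<Longrightarrow> y \<in> K \<Longrightarrow> norm (B1 x - B1 y) \<le> l * norm (x - y)"
    "\<And>\<theta> x y. \<theta> \<in> {-h..0} \<Longrightarrow> x \<in> K \<Longrightarrow> y \<in> K \<Longrightarrow> norm (Bint \<theta> x - Bint \<theta> y) \<le> l * norm (x - y)"
    using lipschitz_on_compact[OF K] by metis
  have "norm (predictor_rhs U \<tau> a x - predictor_rhs U \<tau> a y) \<le> (l + l * C + h * (l * C)) * norm (x - y)"
    if U: "admissible_input U" "\<And>w. norm (U w) \<le> C" and a: "a \<in> {\<tau>..\<tau>+h}" and xy: "x \<in> K" "y \<in> K" for U \<tau> a x y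
  proof -
    let ?d = "l * norm (x - y) * C"
    have mv: "norm (M *v U w - N *v U w) \<le> ?d" if "norm (M - N) \<le> l * norm (x - y)" for M N :: "real^'m^'n" and w
      unfolding matrix_vector_mult_diff_rdistrib[symmetric]
      by (rule order_trans[OF norm_matrix_vector_mult_le]) (use that U l in \<open>auto intro!: mult_mono\<close>)
    let ?J = "\<lambda>z. integral {-h..\<tau>-a} (\<lambda>\<theta>. Bint \<theta> z *v U (a + \<theta>))"
    have int: "(\<lambda>\<theta>. Bint \<theta> z *v U (a + \<theta>)) integrable_on {-h..\<tau>-a}" if "z \<in> K" for z
      using that K a by (intro Bint_input_integrable U) auto
    have "norm (?J x - ?J y) \<le> integral {-h..\<tau>-a} (\<lambda>_. ?d)"
      unfolding integral_diff[OF int[OF xy(1)] int[OF xy(2)], symmetric]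
    proof (rule integral_norm_bound_integral)
      show "(\<lambda>\<theta>. Bint \<theta> x *v U (a + \<theta>) - Bint \<theta> y *v U (a + \<theta>)) integrable_on {-h..\<tau>-a}"
        by (intro integrable_diff int xy)
      fix \<theta> assume "\<theta> \<in> {-h..\<tau>-a}"
      then show "norm (Bint \<theta> x *v U (a + \<theta>) - Bint \<theta> y *v U (a + \<theta>)) \<le> ?d"
        using a xy by (intro mv l) auto
    qed auto
    also have "\<dots> = (\<tau> - a + h) * ?d" using a by simp
    also have "\<dots> \<le> h * ?d"
      by (rule mult_right_mono) (use a l C in auto)
    finally have J: "norm (?J x - ?J y) \<le> h * ?d" .
    have "predictor_rhs U \<tau> a x - predictor_rhs U \<tau> a y
        = (f x - f y) + (B1 x *v U (a - h) - B1 y *v U (a - h)) + (?J x - ?J y)"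
      by (simp add: predictor_rhs_def)
    also have "norm \<dots> \<le> l * norm (x - y) + ?d + h * ?d"
      by (intro order_trans[OF norm_triangle_ineq] add_mono J l mv xy)
    finally show ?thesis by (simp add: algebra_simps)
  qed
  then show ?thesis
    using that[of "l + l * C + h * (l * C)"] l C h_pos by auto
qed

text \<open>At time \<open>a\<close> the window reaches the inputs on
  \<open>[a - h, \<tau>]\<close>, a part of \<open>[\<tau> - h, \<tau>]\<close>; this bounds the
  distributed term by the L1 norm of the initial history, independently of \<open>a\<close>.\<close>

lemma predictor_rhs_growth:
  assumes U: "admissible_input U" and a: "a \<in> {\<tau>..\<tau>+h}" and z: "z \<in> origin_ball R"
  shows "norm (predictor_rhs U \<tau> a z)
    \<le> M_f * norm z + (B1_sup * norm (U (a - h)) + Bint_sup * integral {\<tau>-h..\<tau>} (\<lambda>w. norm (U w)))"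
proof -
  have nU: "(\<lambda>w. norm (U w)) integrable_on {b..c}" for b c
    by (rule admissible_input_norm_integrable[OF U])
  have nUs: "(\<lambda>\<theta>. norm (U (a + \<theta>))) integrable_on {b..c}" for b c
    by (rule admissible_input_norm_integrable[OF admissible_input_shift[OF U]])
  have "norm (integral {-h..\<tau>-a} (\<lambda>\<theta>. Bint \<theta> z *v U (a + \<theta>)))
      \<le> integral {-h..\<tau>-a} (\<lambda>\<theta>. Bint_sup * norm (U (a + \<theta>)))"
    using a z by (intro integral_norm_bound_integral Bint_input_integrable U integrable_on_mult_right nUs Bint_mult_le) auto
  also have "\<dots> = Bint_sup * integral {-h..\<tau>-a} (\<lambda>\<theta>. norm (U (\<theta> + a)))"
    by (simp add: add.commute)
  also have "integral {-h..\<tau>-a} (\<lambda>\<theta>. norm (U (\<theta> + a))) = integral {a-h..\<tau>} (\<lambda>w. norm (U w))"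
    using integral_shift_real_ivl[of "a-h" a \<tau> "\<lambda>w. norm (U w)"] by simp
  also have "\<dots> \<le> integral {\<tau>-h..\<tau>} (\<lambda>w. norm (U w))"
    using a by (intro integral_subset_le nU) auto
  finally have "norm (integral {-h..\<tau>-a} (\<lambda>\<theta>. Bint \<theta> z *v U (a + \<theta>)))
      \<le> Bint_sup * integral {\<tau>-h..\<tau>} (\<lambda>w. norm (U w))"
    using Bint_sup_nonneg by (simp add: mult_left_mono)
  then show ?thesis
    unfolding predictor_rhs_def using f_growth[OF z] B1_mult_le[OF z, of "U (a - h)"]
    by (intro order_trans[OF norm_triangle_ineq] order_trans[OF add_mono[OF norm_triangle_ineq order_refl]]) auto
qed

end

lemma integrable_indicator_Icc:
  fixes g :: "real \<Rightarrow> 'a::banach"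
  assumes "c \<le> b" "g integrable_on {a..c}"
  shows "(\<lambda>x. if x \<le> c then g x else 0) integrable_on {a..b}"
proof -
  have "{..c} \<inter> {a..b} = {a..c}" using assms by auto
  then show ?thesis using integrable_restrict_Int[of "{..c}" g "{a..b}"] assms by (simp only: atMost_iff)
qed

section \<open>Continuity and integrability of the right-hand side along curves\<close>

context predictor_system
begin

lemma continuous_comp_ball:
  assumes "continuous_on (origin_ball R) g" "z ` S \<subseteq> origin_ball R" "a \<in> S" "continuous (at a within S) z"
  shows "continuous (at a within S) (\<lambda>a. g (z a))"
proof -
  have "continuous (at (z a) within z ` S) g"
    by (rule continuous_within_subset[of _ "origin_ball R"])
      (use assms in \<open>auto simp: continuous_on_eq_continuous_within\<close>)
  then show ?thesis using continuous_within_compose2[OF assms(4)] by blast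
qed

lemma finite_shifted_discontinuities:
  assumes "admissible_input U"
  shows "finite {\<theta>. \<not> isCont U (\<theta> + c)}"
proof (rule finite_subset)
  show "{\<theta>. \<not> isCont U (\<theta> + c)} \<subseteq> (\<lambda>w. w - c) ` {w. \<not> isCont U w}"
    by (auto intro!: rev_image_eqI[of "_ + c"])
qed (use assms in \<open>simp add: admissible_input_def\<close>)

text \<open>With a cut-off at \<open>\<theta> \<le> \<tau> - p\<close> the window becomes the fixed
  interval \<open>[-h, 0]\<close> and dominated convergence applies. The integrands converge except
  at the endpoint \<open>\<tau> - a\<close> and at the finitely many jumps of the input. The product
  is left open because the lemma serves both \<open>Bint\<close> in the predictor equation and
  \<open>DBint\<close> in the variational matrix.\<close>

lemma window_integral_continuous:
  fixes prod :: "'c::real_normed_vector \<Rightarrow> real^'m \<Rightarrow> 'd::euclidean_space" and g :: "real \<Rightarrow> real^'n \<Rightarrow> 'c"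
  assumes U: "admissible_input U" and S: "S \<subseteq> {\<tau>..\<tau>+h}" and zS: "z ` S \<subseteq> origin_ball R"
    and a: "a \<in> S" and cz: "continuous (at a within S) z"
    and prod: "bounded_bilinear prod" and g: "\<And>\<theta>. \<theta> \<in> {-h..0} \<Longrightarrow> continuous_on (origin_ball R) (g \<theta>)"
    and int: "\<And>p. p \<in> S \<Longrightarrow> (\<lambda>\<theta>. prod (g \<theta> (z p)) (U (p + \<theta>))) integrable_on {-h..\<tau>-p}"
    and C: "0 \<le> C" "\<And>p \<theta>. p \<in> S \<Longrightarrow> \<theta> \<in> {-h..0} \<Longrightarrow> norm (prod (g \<theta> (z p)) (U (p + \<theta>))) \<le> C"
  shows "continuous (at a within S) (\<lambda>p. integral {-h..\<tau>-p} (\<lambda>\<theta>. prod (g \<theta> (z p)) (U (p + \<theta>))))"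
proof -
  let ?F = "\<lambda>p \<theta>. if \<theta> \<le> \<tau> - p then prod (g \<theta> (z p)) (U (p + \<theta>)) else 0"
  have lim: "((\<lambda>p. integral {-h..0} (?F p)) \<longlongrightarrow> integral {-h..0} (?F a)) (at a within S)"
  proof (rule tendsto_integral_dominated[where N = "insert (\<tau> - a) {\<theta>. \<not> isCont U (\<theta> + a)}" and C = C])
    show "countable (insert (\<tau> - a) {\<theta>. \<not> isCont U (\<theta> + a)})"
      using finite_shifted_discontinuities[OF U] by (simp add: countable_finite)
    show "?F p integrable_on {-h..0}" if "p \<in> insert a S" for p
      by (rule integrable_indicator_Icc) (use that a S int in auto)
    show "norm (?F p w) \<le> C" if "p \<in> S" "w \<in> {-h..0}" for p w
      using C that by auto
    fix w assume w: "w \<in> {-h..0} - insert (\<tau> - a) {\<theta>. \<not> isCont U (\<theta> + a)}"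
    have lp: "((\<lambda>p. \<tau> - p) \<longlongrightarrow> \<tau> - a) (at a within S)" by (intro tendsto_intros)
    show "((\<lambda>p. ?F p w) \<longlongrightarrow> ?F a w) (at a within S)"
    proof (cases "w < \<tau> - a")
      case True
      have "((\<lambda>p. g w (z p)) \<longlongrightarrow> g w (z a)) (at a within S)"
        using continuous_comp_ball[OF g zS a cz, of w] w by (simp add: continuous_within)
      moreover have "((\<lambda>p. U (p + w)) \<longlongrightarrow> U (a + w)) (at a within S)"
        by (rule isCont_tendsto_compose[where g = U]) (use w in \<open>auto intro!: tendsto_intros simp: add.commute\<close>)
      ultimately have "((\<lambda>p. prod (g w (z p)) (U (p + w))) \<longlongrightarrow> prod (g w (z a)) (U (a + w))) (at a within S)"
        by (rule bounded_bilinear.tendsto[OF prod])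
      moreover have "\<forall>\<^sub>F p in at a within S. prod (g w (z p)) (U (p + w)) = ?F p w"
        using order_tendstoD(1)[OF lp True] by (rule eventually_mono) auto
      ultimately show ?thesis using True by (auto intro: Lim_transform_eventually)
    next
      case False
      then have gt: "\<tau> - a < w" using w by auto
      have "\<forall>\<^sub>F p in at a within S. 0 = ?F p w"
        using order_tendstoD(2)[OF lp gt] by (rule eventually_mono) auto
      then show ?thesis using gt by (auto intro: Lim_transform_eventually)
    qed
  qed
  have eq: "integral {-h..0} (?F p) = integral {-h..\<tau>-p} (\<lambda>\<theta>. prod (g \<theta> (z p)) (U (p + \<theta>)))" if "p \<in> S" for p
    by (rule integral_indicator_Icc) (use that S in auto)
  have "((\<lambda>p. integral {-h..\<tau>-p} (\<lambda>\<theta>. prod (g \<theta> (z p)) (U (p + \<theta>))))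
      \<longlongrightarrow> integral {-h..\<tau>-a} (\<lambda>\<theta>. prod (g \<theta> (z a)) (U (a + \<theta>)))) (at a within S)"
    using lim unfolding eq[OF a]
    by (rule Lim_transform_eventually) (auto simp: eventually_at_filter eq)
  then show ?thesis by (simp add: continuous_within)
qed

lemma continuous_delayed_input:
  assumes "isCont U (a - h)"
  shows "continuous (at a within S) (\<lambda>a. U (a - h))"
  by (rule continuous_at_imp_continuous_at_within)
    (rule isCont_o2[where f = "\<lambda>a. a - h" and g = U], use assms in auto)

text \<open>The distributed term is continuous in time even where the input jumps; only the delayed
  value \<open>U (a - h)\<close> can produce a discontinuity.\<close>

lemma predictor_rhs_continuous:
  assumes U: "admissible_input U" and S: "S \<subseteq> {\<tau>..\<tau>+h}" and zS: "z ` S \<subseteq> origin_ball R"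
    and a: "a \<in> S" and cz: "continuous (at a within S) z" and Uc: "isCont U (a - h)"
  shows "continuous (at a within S) (\<lambda>a. predictor_rhs U \<tau> a (z a))"
proof -
  obtain C where C: "C \<ge> 0" "\<And>w. norm (U w) \<le> C" using admissible_input_bound[OF U] by blast
  have J: "continuous (at a within S) (\<lambda>p. integral {-h..\<tau>-p} (\<lambda>\<theta>. Bint \<theta> (z p) *v U (p + \<theta>)))"
  proof (rule window_integral_continuous[OF U S zS a cz bounded_bilinear_matrix_vector_mult])
    show "0 \<le> Bint_sup * C" using C Bint_sup_nonneg by simp
    show "(\<lambda>\<theta>. Bint \<theta> (z p) *v U (p + \<theta>)) integrable_on {-h..\<tau>-p}" if "p \<in> S" for p
      using that S zS by (intro Bint_input_integrable U) auto
    show "norm (Bint \<theta> (z p) *v U (p + \<theta>)) \<le> Bint_sup * C" if "p \<in> S" "\<theta> \<in> {-h..0}" for p \<theta>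
      by (rule order_trans[OF Bint_mult_le[OF that(2)] mult_left_mono[OF C(2) Bint_sup_nonneg]]) (use zS that in auto)
  qed (rule Bint_cont)
  show ?thesis
    unfolding predictor_rhs_def
    by (intro continuous_add continuous_comp_ball[OF f_cont] J continuous_delayed_input[OF Uc]
        bounded_bilinear.continuous[OF bounded_bilinear_matrix_vector_mult] continuous_comp_ball[OF B1_cont] zS a cz)
qed

lemma predictor_rhs_bound:
  assumes "r \<ge> 0" "C \<ge> 0"
  obtains D where "D \<ge> 0"
    "\<And>U \<tau> a z. admissible_input U \<Longrightarrow> (\<And>w. norm (U w) \<le> C) \<Longrightarrow> a \<in> {\<tau>..\<tau>+h} \<Longrightarrow> z \<in> origin_ball R \<Longrightarrow>
       norm z \<le> r \<Longrightarrow> norm (predictor_rhs U \<tau> a z) \<le> D"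
proof -
  have "norm (predictor_rhs U \<tau> a z) \<le> M_f * r + (B1_sup * C + Bint_sup * (h * C))"
    if U: "admissible_input U" "\<And>w. norm (U w) \<le> C" and a: "a \<in> {\<tau>..\<tau>+h}" and z: "z \<in> origin_ball R" "norm z \<le> r"
    for U \<tau> a z
  proof -
    have "integral {\<tau>-h..\<tau>} (\<lambda>w. norm (U w)) \<le> integral {\<tau>-h..\<tau>} (\<lambda>w. C)"
      by (intro integral_le admissible_input_norm_integrable U) auto
    then have "integral {\<tau>-h..\<tau>} (\<lambda>w. norm (U w)) \<le> h * C" using h_pos by simp
    then show ?thesis
      by (intro order_trans[OF predictor_rhs_growth[OF U(1) a z(1)]] add_mono mult_left_mono
          M_f_nonneg B1_sup_nonneg Bint_sup_nonneg U z)
  qed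
  moreover have "0 \<le> M_f * r + (B1_sup * C + Bint_sup * (h * C))"
    using assms h_pos M_f_nonneg B1_sup_nonneg Bint_sup_nonneg by (intro add_nonneg_nonneg mult_nonneg_nonneg) auto
  ultimately show ?thesis using that by blast
qed

lemma predictor_rhs_integrable:
  assumes U: "admissible_input U" and cd: "{c..d} \<subseteq> {\<tau>..\<tau>+h}"
    and z: "continuous_on {c..d} z" "z ` {c..d} \<subseteq> origin_ball R"
  shows "(\<lambda>a. predictor_rhs U \<tau> a (z a)) integrable_on {c..d}"
proof -
  obtain C where C: "C \<ge> 0" "\<And>w. norm (U w) \<le> C" using admissible_input_bound[OF U] by blast
  have "bounded (z ` {c..d})" by (intro compact_imp_bounded compact_continuous_image z) auto
  then obtain r where r: "r > 0" "\<And>a. a \<in> {c..d} \<Longrightarrow> norm (z a) \<le> r" unfolding bounded_pos by blast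
  obtain D where D: "D \<ge> 0" "\<And>U \<tau> a z. admissible_input U \<Longrightarrow> (\<And>w. norm (U w) \<le> C) \<Longrightarrow> a \<in> {\<tau>..\<tau>+h} \<Longrightarrow>
      z \<in> origin_ball R \<Longrightarrow> norm z \<le> r \<Longrightarrow> norm (predictor_rhs U \<tau> a z) \<le> D"
    by (rule predictor_rhs_bound[OF less_imp_le[OF r(1)] C(1)]) (rule that; blast)
  show ?thesis
  proof (rule integrable_countable_discontinuities[where S = "{a. \<not> isCont U (a + - h)}" and C = D])
    show "countable {a. \<not> isCont U (a + - h)}"
      by (rule countable_finite[OF finite_shifted_discontinuities[OF U]])
    fix t assume "t \<in> {c..d} - {a. \<not> isCont U (a + - h)}"
    then show "continuous (at t within {c..d}) (\<lambda>a. predictor_rhs U \<tau> a (z a))"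
      using z cd by (intro predictor_rhs_continuous U) (auto simp: continuous_on_eq_continuous_within)
  next
    fix t assume "t \<in> {c..d}"
    then show "norm (predictor_rhs U \<tau> t (z t)) \<le> D"
      using z cd r by (intro D(2) U C) auto
  qed
qed

section \<open>Predictor trajectories: uniqueness, growth and existence\<close>

text \<open>Absolute time lets trajectories with different starting times share the same input
  \<open>U\<close>, which is how the predicted state is later compared with itself at a nearby
  time.\<close>

definition trajectory :: "(real \<Rightarrow> real^'m) \<Rightarrow> real \<Rightarrow> (real \<Rightarrow> real^'n) \<Rightarrow> bool" where
  "trajectory U \<tau> P \<longleftrightarrow> continuous_on {\<tau>..\<tau>+h} P \<and> P ` {\<tau>..\<tau>+h} \<subseteq> origin_ball R \<and>
     (\<forall>a\<in>{\<tau>..\<tau>+h}. P a = P \<tau> + integral {\<tau>..a} (\<lambda>r. predictor_rhs U \<tau> r (P r)))"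

lemma trajectory_continuous_on: "trajectory U \<tau> P \<Longrightarrow> continuous_on {\<tau>..\<tau>+h} P"
  and trajectory_in_ball: "trajectory U \<tau> P \<Longrightarrow> P ` {\<tau>..\<tau>+h} \<subseteq> origin_ball R"
  and trajectory_eq: "trajectory U \<tau> P \<Longrightarrow> a \<in> {\<tau>..\<tau>+h} \<Longrightarrow>
    P a = P \<tau> + integral {\<tau>..a} (\<lambda>r. predictor_rhs U \<tau> r (P r))"
  unfolding trajectory_def by blast+

lemma trajectory_integrable:
  assumes "admissible_input U" "trajectory U \<tau> P" "{c..d} \<subseteq> {\<tau>..\<tau>+h}"
  shows "(\<lambda>r. predictor_rhs U \<tau> r (P r)) integrable_on {c..d}"
  using trajectory_continuous_on[OF assms(2)] trajectory_in_ball[OF assms(2)] assms(1,3)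
  by (intro predictor_rhs_integrable) (auto intro: continuous_on_subset)

lemma trajectory_increment:
  assumes U: "admissible_input U" and P: "trajectory U \<tau> P" and ab: "\<tau> \<le> b" "b \<le> a" "a \<le> \<tau> + h"
  shows "P a - P b = integral {b..a} (\<lambda>r. predictor_rhs U \<tau> r (P r))"
proof -
  have "integral {\<tau>..b} (\<lambda>r. predictor_rhs U \<tau> r (P r)) + integral {b..a} (\<lambda>r. predictor_rhs U \<tau> r (P r))
      = integral {\<tau>..a} (\<lambda>r. predictor_rhs U \<tau> r (P r))"
    using ab by (intro Henstock_Kurzweil_Integration.integral_combine trajectory_integrable[OF U P]) auto
  moreover have "P a = P \<tau> + integral {\<tau>..a} (\<lambda>r. predictor_rhs U \<tau> r (P r))"
    "P b = P \<tau> + integral {\<tau>..b} (\<lambda>r. predictor_rhs U \<tau> r (P r))"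
    by (intro trajectory_eq[OF P]; use ab in auto)+
  ultimately show ?thesis by (simp add: algebra_simps)
qed

text \<open>The summand \<open>+ 0\<close> gives the integrand the shape expected by the Gronwall
  lemmas, with inhomogeneity 0. Increments between arbitrary times are bounded, so that both time
  directions are served.\<close>

lemma trajectory_lipschitz_diff:
  assumes U: "admissible_input U" and P: "trajectory U \<tau> P" and Q: "trajectory U \<tau> Q"
  obtains L where "L \<ge> 0" "\<And>a b. \<tau> \<le> b \<Longrightarrow> b \<le> a \<Longrightarrow> a \<le> \<tau> + h \<Longrightarrow>
     norm ((P a - Q a) - (P b - Q b)) \<le> integral {b..a} (\<lambda>s. L * norm (P s - Q s) + 0)"
proof -
  obtain C where C: "C \<ge> 0" "\<And>w. norm (U w) \<le> C" using admissible_input_bound[OF U] by blast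
  have cP: "continuous_on {\<tau>..\<tau>+h} P" "P ` {\<tau>..\<tau>+h} \<subseteq> origin_ball R"
    and cQ: "continuous_on {\<tau>..\<tau>+h} Q" "Q ` {\<tau>..\<tau>+h} \<subseteq> origin_ball R"
    using trajectory_continuous_on trajectory_in_ball P Q by blast+
  have "bounded (P ` {\<tau>..\<tau>+h} \<union> Q ` {\<tau>..\<tau>+h})"
    using cP cQ by (auto intro!: compact_imp_bounded compact_continuous_image)
  then obtain r where r: "P ` {\<tau>..\<tau>+h} \<union> Q ` {\<tau>..\<tau>+h} \<subseteq> cball 0 r"
    unfolding bounded_iff by (auto simp: image_subset_iff)
  define K where "K = origin_ball R \<inter> cball (0 :: real^'n) r"
  have K: "K \<subseteq> origin_ball R" "compact K" "convex K"
    using convex_closed_origin_ball[OF R_pos]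
    by (auto simp: K_def intro!: closed_Int_compact convex_Int)
  obtain L where L: "L \<ge> 0" "\<And>U \<tau> a x y. admissible_input U \<Longrightarrow> (\<And>w. norm (U w) \<le> C) \<Longrightarrow> a \<in> {\<tau>..\<tau>+h} \<Longrightarrow>
      x \<in> K \<Longrightarrow> y \<in> K \<Longrightarrow> norm (predictor_rhs U \<tau> a x - predictor_rhs U \<tau> a y) \<le> L * norm (x - y)"
    by (rule predictor_rhs_lipschitz[OF K C(1)]) (rule that; blast)
  show ?thesis
  proof (rule that[OF L(1)])
    fix a b assume ab: "\<tau> \<le> b" "b \<le> a" "a \<le> \<tau> + h"
    have sub: "{b..a} \<subseteq> {\<tau>..\<tau>+h}" using ab by auto
    note int = trajectory_integrable[OF U P sub] trajectory_integrable[OF U Q sub]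
    have "(P a - Q a) - (P b - Q b) = (P a - P b) - (Q a - Q b)" by simp
    also have "\<dots> = integral {b..a} (\<lambda>r. predictor_rhs U \<tau> r (P r) - predictor_rhs U \<tau> r (Q r))"
      by (simp add: trajectory_increment[OF U P ab] trajectory_increment[OF U Q ab] integral_diff int)
    also have "norm \<dots> \<le> integral {b..a} (\<lambda>s. L * norm (P s - Q s) + 0)"
    proof (rule integral_norm_bound_integral)
      have "continuous_on {b..a} (\<lambda>s. L * norm (P s - Q s) + 0)"
        using cP cQ sub by (intro continuous_intros) (auto intro: continuous_on_subset)
      then show "(\<lambda>s. L * norm (P s - Q s) + 0) integrable_on {b..a}"
        by (rule integrable_continuous_real)
      fix s assume "s \<in> {b..a}"
      then show "norm (predictor_rhs U \<tau> s (P s) - predictor_rhs U \<tau> s (Q s)) \<le> L * norm (P s - Q s) + 0"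
        using sub cP cQ r L(2)[OF U C(2), of s \<tau> "P s" "Q s"] by (auto simp: K_def image_subset_iff)
    qed (intro integrable_diff int)
    finally show "norm ((P a - Q a) - (P b - Q b)) \<le> integral {b..a} (\<lambda>s. L * norm (P s - Q s) + 0)" .
  qed
qed

text \<open>Gronwall from whichever end the trajectories agree at. Agreement at the start determines
  \<open>predictor_map\<close>, agreement at the end determines the trajectory in
  \<open>input_matrix\<close>.\<close>

lemma trajectory_unique:
  assumes U: "admissible_input U" and P: "trajectory U \<tau> P" and Q: "trajectory U \<tau> Q"
    and eq: "P \<tau> = Q \<tau> \<or> P (\<tau> + h) = Q (\<tau> + h)" and a: "a \<in> {\<tau>..\<tau>+h}"
  shows "P a = Q a"
proof -
  obtain L where L: "L \<ge> 0" "\<And>a b. \<tau> \<le> b \<Longrightarrow> b \<le> a \<Longrightarrow> a \<le> \<tau> + h \<Longrightarrow>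
     norm ((P a - Q a) - (P b - Q b)) \<le> integral {b..a} (\<lambda>s. L * norm (P s - Q s) + 0)"
    by (rule trajectory_lipschitz_diff[OF U P Q]) (rule that; blast)
  have cont: "continuous_on {\<tau>..\<tau>+h} (\<lambda>s. norm (P s - Q s))"
    by (intro continuous_intros trajectory_continuous_on[OF P] trajectory_continuous_on[OF Q])
  from eq have "norm (P a - Q a) \<le> 0"
  proof
    assume eq: "P \<tau> = Q \<tau>"
    have "norm (P a - Q a) \<le> (0 + integral {\<tau>..a} (\<lambda>_. 0)) * exp (L * (a - \<tau>))"
    proof (rule gronwall_forward)
      fix t assume "t \<in> {\<tau>..a}"
      then show "norm (P t - Q t) \<le> 0 + integral {\<tau>..t} (\<lambda>s. L * norm (P s - Q s) + 0)"
        using L(2)[of \<tau> t] a eq by simp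
    qed (use a L(1) in \<open>auto intro: continuous_on_subset[OF cont]\<close>)
    then show ?thesis by simp
  next
    assume eq: "P (\<tau> + h) = Q (\<tau> + h)"
    have "norm (P a - Q a) \<le> (0 + integral {a..\<tau>+h} (\<lambda>_. 0)) * exp (L * (\<tau> + h - a))"
    proof (rule gronwall_backward)
      fix t assume "t \<in> {a..\<tau>+h}"
      then show "norm (P t - Q t) \<le> 0 + integral {t..\<tau>+h} (\<lambda>s. L * norm (P s - Q s) + 0)"
        using L(2)[of t "\<tau> + h"] a eq by (simp add: norm_minus_commute)
    qed (use a L(1) in \<open>auto intro: continuous_on_subset[OF cont]\<close>)
    then show ?thesis by simp
  qed
  then show ?thesis by simp
qed

text \<open>Coefficient of the L1 norm of the history once the right-hand side has been integrated
  over \<open>[0, h]\<close>: the pointwise delay sees the history once, the distributed delay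
  contributes a multiple of its L1 norm at every time of an interval of length
  \<open>h\<close>.\<close>

definition history_gain :: real where "history_gain = B1_sup + h * Bint_sup"

lemma history_gain_nonneg: "history_gain \<ge> 0"
  using B1_sup_nonneg Bint_sup_nonneg h_pos by (simp add: history_gain_def)

text \<open>Formulated for any curve whose increments obey the growth bound, because the first
  estimate is also applied to the solution of a truncated equation that is not yet known to be a
  trajectory.\<close>

lemma growth_estimate:
  fixes z :: "real \<Rightarrow> real^'n"
  assumes U: "admissible_input U" and cont: "continuous_on {0..h} z"
    and inc: "\<And>s t. 0 \<le> s \<Longrightarrow> s \<le> t \<Longrightarrow> t \<le> h \<Longrightarrow> norm (z t - z s) \<le>
       integral {s..t} (\<lambda>r. M_f * norm (z r) + (B1_sup * norm (U (r - h)) + Bint_sup * integral {-h..0} (\<lambda>w. norm (U w))))"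
    and t: "t \<in> {0..h}"
  shows "norm (z t) \<le> exp (M_f * h) * (norm (z 0) + history_gain * integral {-h..0} (\<lambda>w. norm (U w)))"
    and "norm (z t) \<le> exp (M_f * h) * (norm (z h) + history_gain * integral {-h..0} (\<lambda>w. norm (U w)))"
proof -
  let ?I = "integral {-h..0} (\<lambda>w. norm (U w))"
  let ?g = "\<lambda>r. B1_sup * norm (U (r - h)) + Bint_sup * ?I"
  have I: "?I \<ge> 0" by (intro integral_nonneg admissible_input_norm_integrable U) auto
  have nU: "(\<lambda>r. norm (U (r - h))) integrable_on {a..b}" for a b
    using admissible_input_norm_integrable[OF admissible_input_shift[OF U, of "-h"]] by simp
  have g: "?g integrable_on {a..b}" for a b
    by (intro integrable_add integrable_on_mult_right nU) auto
  have g0: "0 \<le> ?g r" for r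
    using I B1_sup_nonneg Bint_sup_nonneg by (intro add_nonneg_nonneg mult_nonneg_nonneg) auto
  have "integral {0..h} ?g = B1_sup * integral {0..h} (\<lambda>r. norm (U (r - h))) + h * (Bint_sup * ?I)"
    using h_pos by (subst integral_add) (auto intro!: integrable_on_mult_right nU)
  also have "integral {0..h} (\<lambda>r. norm (U (r - h))) = ?I"
    using integral_shift_real_ivl[of "-h" "-h" 0 "\<lambda>w. norm (U w)"] by simp
  finally have G: "integral {0..h} ?g = history_gain * ?I" by (simp add: history_gain_def algebra_simps)
  have Gle: "integral {a..b} ?g \<le> history_gain * ?I" if "{a..b} \<subseteq> {0..h}" for a b
    unfolding G[symmetric] by (rule integral_subset_le) (use that g g0 in auto)
  have fin: "(c + integral {a..b} ?g) * exp (M_f * d) \<le> exp (M_f * h) * (c + history_gain * ?I)"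
    if "{a..b} \<subseteq> {0..h}" "c \<ge> 0" "d \<le> h" for a b c d
    using that Gle[OF that(1)] M_f_nonneg history_gain_nonneg I
    by (subst mult.commute, intro mult_mono add_mono) (auto intro: mult_left_mono integral_nonneg g g0)
  have cont': "continuous_on A (\<lambda>t. norm (z t))" if "A \<subseteq> {0..h}" for A
    using continuous_on_subset[OF cont that] by (rule continuous_on_norm)
  have "norm (z t) \<le> (norm (z 0) + integral {0..t} ?g) * exp (M_f * (t - 0))"
  proof (rule gronwall_forward)
    fix s assume s: "s \<in> {0..t}"
    show "norm (z s) \<le> norm (z 0) + integral {0..s} (\<lambda>r. M_f * norm (z r) + ?g r)"
      using inc[of 0 s] s t norm_triangle_ineq2[of "z s" "z 0"] by auto
  qed (use t M_f_nonneg g g0 cont' in auto)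
  also have "\<dots> \<le> exp (M_f * h) * (norm (z 0) + history_gain * ?I)"
    by (rule fin) (use t in auto)
  finally show "norm (z t) \<le> exp (M_f * h) * (norm (z 0) + history_gain * ?I)" .
  have "norm (z t) \<le> (norm (z h) + integral {t..h} ?g) * exp (M_f * (h - t))"
  proof (rule gronwall_backward)
    fix s assume s: "s \<in> {t..h}"
    show "norm (z s) \<le> norm (z h) + integral {s..h} (\<lambda>r. M_f * norm (z r) + ?g r)"
      using inc[of s h] s t norm_triangle_ineq3[of "z h" "z s"] by auto
  qed (use t M_f_nonneg g g0 cont' in auto)
  also have "\<dots> \<le> exp (M_f * h) * (norm (z h) + history_gain * ?I)"
    by (rule fin) (use t in auto)
  finally show "norm (z t) \<le> exp (M_f * h) * (norm (z h) + history_gain * ?I)" .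
qed

lemma trajectory_estimate:
  assumes U: "admissible_input U" and P: "trajectory U 0 P" and t: "t \<in> {0..h}"
  shows "norm (P t) \<le> exp (M_f * h) * (norm (P 0) + history_gain * integral {-h..0} (\<lambda>w. norm (U w)))"
    and "norm (P t) \<le> exp (M_f * h) * (norm (P h) + history_gain * integral {-h..0} (\<lambda>w. norm (U w)))"
proof -
  have c: "continuous_on {0..h} P" "P ` {0..h} \<subseteq> origin_ball R"
    using trajectory_continuous_on[OF P] trajectory_in_ball[OF P] by auto
  have "norm (P t - P s) \<le>
       integral {s..t} (\<lambda>r. M_f * norm (P r) + (B1_sup * norm (U (r - h)) + Bint_sup * integral {-h..0} (\<lambda>w. norm (U w))))"
    if st: "0 \<le> s" "s \<le> t" "t \<le> h" for s t
  proof -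
    have "t \<le> 0 + h" using st by simp
    show ?thesis
    unfolding trajectory_increment[OF U P st(1,2) \<open>t \<le> 0 + h\<close>]
  proof (rule integral_norm_bound_integral)
    show "(\<lambda>r. predictor_rhs U 0 r (P r)) integrable_on {s..t}"
      by (rule trajectory_integrable[OF U P]) (use st in auto)
    have "(\<lambda>r. norm (P r)) integrable_on {s..t}"
      by (intro integrable_continuous_real continuous_intros continuous_on_subset[OF c(1)]) (use st in auto)
    then show "(\<lambda>r. M_f * norm (P r) + (B1_sup * norm (U (r - h)) + Bint_sup * integral {-h..0} (\<lambda>w. norm (U w)))) integrable_on {s..t}"
      using admissible_input_norm_integrable[OF admissible_input_shift[OF U, of "-h"]]
      by (intro integrable_add integrable_on_mult_right) auto
    fix r assume "r \<in> {s..t}"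
    then show "norm (predictor_rhs U 0 r (P r)) \<le> M_f * norm (P r) + (B1_sup * norm (U (r - h)) + Bint_sup * integral {-h..0} (\<lambda>w. norm (U w)))"
      using predictor_rhs_growth[OF U, of r 0 "P r"] c(2) st by (auto simp: image_subset_iff)
  qed
  qed
  from growth_estimate[OF U c(1) this t]
  show "norm (P t) \<le> exp (M_f * h) * (norm (P 0) + history_gain * integral {-h..0} (\<lambda>w. norm (U w)))"
    and "norm (P t) \<le> exp (M_f * h) * (norm (P h) + history_gain * integral {-h..0} (\<lambda>w. norm (U w)))"
    by blast+
qed

text \<open>Composing the right-hand side with the projection onto the ball of radius
  \<open>r\<close> makes it globally Lipschitz, so a solution exists on \<open>[0, h]\<close>. The
  projection is nonexpansive and fixes 0, hence does not increase norms; so the growth estimate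
  holds for this solution and, by the choice of \<open>r\<close>, keeps it in the ball, where the
  projection is the identity.\<close>

lemma trajectory_exists:
  assumes U: "admissible_input U"
    and r: "exp (M_f * h) * (norm x + history_gain * integral {-h..0} (\<lambda>w. norm (U w))) \<le> r" "ereal r \<le> R"
  obtains P where "trajectory U 0 P" "P 0 = x"
proof -
  define K where "K = cball (0 :: real^'n) r"
  have "0 \<le> integral {-h..0} (\<lambda>w. norm (U w))" by (intro integral_nonneg admissible_input_norm_integrable U) auto
  then have "0 \<le> exp (M_f * h) * (norm x + history_gain * integral {-h..0} (\<lambda>w. norm (U w)))"
    using history_gain_nonneg by auto
  then have r0: "0 \<le> r" using r by linarith
  have K: "K \<subseteq> origin_ball R" "compact K" "convex K" "closed K" "K \<noteq> {}"
    using cball_subset_origin_ball[OF r(2)] r0 by (auto simp: K_def)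
  obtain C where C: "C \<ge> 0" "\<And>w. norm (U w) \<le> C" using admissible_input_bound[OF U] by blast
  obtain L where L: "L \<ge> 0" "\<And>U \<tau> a x y. admissible_input U \<Longrightarrow> (\<And>w. norm (U w) \<le> C) \<Longrightarrow> a \<in> {\<tau>..\<tau>+h} \<Longrightarrow>
      x \<in> K \<Longrightarrow> y \<in> K \<Longrightarrow> norm (predictor_rhs U \<tau> a x - predictor_rhs U \<tau> a y) \<le> L * norm (x - y)"
    by (rule predictor_rhs_lipschitz[OF K(1-3) C(1)]) (rule that; blast)
  let ?p = "closest_point K"
  have pK: "?p z \<in> K" for z by (rule closest_point_in_set[OF K(4,5)])
  have plip: "norm (?p z - ?p w) \<le> norm (z - w)" for z w
    using closest_point_lipschitz[OF K(3,4,5), of z w] by (simp add: dist_norm)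
  have p0: "?p 0 = 0" by (rule closest_point_self) (use r0 in \<open>simp add: K_def\<close>)
  have int: "(\<lambda>t. predictor_rhs U 0 t (?p (z t))) integrable_on {a..b}"
    if "continuous_on {a..b} z" "{a..b} \<subseteq> {0..h}" for z a b
    by (rule predictor_rhs_integrable[OF U])
      (use that pK K continuous_on_compose2[OF continuous_on_closest_point[OF K(3,4,5)] that(1)] in auto)
  obtain z where z: "continuous_on {0..h} z"
    "\<And>t. t \<in> {0..h} \<Longrightarrow> z t = x + integral {0..t} (\<lambda>s. predictor_rhs U 0 s (?p (z s)))"
  proof (rule picard_lindelof[of 0 h "\<lambda>t z. predictor_rhs U 0 t (?p z)" L x])
    fix t :: real and z w assume "t \<in> {0..h}"
    then have "norm (predictor_rhs U 0 t (?p z) - predictor_rhs U 0 t (?p w)) \<le> L * norm (?p z - ?p w)"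
      by (intro L(2) U C pK) auto
    also have "\<dots> \<le> L * norm (z - w)" by (intro mult_left_mono plip L)
    finally show "norm (predictor_rhs U 0 t (?p z) - predictor_rhs U 0 t (?p w)) \<le> L * norm (z - w)" .
  qed (use h_pos int that in auto)
  have z0: "z 0 = x" using z(2)[of 0] h_pos by simp
  have "norm (z t) \<le> r" if t: "t \<in> {0..h}" for t
  proof (rule order_trans[OF growth_estimate(1)[OF U z(1) _ t]])
    show "exp (M_f * h) * (norm (z 0) + history_gain * integral {-h..0} (\<lambda>w. norm (U w))) \<le> r"
      using r z0 by simp
    fix s t assume st: "0 \<le> s" "s \<le> t" "t \<le> h"
    have "integral {0..s} (\<lambda>r. predictor_rhs U 0 r (?p (z r))) + integral {s..t} (\<lambda>r. predictor_rhs U 0 r (?p (z r)))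
      = integral {0..t} (\<lambda>r. predictor_rhs U 0 r (?p (z r)))"
      using st by (intro Henstock_Kurzweil_Integration.integral_combine int continuous_on_subset[OF z(1)]) auto
    then have "z t - z s = integral {s..t} (\<lambda>r. predictor_rhs U 0 r (?p (z r)))"
      using z(2)[of s] z(2)[of t] st by (simp add: algebra_simps)
    also have "norm \<dots> \<le> integral {s..t} (\<lambda>r. M_f * norm (z r) + (B1_sup * norm (U (r - h)) + Bint_sup * integral {-h..0} (\<lambda>w. norm (U w))))"
    proof (rule integral_norm_bound_integral)
      show "(\<lambda>r. predictor_rhs U 0 r (?p (z r))) integrable_on {s..t}"
        by (rule int) (use st in \<open>auto intro: continuous_on_subset[OF z(1)]\<close>)
      have "(\<lambda>r. norm (z r)) integrable_on {s..t}"
        by (intro integrable_continuous_real continuous_intros continuous_on_subset[OF z(1)]) (use st in auto)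
      then show "(\<lambda>r. M_f * norm (z r) + (B1_sup * norm (U (r - h)) + Bint_sup * integral {-h..0} (\<lambda>w. norm (U w)))) integrable_on {s..t}"
        using admissible_input_norm_integrable[OF admissible_input_shift[OF U, of "-h"]]
        by (intro integrable_add integrable_on_mult_right) auto
      fix r assume r: "r \<in> {s..t}"
      have "M_f * norm (?p (z r)) \<le> M_f * norm (z r)"
        using plip[of "z r" 0] p0 M_f_nonneg by (intro mult_left_mono) auto
      then show "norm (predictor_rhs U 0 r (?p (z r))) \<le> M_f * norm (z r) + (B1_sup * norm (U (r - h)) + Bint_sup * integral {-h..0} (\<lambda>w. norm (U w)))"
        using predictor_rhs_growth[OF U, of r 0 "?p (z r)"] pK[of "z r"] K st r by auto
    qed
    finally show "norm (z t - z s) \<le> integral {s..t} (\<lambda>r. M_f * norm (z r) + (B1_sup * norm (U (r - h)) + Bint_sup * integral {-h..0} (\<lambda>w. norm (U w))))" .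
  qed
  then have zK: "z t \<in> K" if "t \<in> {0..h}" for t using that by (simp add: K_def)
  have pz: "?p (z t) = z t" if "t \<in> {0..h}" for t by (intro closest_point_self zK that)
  have "trajectory U 0 z"
    unfolding trajectory_def
  proof (intro conjI ballI)
    fix t assume t: "t \<in> {0..0+h}"
    have "integral {0..t} (\<lambda>s. predictor_rhs U 0 s (?p (z s))) = integral {0..t} (\<lambda>s. predictor_rhs U 0 s (z s))"
      by (rule integral_cong) (use pz t in auto)
    then show "z t = z 0 + integral {0..t} (\<lambda>r. predictor_rhs U 0 r (z r))"
      using z(2)[of t] t z0 by simp
  next
    show "continuous_on {0..0+h} z" using z(1) by simp
    show "z ` {0..0+h} \<subseteq> origin_ball R" using zK K(1) by (auto simp del: atLeastAtMost_iff)
  qed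
  then show ?thesis using z0 by (rule that)
qed

end

subsection \<open>The variational equation\<close>

lemma solves_on_cong:
  assumes "solves_on I F z" "countable S" "\<And>t. t \<in> I - S \<Longrightarrow> F t (z t) = G t (z t)"
  shows "solves_on I G z"
proof -
  obtain S' where S': "countable S'" "continuous_on I z"
    "\<forall>t\<in>I - S'. (z has_vector_derivative F t (z t)) (at t within I)"
    using assms(1) by (auto simp: solves_on_def)
  have "\<forall>t\<in>I - (S \<union> S'). (z has_vector_derivative G t (z t)) (at t within I)"
  proof
    fix t assume t: "t \<in> I - (S \<union> S')"
    then have "(z has_vector_derivative F t (z t)) (at t within I)" using S'(3) by blast
    moreover have "F t (z t) = G t (z t)" by (rule assms(3)) (use t in blast)
    ultimately show "(z has_vector_derivative G t (z t)) (at t within I)" by simp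
  qed
  moreover have "countable (S \<union> S')" using S' assms(2) by simp
  ultimately show ?thesis using S'(2) unfolding solves_on_def by blast
qed

text \<open>Derivatives are available only within the ball, so the hypotheses keep the whole
  sequence in \<open>S\<close>.\<close>

lemma difference_quotient_tendsto:
  fixes g :: "'a::real_normed_vector \<Rightarrow> 'b::real_normed_vector"
  assumes der: "(g has_derivative g') (at z within S)" and S: "\<And>k. z + e k *\<^sub>R d \<in> S"
    and e: "e \<longlonglongrightarrow> 0" "\<And>k. e k > 0"
  shows "(\<lambda>k. (1 / e k) *\<^sub>R (g (z + e k *\<^sub>R d) - g z)) \<longlonglongrightarrow> g' d"
proof (rule LIMSEQ_I)
  fix r :: real assume r: "r > 0"
  define r' where "r' = r / (2 * (norm d + 1))"
  have pos: "norm d + 1 > 0" by (simp add: add_nonneg_pos)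
  have r': "r' > 0" using r pos by (simp add: r'_def)
  have lin: "bounded_linear g'" using der by (rule has_derivative_bounded_linear)
  obtain \<delta> where \<delta>: "\<delta> > 0" "\<And>y. y \<in> S \<Longrightarrow> norm (y - z) < \<delta> \<Longrightarrow> norm (g y - g z - g' (y - z)) \<le> r' * norm (y - z)"
    using der r' unfolding has_derivative_within_alt by blast
  have "(\<lambda>k. e k * norm d) \<longlonglongrightarrow> 0 * norm d" by (intro tendsto_intros e)
  then obtain N where N: "\<And>k. k \<ge> N \<Longrightarrow> e k * norm d < \<delta>"
    using order_tendstoD(2)[of _ 0 sequentially \<delta>] \<delta>(1) unfolding eventually_sequentially by auto
  show "\<exists>no. \<forall>n\<ge>no. norm ((1 / e n) *\<^sub>R (g (z + e n *\<^sub>R d) - g z) - g' d) < r"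
  proof (intro exI[of _ N] allI impI)
    fix k assume k: "k \<ge> N"
    let ?D = "g (z + e k *\<^sub>R d) - g z - g' (e k *\<^sub>R d)"
    have "norm ?D \<le> r' * (e k * norm d)"
      using \<delta>(2)[OF S[of k]] N[OF k] e(2)[of k] by simp
    moreover have "(1 / e k) *\<^sub>R (g (z + e k *\<^sub>R d) - g z) - g' d = (1 / e k) *\<^sub>R ?D"
      using e(2)[of k] by (simp add: scaleR_diff_right linear_simps(5)[OF lin])
    ultimately have "norm ((1 / e k) *\<^sub>R (g (z + e k *\<^sub>R d) - g z) - g' d) \<le> (1 / e k) * (r' * (e k * norm d))"
      using e(2)[of k] mult_left_mono[of "norm ?D" "r' * (e k * norm d)" "1 / e k"] by (simp only: norm_scaleR) simp
    also have "\<dots> = r' * norm d" using e(2)[of k] by simp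
    also have "\<dots> \<le> r' * (norm d + 1)" using r' by (intro mult_left_mono) auto
    also have "\<dots> = r / 2" using pos unfolding r'_def by (simp add: divide_simps)
    also have "\<dots> < r" using r by simp
    finally show "norm ((1 / e k) *\<^sub>R (g (z + e k *\<^sub>R d) - g z) - g' d) < r" .
  qed
qed

section \<open>The predictor map, and regularity of the variational equation\<close>

context predictor_system
begin

text \<open>A history has no meaningful value at 0. That value is read pointwise only at
  \<open>s = h\<close>, a single exceptional time, and inside the integral only at
  \<open>\<theta> = -s\<close>, a null set.\<close>

lemma predictor_trajectory_iff:
  assumes U: "admissible_input U" and \<phi>: "\<And>\<theta>. \<theta> \<in> {-h..<0} \<Longrightarrow> \<phi> \<theta> = U \<theta>"
  shows "predictor_trajectory h R f B1 Bint \<phi> \<xi> \<longleftrightarrow> trajectory U 0 \<xi>"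
proof -
  let ?F = "\<lambda>s z. f z + B1 z *v \<phi> (s - h) + integral {-h..-s} (\<lambda>\<theta>. Bint \<theta> z *v \<phi> (s + \<theta>))"
  have eq: "?F s z = predictor_rhs U 0 s z" if s: "s \<in> {0..h} - {h}" for s z
  proof -
    have "integral {-h..-s} (\<lambda>\<theta>. Bint \<theta> z *v \<phi> (s + \<theta>)) = integral {-h..-s} (\<lambda>\<theta>. Bint \<theta> z *v U (s + \<theta>))"
      by (rule integral_spike[of "{-s}"]) (use \<phi> s in auto)
    then show ?thesis using s \<phi>[of "s - h"] by (simp add: predictor_rhs_def)
  qed
  have sol: "solves_on {0..h} ?F \<xi> \<longleftrightarrow> solves_on {0..h} (predictor_rhs U 0) \<xi>"
    by (intro iffI; erule solves_on_cong[where S = "{h}"]) (use eq in auto)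
  have D: "countable {a. \<not> isCont U (a + - h)}"
    by (rule countable_finite[OF finite_shifted_discontinuities[OF U]])
  have cont: "continuous (at t within {0..h}) (\<lambda>s. predictor_rhs U 0 s (\<xi> s))"
    if "\<forall>s\<in>{0..h}. \<xi> s \<in> origin_ball R" "continuous_on {0..h} \<xi>" "t \<in> {0..h} - {a. \<not> isCont U (a + - h)}" for t
    using that by (intro predictor_rhs_continuous U) (auto simp: continuous_on_eq_continuous_within)
  have int: "(\<lambda>s. predictor_rhs U 0 s (\<xi> s)) integrable_on {0..h}"
    if "\<forall>s\<in>{0..h}. \<xi> s \<in> origin_ball R" "continuous_on {0..h} \<xi>"
    using that by (intro predictor_rhs_integrable U) auto
  show ?thesis
  proof
    assume "predictor_trajectory h R f B1 Bint \<phi> \<xi>"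
    then have ball: "\<forall>s\<in>{0..h}. \<xi> s \<in> origin_ball R" and s: "solves_on {0..h} (predictor_rhs U 0) \<xi>"
      unfolding predictor_trajectory_def sol by auto
    have c: "continuous_on {0..h} \<xi>" using s by (auto simp: solves_on_def)
    show "trajectory U 0 \<xi>"
      unfolding trajectory_def
    proof (intro conjI ballI)
      fix a assume "a \<in> {0..0+h}"
      then show "\<xi> a = \<xi> 0 + integral {0..a} (\<lambda>r. predictor_rhs U 0 r (\<xi> r))"
        using solves_on_imp_integral[OF s D cont[OF ball c] int[OF ball c], of a] by simp
    qed (use c ball in auto)
  next
    assume P: "trajectory U 0 \<xi>"
    have ball: "\<forall>s\<in>{0..h}. \<xi> s \<in> origin_ball R" and c: "continuous_on {0..h} \<xi>"
      using trajectory_continuous_on[OF P] trajectory_in_ball[OF P] by auto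
    have "solves_on {0..h} (predictor_rhs U 0) \<xi>"
    proof (rule integral_imp_solves_on[where F = "predictor_rhs U 0" and z = \<xi> and ?z0.0 = "\<xi> 0", OF D cont[OF ball c] int[OF ball c]])
      fix t assume "t \<in> {0..h}"
      then show "\<xi> t = \<xi> 0 + integral {0..t} (\<lambda>s. predictor_rhs U 0 s (\<xi> s))"
        using trajectory_eq[OF P, of t] by simp
    qed
    then show "predictor_trajectory h R f B1 Bint \<phi> \<xi>"
      unfolding predictor_trajectory_def sol using ball by blast
  qed
qed

lemma predictor_map_eq:
  assumes U: "admissible_input U" and \<phi>: "\<And>\<theta>. \<theta> \<in> {-h..<0} \<Longrightarrow> \<phi> \<theta> = U \<theta>" and P: "trajectory U 0 P"
  shows "predictor_map h R f B1 Bint (P 0) \<phi> = P h"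
proof -
  have iff: "predictor_trajectory h R f B1 Bint \<phi> \<xi> \<longleftrightarrow> trajectory U 0 \<xi>" for \<xi>
    by (rule predictor_trajectory_iff[OF U]) (rule \<phi>)
  show ?thesis
  unfolding predictor_map_def iff
proof (rule the_equality)
  show "\<exists>\<xi>. trajectory U 0 \<xi> \<and> \<xi> 0 = P 0 \<and> \<xi> h = P h" using P by blast
  fix y assume "\<exists>\<xi>. trajectory U 0 \<xi> \<and> \<xi> 0 = P 0 \<and> \<xi> h = y"
  then obtain Q where "trajectory U 0 Q" "Q 0 = P 0" "Q h = y" by blast
  then show "y = P h" using trajectory_unique[OF U P, of Q h] h_pos by simp
qed
qed

lemma DBint_uniform_bound:
  assumes "K \<subseteq> origin_ball R" "compact K"
  obtains C where "C \<ge> 0" "\<And>i \<theta> x. \<theta> \<in> {-h..0} \<Longrightarrow> x \<in> K \<Longrightarrow> norm (DBint i \<theta> x) \<le> C"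
proof -
  have "\<exists>c. \<forall>\<theta>\<in>{-h..0}. \<forall>x\<in>K. norm (DBint i \<theta> x) \<le> c" for i
    using DBint_bounded[OF assms, of i] unfolding bounded_iff by force
  then obtain c where c: "\<And>i \<theta> x. \<theta> \<in> {-h..0} \<Longrightarrow> x \<in> K \<Longrightarrow> norm (DBint i \<theta> x) \<le> c i" by metis
  have le: "c i \<le> (\<Sum>i\<in>UNIV. max 0 (c i))" for i
    using member_le_sum[of i UNIV "\<lambda>i. max 0 (c i)"] by simp
  have "0 \<le> (\<Sum>i\<in>UNIV. max 0 (c i))" by (intro sum_nonneg) auto
  then show ?thesis using that c le by (meson order_trans)
qed

text \<open>\<open>DBint\<close> need not be piecewise continuous in \<open>\<theta>\<close>; it is integrable as a bounded pointwise limit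
  of difference quotients of \<open>Bint\<close>.\<close>

lemma DBint_input_integrable:
  assumes U: "admissible_input U" and r: "ereal r \<le> R" and z: "norm z < r" and c: "c \<le> 0"
  shows "(\<lambda>\<theta>. U (a + \<theta>) $ i *\<^sub>R DBint i \<theta> z) integrable_on {-h..c}"
  unfolding integrable_componentwise_iff[of "\<lambda>\<theta>. U (a + \<theta>) $ i *\<^sub>R DBint i \<theta> z"]
proof
  fix b :: "real^'n^'n" assume "b \<in> Basis"
  then obtain k j where b: "b = axis k (axis j 1)" by (auto simp: Basis_vec_def)
  define K where "K = cball (0 :: real^'n) r"
  have K: "K \<subseteq> origin_ball R" "compact K" "convex K"
    using cball_subset_origin_ball[OF r] by (auto simp: K_def)
  obtain L where L: "L \<ge> 0"
    "\<And>\<theta> x y. \<theta> \<in> {-h..0} \<Longrightarrow> x \<in> K \<Longrightarrow> y \<in> K \<Longrightarrow> norm (Bint \<theta> x - Bint \<theta> y) \<le> L * norm (x - y)"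
    by (rule lipschitz_on_compact[OF K]) (rule that; blast)
  obtain C where C: "C \<ge> 0" "\<And>w. norm (U w) \<le> C" using admissible_input_bound[OF U] by blast
  \<comment> \<open>For the basis matrix \<open>b\<close> with its 1 at \<open>(k, j)\<close>, the
    wanted entry of \<open>DBint i \<theta> z\<close> is the derivative in direction
    \<open>axis j 1\<close> of the entry \<open>(k, i)\<close> of
    \<open>Bint \<theta>\<close>.\<close>
  define d :: "real^'n" where "d = axis j 1"
  \<comment> \<open>The steps are at most \<open>r - norm z\<close>, so that the displaced points
    stay in the ball; this is the purpose of the strict inequality
    \<open>norm z < r\<close>.\<close>
  define e :: "nat \<Rightarrow> real" where "e n = (r - norm z) / real (Suc n)" for n
  have e: "e n > 0" "e n \<le> r - norm z" for n using z by (auto simp: e_def divide_simps mult_ac)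
  have "(\<lambda>n. (r - norm z) * inverse (real (Suc n))) \<longlonglongrightarrow> (r - norm z) * 0"
    by (intro tendsto_intros LIMSEQ_inverse_real_of_nat)
  then have e0: "e \<longlonglongrightarrow> 0" by (simp only: e_def[abs_def] divide_inverse mult_zero_right)
  have zK: "z + e n *\<^sub>R d \<in> K" "z \<in> K" for n
    using e[of n] norm_triangle_ineq[of z "e n *\<^sub>R d"] z by (auto simp: K_def d_def)
  define q where "q n \<theta> = (1 / e n) *\<^sub>R (Bint \<theta> (z + e n *\<^sub>R d) - Bint \<theta> z)" for n \<theta>
  have lim: "(\<lambda>n. q n \<theta> $ k $ i) \<longlonglongrightarrow> DBint i \<theta> z $ k $ j" if "\<theta> \<in> {-h..0}" for \<theta>
  proof -
    have "(\<lambda>n. q n \<theta>) \<longlonglongrightarrow> matrix_of_columns (\<lambda>i. DBint i \<theta> z *v d)"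
      unfolding q_def
      by (rule difference_quotient_tendsto[OF Bint_deriv[OF that]]) (use zK K e e0 in auto)
    then have "(\<lambda>n. q n \<theta> $ k $ i) \<longlonglongrightarrow> matrix_of_columns (\<lambda>i. DBint i \<theta> z *v d) $ k $ i"
      by (intro tendsto_intros)
    moreover have "matrix_of_columns (\<lambda>i. DBint i \<theta> z *v d) $ k $ i = DBint i \<theta> z $ k $ j"
      by (simp add: matrix_of_columns_def d_def matrix_vector_mul_component inner_axis)
    ultimately show ?thesis by simp
  qed
  have bound: "norm (U (a + \<theta>) $ i * q n \<theta> $ k $ i) \<le> C * L" if "\<theta> \<in> {-h..0}" for n \<theta>
  proof -
    have "norm (q n \<theta>) \<le> (1 / e n) * (L * norm (e n *\<^sub>R d))"
      using mult_left_mono[OF L(2)[OF that zK(1)[of n] zK(2)], of "1 / e n"] e[of n]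
      unfolding q_def by (simp only: norm_scaleR) simp
    also have "\<dots> = L" using e[of n] by (simp add: d_def)
    finally have "\<bar>q n \<theta> $ k $ i\<bar> \<le> L"
      using component_le_norm_cart[of "q n \<theta> $ k" i] Finite_Cartesian_Product.norm_nth_le[of "q n \<theta>" k] by linarith
    moreover have "\<bar>U (a + \<theta>) $ i\<bar> \<le> C" by (rule order_trans[OF component_le_norm_cart C(2)])
    ultimately show ?thesis by (simp add: abs_mult mult_mono C)
  qed
  have "(\<lambda>\<theta>. U (a + \<theta>) $ i * DBint i \<theta> z $ k $ j) integrable_on {-h..c}"
  proof (rule dominated_convergence(1)[where f = "\<lambda>n \<theta>. U (a + \<theta>) $ i * q n \<theta> $ k $ i" and h = "\<lambda>_. C * L"])
    fix n
    let ?disc = "\<lambda>x. {\<theta> \<in> {-h..0}. \<not> continuous (at \<theta> within {-h..0}) (\<lambda>\<theta>. Bint \<theta> x)}"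
    let ?S = "?disc (z + e n *\<^sub>R d) \<union> ?disc z \<union> {\<theta>. \<not> isCont (\<lambda>\<theta>. U (a + \<theta>)) \<theta>}"
    have "(\<lambda>\<theta>. U (a + \<theta>) $ i * q n \<theta> $ k $ i) integrable_on {-h..0}"
    proof (rule integrable_countable_discontinuities[where S = ?S, OF _ _ bound])
      show "countable ?S"
        using admissible_input_shift[OF U, of a] Bint_pc zK K
        by (auto simp: admissible_input_def piecewise_continuous_on_def intro!: countable_finite)
      fix \<theta> assume \<theta>: "\<theta> \<in> {-h..0} - ?S"
      then have "continuous (at \<theta> within {-h..0}) (\<lambda>\<theta>. U (a + \<theta>))"
        by (auto intro: continuous_at_imp_continuous_at_within)
      with \<theta> show "continuous (at \<theta> within {-h..0}) (\<lambda>\<theta>. U (a + \<theta>) $ i * q n \<theta> $ k $ i)"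
        unfolding q_def by (intro continuous_intros) auto
    qed
    then show "(\<lambda>\<theta>. U (a + \<theta>) $ i * q n \<theta> $ k $ i) integrable_on {-h..c}"
      by (rule integrable_on_subinterval) (use c in auto)
  next
    fix \<theta> assume "\<theta> \<in> {-h..c}"
    then have \<theta>: "\<theta> \<in> {-h..0}" using c by auto
    show "(\<lambda>n. U (a + \<theta>) $ i * q n \<theta> $ k $ i) \<longlonglongrightarrow> U (a + \<theta>) $ i * DBint i \<theta> z $ k $ j"
      by (intro tendsto_intros lim \<theta>)
    show "norm (U (a + \<theta>) $ i * q n \<theta> $ k $ i) \<le> C * L" for n by (rule bound[OF \<theta>])
  qed auto
  then show "(\<lambda>\<theta>. (U (a + \<theta>) $ i *\<^sub>R DBint i \<theta> z) \<bullet> b) integrable_on {-h..c}"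
    by (simp add: b inner_axis)
qed

text \<open>The matrix comes first so that the product fits
  \<open>window_integral_continuous\<close>.\<close>

lemma bounded_bilinear_component_scaleR:
  "bounded_bilinear (\<lambda>(M :: real^'n^'n) (u :: real^'m). u $ i *\<^sub>R M)"
  by (rule bounded_bilinear.flip)
    (rule bounded_bilinear.comp1[OF bounded_bilinear_scaleR bounded_linear_vec_nth])

abbreviation variational :: "real \<Rightarrow> real^'n \<Rightarrow> (real \<Rightarrow> real^'m) \<Rightarrow> real^'n^'n" where
  "variational \<equiv> variational_matrix h A DB1 DBint"

text \<open>The gap \<open>r' < r\<close> is passed on to \<open>DBint_input_integrable\<close>,
  whose difference quotients need room around \<open>z p\<close>.\<close>

lemma variational_continuous:
  assumes U: "admissible_input U" and r: "ereal r \<le> R" and S: "S \<subseteq> {0..h}" and zS: "\<And>p. p \<in> S \<Longrightarrow> norm (z p) \<le> r'"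
    and r': "r' < r" and s: "s \<in> S" and cz: "continuous (at s within S) z" and Uc: "isCont U (s - h)"
  shows "continuous (at s within S) (\<lambda>s. variational s (z s) U)"
proof -
  have zr: "norm (z p) < r" if "p \<in> S" for p using zS[OF that] r' by simp
  have zball: "z ` S \<subseteq> origin_ball R"
  proof (rule image_subsetI)
    fix p assume "p \<in> S"
    then have "z p \<in> cball 0 r" using zr[of p] by simp
    then show "z p \<in> origin_ball R" using cball_subset_origin_ball[OF r] by blast
  qed
  obtain C where C: "C \<ge> 0" "\<And>w. norm (U w) \<le> C" using admissible_input_bound[OF U] by blast
  obtain D where D: "D \<ge> 0" "\<And>i \<theta> x. \<theta> \<in> {-h..0} \<Longrightarrow> x \<in> cball 0 r \<Longrightarrow> norm (DBint i \<theta> x) \<le> D"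
    by (rule DBint_uniform_bound[OF cball_subset_origin_ball[OF r] compact_cball]) (rule that; blast)
  have "continuous (at s within S) (\<lambda>p. integral {-h..0-p} (\<lambda>\<theta>. (U (p + \<theta>) $ i) *\<^sub>R DBint i \<theta> (z p)))" for i
  proof (rule window_integral_continuous[OF U _ zball s cz bounded_bilinear_component_scaleR, where g = "DBint i"])
    show "S \<subseteq> {0..0 + h}" using S by simp
    show "continuous_on (origin_ball R) (DBint i \<theta>)" if "\<theta> \<in> {-h..0}" for \<theta> by (rule DBint_cont[OF that])
    show "(\<lambda>\<theta>. U (p + \<theta>) $ i *\<^sub>R DBint i \<theta> (z p)) integrable_on {-h..0-p}" if "p \<in> S" for p
      by (rule DBint_input_integrable[OF U r]) (use zr that S in auto)
    show "0 \<le> C * D" using C D by simp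
    show "norm (U (p + \<theta>) $ i *\<^sub>R DBint i \<theta> (z p)) \<le> C * D" if "p \<in> S" "\<theta> \<in> {-h..0}" for p \<theta>
    proof -
      have "norm (DBint i \<theta> (z p)) \<le> D" using zr[OF that(1)] by (intro D(2) that) simp
      moreover have "\<bar>U (p + \<theta>) $ i\<bar> \<le> C" by (rule order_trans[OF component_le_norm_cart C(2)])
      ultimately show ?thesis using C(1) by (simp add: mult_mono)
    qed
  qed
  then have "continuous (at s within S) (\<lambda>p. integral {-h..-p} (\<lambda>\<theta>. (U (p + \<theta>) $ i) *\<^sub>R DBint i \<theta> (z p)))" for i
    by simp
  moreover have "continuous (at s within S) (\<lambda>s. U (s - h) $ i)" for i
    using continuous_delayed_input[OF Uc] by (rule continuous_component)
  ultimately show ?thesis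
    unfolding variational_matrix_def
    by (intro continuous_add continuous_sum continuous_scaleR continuous_comp_ball[OF A_cont]
        continuous_comp_ball[OF DB1_cont] zball s cz)
qed

lemma variational_bound:
  assumes U: "admissible_input U" and r: "ereal r \<le> R"
  obtains D where "D \<ge> 0" "\<And>s z. s \<in> {0..h} \<Longrightarrow> norm z < r \<Longrightarrow> norm (variational s z U) \<le> D"
proof -
  obtain C where C: "C \<ge> 0" "\<And>w. norm (U w) \<le> C" using admissible_input_bound[OF U] by blast
  obtain D where D: "D \<ge> 0" "\<And>i \<theta> x. \<theta> \<in> {-h..0} \<Longrightarrow> x \<in> cball 0 r \<Longrightarrow> norm (DBint i \<theta> x) \<le> D"
    by (rule DBint_uniform_bound[OF cball_subset_origin_ball[OF r] compact_cball]) (rule that; blast)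
  have bdd: "\<exists>a. \<forall>x\<in>cball 0 r. norm (g x) \<le> a" if "continuous_on (origin_ball R) g" for g :: "real^'n \<Rightarrow> real^'n^'n"
    using compact_imp_bounded[OF compact_continuous_image[OF continuous_on_subset[OF that cball_subset_origin_ball[OF r]] compact_cball]]
    by (auto simp: bounded_iff)
  obtain a where a: "\<And>x. x \<in> cball 0 r \<Longrightarrow> norm (A x) \<le> a" using bdd[OF A_cont] by blast
  have "\<exists>b. \<forall>x\<in>cball 0 r. norm (DB1 i x) \<le> b" for i by (rule bdd[OF DB1_cont])
  then obtain b where b: "\<And>i x. x \<in> cball 0 r \<Longrightarrow> norm (DB1 i x) \<le> b i" by metis
  define D' where "D' = \<bar>a\<bar> + (\<Sum>i\<in>(UNIV::'m set). C * \<bar>b i\<bar>) + (\<Sum>i\<in>(UNIV::'m set). h * (C * D))"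
  have Ui: "\<bar>U w $ i\<bar> \<le> C" for w i by (rule order_trans[OF component_le_norm_cart C(2)])
  have "norm (variational s z U) \<le> D'" if s: "s \<in> {0..h}" and z: "norm z < r" for s z
  proof -
    have zr: "z \<in> cball 0 r" using z by simp
    have "norm (integral {-h..-s} (\<lambda>\<theta>. (U (s + \<theta>) $ i) *\<^sub>R DBint i \<theta> z)) \<le> h * (C * D)" for i
    proof -
      have "norm (integral {-h..-s} (\<lambda>\<theta>. (U (s + \<theta>) $ i) *\<^sub>R DBint i \<theta> z)) \<le> integral {-h..-s} (\<lambda>_. C * D)"
      proof (rule integral_norm_bound_integral)
        show "(\<lambda>\<theta>. (U (s + \<theta>) $ i) *\<^sub>R DBint i \<theta> z) integrable_on {-h..-s}"
          by (rule DBint_input_integrable[OF U r z]) (use s in auto)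
        fix \<theta> assume "\<theta> \<in> {-h..-s}"
        then show "norm (U (s + \<theta>) $ i *\<^sub>R DBint i \<theta> z) \<le> C * D"
          using D(2)[OF _ zr, of \<theta> i] Ui[of "s + \<theta>" i] s by (auto simp: C D intro!: mult_mono)
      qed auto
      also have "\<dots> = (h - s) * (C * D)" using s by simp
      also have "\<dots> \<le> h * (C * D)" by (rule mult_right_mono) (use s C D in auto)
      finally show ?thesis .
    qed
    moreover have "norm (U (s - h) $ i *\<^sub>R DB1 i z) \<le> C * \<bar>b i\<bar>" for i
      using Ui[of "s - h" i] b[OF zr, of i] C by (auto intro!: mult_mono)
    moreover have "norm (A z) \<le> \<bar>a\<bar>" using a[OF zr] by simp
    ultimately show ?thesis
      unfolding variational_matrix_def D'_def
      by (intro order_trans[OF norm_triangle_ineq] add_mono order_trans[OF norm_sum] sum_mono)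
  qed
  moreover have "0 \<le> D'" unfolding D'_def using C D h_pos by (intro add_nonneg_nonneg sum_nonneg mult_nonneg_nonneg) auto
  ultimately show ?thesis using that by blast
qed

lemma variational_cong:
  assumes "\<And>\<theta>. \<theta> \<in> {-h..<0} \<Longrightarrow> \<phi> \<theta> = U \<theta>" "s \<in> {0..h} - {h}"
  shows "variational s z \<phi> = variational s z U"
proof -
  have "integral {-h..-s} (\<lambda>\<theta>. (\<phi> (s + \<theta>) $ i) *\<^sub>R DBint i \<theta> z) = integral {-h..-s} (\<lambda>\<theta>. (U (s + \<theta>) $ i) *\<^sub>R DBint i \<theta> z)" for i
    by (rule integral_spike[of "{-s}"]) (use assms in auto)
  moreover have "\<phi> (s - h) = U (s - h)" using assms by auto
  ultimately show ?thesis by (simp add: variational_matrix_def)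
qed

text \<open>The jumps of \<open>Bint \<theta> x\<close> in \<open>\<theta>\<close> depend on
  \<open>x\<close>, and a union over all states is not visibly countable. Only the jumps for a
  countable dense set of states are collected; the Lipschitz bound in the state, uniform in
  \<open>\<theta>\<close>, carries continuity from a dense state \<open>q\<close> to every nearby
  \<open>z0\<close>, jointly in both arguments.\<close>

lemma Bint_continuous_except_countable:
  assumes K: "K \<subseteq> origin_ball R" "compact K" "convex K"
  obtains D where "countable D"
    "\<And>\<theta>0 z0. \<theta>0 \<in> {-h..0} - D \<Longrightarrow> z0 \<in> K \<Longrightarrow>
       continuous (at (\<theta>0, z0) within ({-h..0} \<times> K)) (\<lambda>p. Bint (fst p) (snd p))"
proof -
  obtain L where L: "L \<ge> 0"
    "\<And>\<theta> x y. \<theta> \<in> {-h..0} \<Longrightarrow> x \<in> K \<Longrightarrow> y \<in> K \<Longrightarrow> norm (Bint \<theta> x - Bint \<theta> y) \<le> L * norm (x - y)"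
    by (rule lipschitz_on_compact[OF K]) (rule that; blast)
  obtain T where T: "countable T" "T \<subseteq> K" "K \<subseteq> closure T" by (rule separable)
  let ?disc = "\<lambda>x. {\<theta> \<in> {-h..0}. \<not> continuous (at \<theta> within {-h..0}) (\<lambda>\<theta>. Bint \<theta> x)}"
  define D where "D = (\<Union>q\<in>T. ?disc q)"
  have "finite (?disc q)" if "q \<in> T" for q
    using Bint_pc[of q] that T K unfolding piecewise_continuous_on_def by blast
  then have "countable D" unfolding D_def by (intro countable_UN T(1)) (rule countable_finite)
  moreover have "\<exists>\<delta>>0. \<forall>p\<in>{-h..0} \<times> K. dist p (\<theta>0, z0) < \<delta> \<longrightarrow> dist (Bint (fst p) (snd p)) (Bint \<theta>0 z0) < \<epsilon>"
    if \<theta>0: "\<theta>0 \<in> {-h..0} - D" and z0: "z0 \<in> K" and \<epsilon>: "\<epsilon> > 0" for \<theta>0 z0 \<epsilon>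
  proof -
    \<comment> \<open>Four differences, passing through \<open>z0\<close> and \<open>q\<close>,
      share \<open>\<epsilon>\<close>: three are Lipschitz terms over a distance below
      \<open>\<eta>\<close>, the fourth is continuity in \<open>\<theta>\<close> at the state
      \<open>q\<close>.\<close>
    define \<eta> where "\<eta> = \<epsilon> / (4 * (L + 1))"
    have \<eta>: "\<eta> > 0" "L * \<eta> \<le> \<epsilon> / 4" using \<epsilon> L(1) by (auto simp: \<eta>_def divide_simps)
    obtain q where q: "q \<in> T" "dist q z0 < \<eta>" using T z0 \<eta> closure_approachable by blast
    have "continuous (at \<theta>0 within {-h..0}) (\<lambda>\<theta>. Bint \<theta> q)" using \<theta>0 q unfolding D_def by blast
    moreover have "\<epsilon> / 4 > 0" using \<epsilon> by simp
    ultimately obtain \<delta> where \<delta>: "\<delta> > 0" "\<And>\<theta>. \<theta> \<in> {-h..0} \<Longrightarrow> dist \<theta> \<theta>0 < \<delta> \<Longrightarrow> dist (Bint \<theta> q) (Bint \<theta>0 q) < \<epsilon> / 4"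
      unfolding continuous_within_eps_delta by blast
    have "norm (Bint \<theta> z - Bint \<theta>0 z0) < \<epsilon>"
      if \<theta>: "\<theta> \<in> {-h..0}" and z: "z \<in> K" and d: "\<bar>\<theta> - \<theta>0\<bar> < min \<delta> \<eta>" "norm (z - z0) < min \<delta> \<eta>" for \<theta> z
    proof -
      have "norm (Bint \<theta> z - Bint \<theta> z0) \<le> L * norm (z - z0)" by (intro L \<theta> z z0)
      also have "\<dots> \<le> L * \<eta>" using d L(1) by (intro mult_left_mono) auto
      finally have 1: "norm (Bint \<theta> z - Bint \<theta> z0) \<le> \<epsilon> / 4" using \<eta> by simp
      have q2: "norm (Bint \<theta> z0 - Bint \<theta> q) \<le> \<epsilon> / 4" if "\<theta> \<in> {-h..0}" for \<theta>
      proof -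
        have "norm (Bint \<theta> z0 - Bint \<theta> q) \<le> L * norm (z0 - q)" using T q by (intro L that z0) auto
        also have "\<dots> \<le> L * \<eta>" using q L(1) by (intro mult_left_mono) (auto simp: dist_norm norm_minus_commute)
        finally show ?thesis using \<eta> by simp
      qed
      have 3: "norm (Bint \<theta> q - Bint \<theta>0 q) < \<epsilon> / 4" using \<delta>(2)[OF \<theta>] d by (simp add: dist_norm)
      have "Bint \<theta> z - Bint \<theta>0 z0 = (Bint \<theta> z - Bint \<theta> z0) + (Bint \<theta> z0 - Bint \<theta> q)
          + (Bint \<theta> q - Bint \<theta>0 q) + (Bint \<theta>0 q - Bint \<theta>0 z0)" by simp
      also have "norm \<dots> \<le> norm (Bint \<theta> z - Bint \<theta> z0) + norm (Bint \<theta> z0 - Bint \<theta> q)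
          + norm (Bint \<theta> q - Bint \<theta>0 q) + norm (Bint \<theta>0 q - Bint \<theta>0 z0)"
        by (intro order_trans[OF norm_triangle_ineq] add_mono order_refl)
      also have "norm (Bint \<theta>0 q - Bint \<theta>0 z0) = norm (Bint \<theta>0 z0 - Bint \<theta>0 q)" by (rule norm_minus_commute)
      finally show ?thesis using 1 q2[OF \<theta>] q2[of \<theta>0] 3 \<theta>0 by auto
    qed
    then have "dist (Bint (fst p) (snd p)) (Bint \<theta>0 z0) < \<epsilon>"
      if "p \<in> {-h..0} \<times> K" "dist p (\<theta>0, z0) < min \<delta> \<eta>" for p
      using that dist_fst_le[of p "(\<theta>0, z0)"] dist_snd_le[of p "(\<theta>0, z0)"]
      by (auto simp: dist_norm)
    then show ?thesis using \<delta>(1) \<eta>(1) by (intro exI[of _ "min \<delta> \<eta>"] conjI ballI impI) auto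
  qed
  ultimately show ?thesis by (intro that[of D]) (auto simp: continuous_within_eps_delta)
qed

end

lemma average_approx:
  fixes g :: "real \<Rightarrow> 'a::banach"
  assumes g: "g integrable_on {a..a+e}" and e: "e > 0"
    and le: "\<And>s. s \<in> {a..a+e} \<Longrightarrow> norm (g s - l) \<le> \<eta>"
  shows "norm ((1 / e) *\<^sub>R integral {a..a+e} g - l) \<le> \<eta>"
proof -
  have "norm (integral {a..a+e} (\<lambda>s. g s - l)) \<le> integral {a..a+e} (\<lambda>_. \<eta>)"
    by (rule integral_norm_bound_integral) (use g le in \<open>auto intro: integrable_diff\<close>)
  also have "integral {a..a+e} (\<lambda>s. g s - l) = integral {a..a+e} g - e *\<^sub>R l"
    using integral_diff[OF g integrable_const_ivl[of l a "a + e"]] e by simp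
  also have "integral {a..a+e} (\<lambda>_. \<eta>) = e * \<eta>" using e by simp
  finally have "(1 / e) * norm (integral {a..a+e} g - e *\<^sub>R l) \<le> (1 / e) * (e * \<eta>)"
    using e by (intro mult_left_mono) auto
  also have "(1 / e) * (e * \<eta>) = \<eta>" using e by simp
  also have "(1 / e) * norm (integral {a..a+e} g - e *\<^sub>R l) = norm ((1 / e) *\<^sub>R (integral {a..a+e} g - e *\<^sub>R l))"
    using e by simp
  also have "(1 / e) *\<^sub>R (integral {a..a+e} g - e *\<^sub>R l) = (1 / e) *\<^sub>R integral {a..a+e} g - l"
    using e by (simp add: scaleR_diff_right)
  finally show ?thesis .
qed

lemma lower_indicator_Icc:
  fixes g :: "real \<Rightarrow> 'a::banach"
  assumes c: "a \<le> c" and g: "g integrable_on {c..b}"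
  shows "(\<lambda>x. if c \<le> x then g x else 0) integrable_on {a..b}"
    and "integral {a..b} (\<lambda>x. if c \<le> x then g x else 0) = integral {c..b} g"
proof -
  have eq: "{c..} \<inter> {a..b} = {c..b}" using c by auto
  show "(\<lambda>x. if c \<le> x then g x else 0) integrable_on {a..b}"
    using integrable_restrict_Int[of "{c..}" g "{a..b}"] g by (simp only: eq atLeast_iff)
  show "integral {a..b} (\<lambda>x. if c \<le> x then g x else 0) = integral {c..b} g"
    using integral_restrict_Int[of "{a..b}" "{c..}" g] by (simp only: eq atLeast_iff)
qed

context predictor_system
begin

lemma Bint_norm_bound:
  obtains C where "C \<ge> 0" "\<And>\<theta> x. \<theta> \<in> {-h..0} \<Longrightarrow> x \<in> origin_ball R \<Longrightarrow> norm (Bint \<theta> x) \<le> C"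
proof -
  obtain C where C: "\<And>\<theta> x. \<theta> \<in> {-h..0} \<Longrightarrow> x \<in> origin_ball R \<Longrightarrow> norm (Bint \<theta> x) \<le> C"
    using Bint_bounded unfolding bounded_iff by force
  have "0 \<le> C" by (rule order_trans[OF norm_ge_zero C[of 0 0]]) (use h_pos zero_in_ball in auto)
  then show ?thesis using C by (rule that)
qed

text \<open>One countable set of times serves every curve \<open>\<beta>\<close>. It collects the
  times at which \<open>\<theta> = -s\<close> is exceptional for \<open>Bint\<close> or
  \<open>U\<close> jumps at \<open>s - h\<close>; joint continuity at \<open>(-s, z0)\<close> is
  recorded for the limit of the shrinking window.\<close>

lemma variational_rhs_regular:
  fixes P :: "real \<Rightarrow> real^'n"
  assumes U: "admissible_input U" and r: "ereal r \<le> R"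
    and P: "continuous_on {0..h} P" "\<forall>s\<in>{0..h}. norm (P s) \<le> r'" "r' < r"
  obtains E where "countable E"
    "\<And>\<beta> s. continuous_on {0..h} \<beta> \<Longrightarrow> s \<in> {0..h} - E \<Longrightarrow>
       continuous (at s within {0..h}) (\<lambda>s. variational s (P s) U ** \<beta> s + Bint (-s) (P s))"
    "\<And>s z0. s \<in> {0..h} - E \<Longrightarrow> norm z0 \<le> r \<Longrightarrow>
       continuous (at (-s, z0) within ({-h..0} \<times> cball 0 r)) (\<lambda>p. Bint (fst p) (snd p))"
    "\<And>s. s \<in> {0..h} - E \<Longrightarrow> isCont U (s - h)"
proof -
  define K where "K = cball (0 :: real^'n) r"
  have K: "K \<subseteq> origin_ball R" "compact K" "convex K"
    using cball_subset_origin_ball[OF r] by (auto simp: K_def)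
  obtain D where D: "countable D"
    "\<And>\<theta>0 z0. \<theta>0 \<in> {-h..0} - D \<Longrightarrow> z0 \<in> K \<Longrightarrow>
       continuous (at (\<theta>0, z0) within ({-h..0} \<times> K)) (\<lambda>p. Bint (fst p) (snd p))"
    by (rule Bint_continuous_except_countable[OF K]) (rule that, assumption, blast)
  define E where "E = uminus ` D \<union> {s. \<not> isCont U (s + - h)}"
  have PK: "P s \<in> K" if "s \<in> {0..h}" for s using P(2)[rule_format, OF that] P(3) by (simp add: K_def)
  have ED: "-s \<in> {-h..0} - D" if "s \<in> {0..h} - E" for s
  proof -
    have "-s \<notin> D"
    proof
      assume "-s \<in> D"
      then have "- (-s) \<in> uminus ` D" by (rule imageI)
      then show False using that by (simp add: E_def)
    qed
    then show ?thesis using that by auto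
  qed
  show ?thesis
  proof (rule that[of E])
    show "countable E"
      using D(1) finite_shifted_discontinuities[OF U, of "-h"] unfolding E_def by (simp add: countable_finite)
    show "isCont U (s - h)" if "s \<in> {0..h} - E" for s using that by (simp add: E_def)
    show "continuous (at (-s, z0) within ({-h..0} \<times> cball 0 r)) (\<lambda>p. Bint (fst p) (snd p))"
      if "s \<in> {0..h} - E" "norm z0 \<le> r" for s z0
      using D(2)[OF ED[OF that(1)], of z0] that(2) by (simp add: K_def)
    fix \<beta> :: "real \<Rightarrow> real^'m^'n" and s assume \<beta>: "continuous_on {0..h} \<beta>" and s: "s \<in> {0..h} - E"
    have cP: "continuous (at s within {0..h}) P" using P(1) s by (simp add: continuous_on_eq_continuous_within)
    have "continuous (at s within {0..h}) (\<lambda>s. variational s (P s) U)"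
      by (rule variational_continuous[OF U r _ P(2)[rule_format] P(3) _ cP]) (use s E_def in auto)
    moreover have "continuous (at s within {0..h}) (\<lambda>s. Bint (-s) (P s))"
    proof -
      have "continuous (at (-s, P s) within ((\<lambda>s. (-s, P s)) ` {0..h})) (\<lambda>p. Bint (fst p) (snd p))"
        by (rule continuous_within_subset[OF D(2)[OF ED[OF s] PK]]) (use s PK in auto)
      then show ?thesis
        using continuous_within_compose2[of s "{0..h}" "\<lambda>s. (-s, P s)" "\<lambda>p. Bint (fst p) (snd p)"] cP
        by (simp add: continuous_Pair continuous_minus)
    qed
    moreover have "continuous (at s within {0..h}) \<beta>" using \<beta> s by (simp add: continuous_on_eq_continuous_within)
    ultimately show "continuous (at s within {0..h}) (\<lambda>s. variational s (P s) U ** \<beta> s + Bint (-s) (P s))"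
      by (intro continuous_add bounded_bilinear.continuous[OF bounded_bilinear_matrix_matrix_mult])
  qed
qed

lemma variational_rhs_integrable:
  fixes P :: "real \<Rightarrow> real^'n" and \<beta> :: "real \<Rightarrow> real^'m^'n"
  assumes U: "admissible_input U" and r: "ereal r \<le> R"
    and P: "continuous_on {0..h} P" "\<forall>s\<in>{0..h}. norm (P s) \<le> r'" "r' < r"
    and \<beta>: "continuous_on {0..h} \<beta>"
  shows "(\<lambda>s. variational s (P s) U ** \<beta> s + Bint (-s) (P s)) integrable_on {0..h}"
proof -
  obtain E where E: "countable E" "\<And>\<beta> s. continuous_on {0..h} \<beta> \<Longrightarrow> s \<in> {0..h} - E \<Longrightarrow>
       continuous (at s within {0..h}) (\<lambda>s. variational s (P s) U ** \<beta> s + Bint (-s) (P s))"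
    by (rule variational_rhs_regular[OF U r P]) (rule that, assumption, blast)
  obtain D where D: "D \<ge> 0" "\<And>s z. s \<in> {0..h} \<Longrightarrow> norm z < r \<Longrightarrow> norm (variational s z U) \<le> D"
    by (rule variational_bound[OF U r]) (rule that, assumption, blast)
  obtain C where C: "C \<ge> 0" "\<And>\<theta> x. \<theta> \<in> {-h..0} \<Longrightarrow> x \<in> origin_ball R \<Longrightarrow> norm (Bint \<theta> x) \<le> C"
    by (rule Bint_norm_bound) (rule that, assumption, blast)
  obtain k where k: "k > 0" "\<And>(M :: real^'n^'n) (N :: real^'m^'n). norm (M ** N) \<le> norm M * norm N * k"
    using bounded_bilinear.pos_bounded[OF bounded_bilinear_matrix_matrix_mult] by blast
  have "bounded (\<beta> ` {0..h})" by (intro compact_imp_bounded compact_continuous_image \<beta>) auto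
  then obtain b where b: "\<And>s. s \<in> {0..h} \<Longrightarrow> norm (\<beta> s) \<le> b" unfolding bounded_iff by blast
  show ?thesis
  proof (rule integrable_countable_discontinuities[OF E(1) E(2)[OF \<beta>], where C = "D * b * k + C"])
    fix s assume s: "s \<in> {0..h}"
    have "P s \<in> cball 0 r" using P(2)[rule_format, OF s] P(3) by simp
    then have "norm (Bint (-s) (P s)) \<le> C" using cball_subset_origin_ball[OF r] s by (intro C(2)) auto
    moreover have "norm (variational s (P s) U ** \<beta> s) \<le> D * b * k"
      using D(2)[OF s, of "P s"] P(2)[rule_format, OF s] P(3) b[OF s] k D(1)
      by (intro order_trans[OF k(2)] mult_right_mono mult_mono) auto
    ultimately show "norm (variational s (P s) U ** \<beta> s + Bint (-s) (P s)) \<le> D * b * k + C"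
      by (intro order_trans[OF norm_triangle_ineq] add_mono)
  qed
qed

section \<open>Solutions of the variational equation and the input matrix\<close>

definition variational_solution ::
    "(real \<Rightarrow> real^'m) \<Rightarrow> (real \<Rightarrow> real^'n) \<Rightarrow> real^'m^'n \<Rightarrow> (real \<Rightarrow> real^'m^'n) \<Rightarrow> bool" where
  "variational_solution U P M0 \<beta> \<longleftrightarrow> continuous_on {0..h} \<beta> \<and>
     (\<forall>s\<in>{0..h}. \<beta> s = M0 + integral {0..s} (\<lambda>s. variational s (P s) U ** \<beta> s + Bint (-s) (P s)))"

lemma variational_lipschitz:
  assumes U: "admissible_input U" and r: "ereal r \<le> R"
  obtains L where "L \<ge> 0" "\<And>s z (M :: real^'m^'n) N. s \<in> {0..h} \<Longrightarrow> norm z < r \<Longrightarrow>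
    norm (variational s z U ** M - variational s z U ** N) \<le> L * norm (M - N)"
proof -
  obtain D where D: "D \<ge> 0" "\<And>s z. s \<in> {0..h} \<Longrightarrow> norm z < r \<Longrightarrow> norm (variational s z U) \<le> D"
    by (rule variational_bound[OF U r]) (rule that, assumption, blast)
  obtain k where k: "k > 0" "\<And>(M :: real^'n^'n) (N :: real^'m^'n). norm (M ** N) \<le> norm M * norm N * k"
    using bounded_bilinear.pos_bounded[OF bounded_bilinear_matrix_matrix_mult] by blast
  have "norm (variational s z U ** M - variational s z U ** N) \<le> D * k * norm (M - N)"
    if "s \<in> {0..h}" "norm z < r" for s z and M N :: "real^'m^'n"
  proof -
    have "norm (variational s z U ** M - variational s z U ** N) = norm (variational s z U ** (M - N))"
      by (simp add: bounded_bilinear.diff_right[OF bounded_bilinear_matrix_matrix_mult])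
    also have "\<dots> \<le> norm (variational s z U) * norm (M - N) * k" by (rule k)
    also have "\<dots> \<le> D * norm (M - N) * k" using D(2)[OF that] k(1) by (intro mult_right_mono) auto
    finally show ?thesis by (simp add: mult_ac)
  qed
  then show ?thesis using that[of "D * k"] D k by auto
qed

text \<open>The equation is affine in \<open>\<beta>\<close> with bounded coefficient, hence
  globally Lipschitz, so Picard iteration applies without truncation.\<close>

lemma variational_solution_exists:
  assumes U: "admissible_input U" and r: "ereal r \<le> R"
    and P: "continuous_on {0..h} P" "\<forall>s\<in>{0..h}. norm (P s) \<le> r'" "r' < r"
  obtains \<beta> where "variational_solution U P M0 \<beta>"
proof -
  obtain L where L: "L \<ge> 0" "\<And>s z (M :: real^'m^'n) N. s \<in> {0..h} \<Longrightarrow> norm z < r \<Longrightarrow>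
    norm (variational s z U ** M - variational s z U ** N) \<le> L * norm (M - N)"
    by (rule variational_lipschitz[OF U r]) (rule that, assumption, blast)
  obtain \<beta> where "continuous_on {0..h} \<beta>"
    "\<And>t. t \<in> {0..h} \<Longrightarrow> \<beta> t = M0 + integral {0..t} (\<lambda>s. variational s (P s) U ** \<beta> s + Bint (-s) (P s))"
  proof (rule picard_lindelof[of 0 h "\<lambda>s M. variational s (P s) U ** M + Bint (-s) (P s)" L M0])
    fix s :: real and M N :: "real^'m^'n" assume "s \<in> {0..h}"
    then show "norm (variational s (P s) U ** M + Bint (- s) (P s) - (variational s (P s) U ** N + Bint (- s) (P s))) \<le> L * norm (M - N)"
      using L(2)[of s "P s" M N] P(2)[rule_format, of s] P(3) by auto
  next
    show "(\<lambda>t. variational t (P t) U ** z t + Bint (- t) (P t)) integrable_on {0..h}"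
      if "continuous_on {0..h} z" for z
      by (rule variational_rhs_integrable[OF U r P that])
  qed (use h_pos that in auto)
  then show ?thesis using that unfolding variational_solution_def by blast
qed

lemma variational_solution_unique:
  assumes U: "admissible_input U" and r: "ereal r \<le> R"
    and P: "continuous_on {0..h} P" "\<forall>s\<in>{0..h}. norm (P s) \<le> r'" "r' < r"
    and \<beta>: "variational_solution U P M0 \<beta>" and \<beta>': "variational_solution U P M0 \<beta>'"
  shows "\<beta> h = \<beta>' h"
proof -
  obtain L where L: "L \<ge> 0" "\<And>s z (M :: real^'m^'n) N. s \<in> {0..h} \<Longrightarrow> norm z < r \<Longrightarrow>
    norm (variational s z U ** M - variational s z U ** N) \<le> L * norm (M - N)"
    by (rule variational_lipschitz[OF U r]) (rule that, assumption, blast)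
  have c: "continuous_on {0..h} \<beta>" "continuous_on {0..h} \<beta>'"
    using \<beta> \<beta>' unfolding variational_solution_def by blast+
  have eq: "\<beta> t = M0 + integral {0..t} (\<lambda>s. variational s (P s) U ** \<beta> s + Bint (-s) (P s))"
    "\<beta>' t = M0 + integral {0..t} (\<lambda>s. variational s (P s) U ** \<beta>' s + Bint (-s) (P s))" if "t \<in> {0..h}" for t
    using \<beta> \<beta>' that unfolding variational_solution_def by blast+
  have cn: "continuous_on {0..h} (\<lambda>s. norm (\<beta> s - \<beta>' s))" by (intro continuous_intros c)
  have "norm (\<beta> h - \<beta>' h) \<le> (0 + integral {0..h} (\<lambda>_. 0)) * exp (L * (h - 0))"
  proof (rule gronwall_forward[OF _ cn L(1)])
    fix t assume t: "t \<in> {0..h}"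
    have int: "(\<lambda>s. variational s (P s) U ** z s + Bint (- s) (P s)) integrable_on {0..t}"
      if "continuous_on {0..h} z" for z
      by (rule integrable_on_subinterval[OF variational_rhs_integrable[OF U r P that]]) (use t in auto)
    have d: "\<beta> t - \<beta>' t = integral {0..t} (\<lambda>s. (variational s (P s) U ** \<beta> s + Bint (-s) (P s)) - (variational s (P s) U ** \<beta>' s + Bint (-s) (P s)))"
      unfolding integral_diff[OF int[OF c(1)] int[OF c(2)]] by (simp add: eq[OF t])
    show "norm (\<beta> t - \<beta>' t) \<le> 0 + integral {0..t} (\<lambda>s. L * norm (\<beta> s - \<beta>' s) + 0)"
      unfolding d add_0[of "integral _ _"]
    proof (rule integral_norm_bound_integral)
      show "(\<lambda>s. L * norm (\<beta> s - \<beta>' s) + 0) integrable_on {0..t}"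
        by (intro integrable_continuous_real continuous_intros continuous_on_subset[OF c(1)] continuous_on_subset[OF c(2)])
          (use t in auto)
      fix s assume "s \<in> {0..t}"
      then show "norm ((variational s (P s) U ** \<beta> s + Bint (-s) (P s)) - (variational s (P s) U ** \<beta>' s + Bint (-s) (P s))) \<le> L * norm (\<beta> s - \<beta>' s) + 0"
        using L(2)[of s "P s" "\<beta> s" "\<beta>' s"] P(2)[rule_format, of s] P(3) t by auto
    qed (intro integrable_diff int c)
  qed (use h_pos in auto)
  then show ?thesis by simp
qed

text \<open>Both unknowns under the definite description are forced: the terminal value determines
  \<open>\<xi>\<close>, and the linear equation started at \<open>B0 (\<xi> 0)\<close> determines
  \<open>\<beta> h\<close>.\<close>

lemma input_matrix_eq:
  assumes U: "admissible_input U" and \<phi>: "\<And>\<theta>. \<theta> \<in> {-h..<0} \<Longrightarrow> \<phi> \<theta> = U \<theta>" and P: "trajectory U 0 P"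
    and r: "ereal r \<le> R" and r': "\<forall>s\<in>{0..h}. norm (P s) \<le> r'" "r' < r"
    and \<beta>: "variational_solution U P (B0 (P 0)) \<beta>"
  shows "input_matrix h R f A B0 B1 DB1 Bint DBint (P h) \<phi> = B1 (P h) + \<beta> h"
proof -
  have iff: "predictor_trajectory h R f B1 Bint \<phi> \<xi> \<longleftrightarrow> trajectory U 0 \<xi>" for \<xi>
    by (rule predictor_trajectory_iff[OF U]) (rule \<phi>)
  have cP: "continuous_on {0..h} P" using trajectory_continuous_on[OF P] by simp
  obtain E where E: "countable E" "\<And>\<beta> s. continuous_on {0..h} \<beta> \<Longrightarrow> s \<in> {0..h} - E \<Longrightarrow>
       continuous (at s within {0..h}) (\<lambda>s. variational s (P s) U ** \<beta> s + Bint (-s) (P s))"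
    by (rule variational_rhs_regular[OF U r cP r']) (rule that, assumption, blast)
  let ?F = "\<lambda>\<phi> s b. variational s (P s) \<phi> ** b + Bint (-s) (P s)"
  have vc: "variational s z \<phi> = variational s z U" if "s \<in> {0..h} - {h}" for s z
    by (rule variational_cong[OF _ that]) (rule \<phi>)
  have sol: "solves_on {0..h} (?F \<phi>) \<beta> \<longleftrightarrow> solves_on {0..h} (?F U) \<beta>" for \<beta> :: "real \<Rightarrow> real^'m^'n"
    by (intro iffI; erule solves_on_cong[where S = "{h}"]) (simp_all add: vc)
  show ?thesis
    unfolding input_matrix_def iff
  proof (rule the_equality)
    have c: "continuous_on {0..h} \<beta>" using \<beta> unfolding variational_solution_def by blast
    have "solves_on {0..h} (?F U) \<beta>"
      by (rule integral_imp_solves_on[where F = "?F U" and z = \<beta> and ?z0.0 = "B0 (P 0)", OF E(1) _ variational_rhs_integrable[OF U r cP r' c]])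
        (erule E(2)[OF c], erule bspec[OF conjunct2[OF \<beta>[unfolded variational_solution_def]]])
    moreover have "\<beta> 0 = B0 (P 0)" using \<beta> h_pos unfolding variational_solution_def by force
    ultimately show "\<exists>\<xi> \<beta>'. trajectory U 0 \<xi> \<and> \<xi> h = P h \<and>
        solves_on {0..h} (\<lambda>s b. variational s (\<xi> s) \<phi> ** b + Bint (- s) (\<xi> s)) \<beta>' \<and>
        \<beta>' 0 = B0 (\<xi> 0) \<and> B1 (P h) + \<beta> h = B1 (\<xi> h) + \<beta>' h"
      using P sol by blast
  next
    fix M
    assume "\<exists>\<xi> \<beta>'. trajectory U 0 \<xi> \<and> \<xi> h = P h \<and>
        solves_on {0..h} (\<lambda>s b. variational s (\<xi> s) \<phi> ** b + Bint (- s) (\<xi> s)) \<beta>' \<and>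
        \<beta>' 0 = B0 (\<xi> 0) \<and> M = B1 (\<xi> h) + \<beta>' h"
    then obtain \<xi> \<beta>' where \<xi>: "trajectory U 0 \<xi>" "\<xi> h = P h" "\<beta>' 0 = B0 (\<xi> 0)" "M = B1 (\<xi> h) + \<beta>' h"
      and s: "solves_on {0..h} (\<lambda>s b. variational s (\<xi> s) \<phi> ** b + Bint (- s) (\<xi> s)) \<beta>'" by blast
    have eq: "\<xi> s = P s" if "s \<in> {0..h}" for s
      using trajectory_unique[OF U \<xi>(1) P, of s] \<xi>(2) that by simp
    have "solves_on {0..h} (?F \<phi>) \<beta>'"
      by (rule solves_on_cong[OF s, of "{}"]) (use eq in auto)
    then have s': "solves_on {0..h} (?F U) \<beta>'" by (simp add: sol)
    then have c': "continuous_on {0..h} \<beta>'" by (simp add: solves_on_def)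
    have "variational_solution U P (B0 (P 0)) \<beta>'"
      unfolding variational_solution_def
    proof (intro conjI ballI c')
      fix t assume "t \<in> {0..h}"
      then show "\<beta>' t = B0 (P 0) + integral {0..t} (\<lambda>s. variational s (P s) U ** \<beta>' s + Bint (- s) (P s))"
        using solves_on_imp_integral[OF s' E(1) E(2)[OF c'] variational_rhs_integrable[OF U r cP r' c'], of t]
          \<xi>(3) eq[of 0] h_pos by simp
    qed
    then have "\<beta>' h = \<beta> h" using variational_solution_unique[OF U r cP r' _ \<beta>] by blast
    then show "M = B1 (P h) + \<beta> h" using \<xi> by simp
  qed
qed

section \<open>Dependence on the starting time and on the state\<close>

text \<open>The right-hand sides differ only in the window: a later start adds the inputs on
  \<open>[\<tau>, \<tau>']\<close>.\<close>

lemma predictor_rhs_later_start: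
  assumes U: "admissible_input U" and z: "z \<in> origin_ball R" and a: "\<tau> \<le> \<tau>'" "\<tau>' \<le> a" "a \<le> \<tau> + h"
  shows "predictor_rhs U \<tau>' a z - predictor_rhs U \<tau> a z = integral {\<tau>-a..\<tau>'-a} (\<lambda>\<theta>. Bint \<theta> z *v U (a + \<theta>))"
proof -
  have "integral {-h..\<tau>-a} (\<lambda>\<theta>. Bint \<theta> z *v U (a + \<theta>)) + integral {\<tau>-a..\<tau>'-a} (\<lambda>\<theta>. Bint \<theta> z *v U (a + \<theta>))
      = integral {-h..\<tau>'-a} (\<lambda>\<theta>. Bint \<theta> z *v U (a + \<theta>))"
    by (intro Henstock_Kurzweil_Integration.integral_combine Bint_input_integrable U z) (use a in auto)
  then show ?thesis by (simp add: predictor_rhs_def algebra_simps)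
qed

lemma predictor_rhs_later_start_le:
  assumes U: "admissible_input U" "\<And>w. norm (U w) \<le> C" and z: "z \<in> origin_ball R"
    and a: "\<tau> \<le> \<tau>'" "\<tau>' \<le> a" "a \<le> \<tau> + h"
  shows "norm (predictor_rhs U \<tau>' a z - predictor_rhs U \<tau> a z) \<le> (\<tau>' - \<tau>) * (Bint_sup * C)"
proof -
  have "norm (integral {\<tau>-a..\<tau>'-a} (\<lambda>\<theta>. Bint \<theta> z *v U (a + \<theta>))) \<le> integral {\<tau>-a..\<tau>'-a} (\<lambda>_. Bint_sup * C)"
  proof (rule integral_norm_bound_integral)
    show "(\<lambda>\<theta>. Bint \<theta> z *v U (a + \<theta>)) integrable_on {\<tau>-a..\<tau>'-a}"
      by (intro Bint_input_integrable U z) (use a in auto)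
    fix \<theta> assume "\<theta> \<in> {\<tau>-a..\<tau>'-a}"
    then show "norm (Bint \<theta> z *v U (a + \<theta>)) \<le> Bint_sup * C"
      using a by (intro order_trans[OF Bint_mult_le[OF _ z] mult_left_mono[OF U(2) Bint_sup_nonneg]]) auto
  qed auto
  also have "\<dots> = (\<tau>' - \<tau>) * (Bint_sup * C)" using a by simp
  finally show ?thesis unfolding predictor_rhs_later_start[OF U(1) z a] .
qed

text \<open>On the overlap \<open>[e, h]\<close> the two trajectories satisfy equations differing by
  \<open>O(e)\<close>, so Gronwall applies; outside the overlap each moves by at most
  \<open>D * e\<close>. The constant is uniform in the input and the trajectories, because
  continuity of the predicted state compares a different translate of the input at every
  time.\<close>

lemma trajectory_shift_estimate:
  assumes r: "ereal r \<le> R" "r \<ge> 0" and C: "C \<ge> 0"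
  obtains c where "c \<ge> 0"
    "\<And>U P Q e. admissible_input U \<Longrightarrow> (\<And>w. norm (U w) \<le> C) \<Longrightarrow> trajectory U 0 P \<Longrightarrow> trajectory U e Q \<Longrightarrow>
       0 \<le> e \<Longrightarrow> e \<le> h \<Longrightarrow> (\<And>s. s \<in> {0..h} \<Longrightarrow> norm (P s) \<le> r) \<Longrightarrow> (\<And>s. s \<in> {e..e+h} \<Longrightarrow> norm (Q s) \<le> r) \<Longrightarrow>
       norm (Q (e + h) - P h) \<le> c * (norm (Q e - P 0) + e)"
proof -
  define K where "K = cball (0 :: real^'n) r"
  have K: "K \<subseteq> origin_ball R" "compact K" "convex K"
    using cball_subset_origin_ball[OF r(1)] by (auto simp: K_def)
  obtain L where L: "L \<ge> 0" "\<And>U \<tau> a x y. admissible_input U \<Longrightarrow> (\<And>w. norm (U w) \<le> C) \<Longrightarrow> a \<in> {\<tau>..\<tau>+h} \<Longrightarrow>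
      x \<in> K \<Longrightarrow> y \<in> K \<Longrightarrow> norm (predictor_rhs U \<tau> a x - predictor_rhs U \<tau> a y) \<le> L * norm (x - y)"
    by (rule predictor_rhs_lipschitz[OF K C]) (rule that, assumption, blast)
  obtain D where D: "D \<ge> 0" "\<And>U \<tau> a z. admissible_input U \<Longrightarrow> (\<And>w. norm (U w) \<le> C) \<Longrightarrow> a \<in> {\<tau>..\<tau>+h} \<Longrightarrow>
      z \<in> origin_ball R \<Longrightarrow> norm z \<le> r \<Longrightarrow> norm (predictor_rhs U \<tau> a z) \<le> D"
    by (rule predictor_rhs_bound[OF r(2) C]) (rule that, assumption, blast)
  \<comment> \<open>The term with the exponential is the Gronwall estimate on the overlap, including
    the drift of \<open>P\<close> on \<open>[0, e]\<close>; the last \<open>D\<close> is the drift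
    of the later trajectory on \<open>[h, e + h]\<close>.\<close>
  define c where "c = (1 + D + h * (Bint_sup * C)) * exp (L * h) + D"
  have BC: "0 \<le> Bint_sup * C" using Bint_sup_nonneg C by simp
  have "norm (Q (e + h) - P h) \<le> c * (norm (Q e - P 0) + e)"
    if U: "admissible_input U" "\<And>w. norm (U w) \<le> C" and P: "trajectory U 0 P" and Q: "trajectory U e Q"
      and e: "0 \<le> e" "e \<le> h" and Pr: "\<And>s. s \<in> {0..h} \<Longrightarrow> norm (P s) \<le> r" and Qr: "\<And>s. s \<in> {e..e+h} \<Longrightarrow> norm (Q s) \<le> r"
    for U P Q e
  proof -
    have inc: "norm (S b - S a) \<le> D * (b - a)"
      if S: "trajectory U \<tau> S" and Sr: "\<And>s. s \<in> {\<tau>..\<tau>+h} \<Longrightarrow> norm (S s) \<le> r" and ab: "\<tau> \<le> a" "a \<le> b" "b \<le> \<tau> + h" for S \<tau> a b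
    proof -
      have "norm (integral {a..b} (\<lambda>s. predictor_rhs U \<tau> s (S s))) \<le> integral {a..b} (\<lambda>_. D)"
      proof (rule integral_norm_bound_integral)
        show "(\<lambda>s. predictor_rhs U \<tau> s (S s)) integrable_on {a..b}"
          by (rule trajectory_integrable[OF U(1) S]) (use ab in auto)
        fix s assume s: "s \<in> {a..b}"
        then show "norm (predictor_rhs U \<tau> s (S s)) \<le> D"
          using ab Sr[of s] trajectory_in_ball[OF S] by (intro D(2) U) auto
      qed auto
      then show ?thesis using ab by (simp add: trajectory_increment[OF U(1) S ab] mult.commute)
    qed
    have cP: "continuous_on {e..h} P" and cQ: "continuous_on {e..h} Q"
      using trajectory_continuous_on[OF P] trajectory_continuous_on[OF Q] e by (auto elim!: continuous_on_subset)
    have ball: "P s \<in> origin_ball R" "P s \<in> K" "Q s \<in> K" if "s \<in> {e..h}" for s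
      using Pr[of s] Qr[of s] K(1) that e by (auto simp: K_def)
    have "norm (Q h - P h) \<le> (norm (Q e - P e) + integral {e..h} (\<lambda>_. e * (Bint_sup * C))) * exp (L * (h - e))"
    proof (rule gronwall_forward[OF e(2) _ L(1)])
      show "continuous_on {e..h} (\<lambda>s. norm (Q s - P s))" by (intro continuous_intros cP cQ)
      fix t assume t: "t \<in> {e..h}"
      have iP: "(\<lambda>s. predictor_rhs U 0 s (P s)) integrable_on {e..t}"
        by (rule trajectory_integrable[OF U(1) P]) (use t e in auto)
      have iQ: "(\<lambda>s. predictor_rhs U e s (Q s)) integrable_on {e..t}"
        by (rule trajectory_integrable[OF U(1) Q]) (use t e in auto)
      have "Q t - P t = (Q e - P e) + integral {e..t} (\<lambda>s. predictor_rhs U e s (Q s) - predictor_rhs U 0 s (P s))"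
        using trajectory_increment[OF U(1) P, of e t] trajectory_increment[OF U(1) Q, of e t] t e
        by (simp add: integral_diff iP iQ algebra_simps)
      moreover have "norm (integral {e..t} (\<lambda>s. predictor_rhs U e s (Q s) - predictor_rhs U 0 s (P s)))
          \<le> integral {e..t} (\<lambda>s. L * norm (Q s - P s) + e * (Bint_sup * C))"
      proof (rule integral_norm_bound_integral)
        show "(\<lambda>s. predictor_rhs U e s (Q s) - predictor_rhs U 0 s (P s)) integrable_on {e..t}"
          by (intro integrable_diff iP iQ)
        show "(\<lambda>s. L * norm (Q s - P s) + e * (Bint_sup * C)) integrable_on {e..t}"
          by (intro integrable_continuous_real continuous_intros continuous_on_subset[OF cP] continuous_on_subset[OF cQ])
            (use t in auto)
        fix s assume s: "s \<in> {e..t}"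
        then have s': "s \<in> {e..h}" using t by auto
        have "norm (predictor_rhs U e s (Q s) - predictor_rhs U e s (P s)) \<le> L * norm (Q s - P s)"
          by (intro L(2) U ball s') (use s' e in auto)
        moreover have "norm (predictor_rhs U e s (P s) - predictor_rhs U 0 s (P s)) \<le> (e - 0) * (Bint_sup * C)"
          by (intro predictor_rhs_later_start_le U ball s') (use s' e in auto)
        ultimately show "norm (predictor_rhs U e s (Q s) - predictor_rhs U 0 s (P s)) \<le> L * norm (Q s - P s) + e * (Bint_sup * C)"
          using norm_triangle_ineq[of "predictor_rhs U e s (Q s) - predictor_rhs U e s (P s)" "predictor_rhs U e s (P s) - predictor_rhs U 0 s (P s)"]
          by simp
      qed
      ultimately show "norm (Q t - P t) \<le> norm (Q e - P e) + integral {e..t} (\<lambda>s. L * norm (Q s - P s) + e * (Bint_sup * C))"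
        using norm_triangle_ineq[of "Q e - P e" "integral {e..t} (\<lambda>s. predictor_rhs U e s (Q s) - predictor_rhs U 0 s (P s))"]
        by simp
    qed (use BC e in auto)
    also have "\<dots> \<le> (norm (Q e - P 0) + D * e + h * (Bint_sup * C) * e) * exp (L * h)"
    proof (rule mult_mono)
      have "norm (Q e - P e) \<le> norm (Q e - P 0) + norm (P e - P 0)"
        using norm_triangle_ineq4[of "Q e - P 0" "P e - P 0"] by simp
      also have "norm (P e - P 0) \<le> D * e" using inc[OF P, of 0 e] Pr e by simp
      finally have "norm (Q e - P e) \<le> norm (Q e - P 0) + D * e" by simp
      moreover have "(h - e) * (e * (Bint_sup * C)) \<le> h * (e * (Bint_sup * C))"
        using e BC by (intro mult_right_mono) auto
      ultimately show "norm (Q e - P e) + integral {e..h} (\<lambda>_. e * (Bint_sup * C)) \<le> norm (Q e - P 0) + D * e + h * (Bint_sup * C) * e"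
        using e by (simp add: mult_ac)
    qed (use L e D BC C Bint_sup_nonneg h_pos in \<open>auto intro!: mult_left_mono add_nonneg_nonneg mult_nonneg_nonneg\<close>)
    finally have 1: "norm (Q h - P h) \<le> (norm (Q e - P 0) + D * e + h * (Bint_sup * C) * e) * exp (L * h)" .
    have 2: "norm (Q (e + h) - Q h) \<le> D * e" using inc[OF Q Qr, of h "e + h"] e by simp
    have "norm (Q (e + h) - P h) \<le> norm (Q (e + h) - Q h) + norm (Q h - P h)"
      using norm_triangle_ineq[of "Q (e + h) - Q h" "Q h - P h"] by simp
    also have "\<dots> \<le> D * e + (norm (Q e - P 0) + D * e + h * (Bint_sup * C) * e) * exp (L * h)"
      by (intro add_mono 1 2)
    also have "\<dots> \<le> c * (norm (Q e - P 0) + e)"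
    proof -
      have "norm (Q e - P 0) + D * e + h * (Bint_sup * C) * e \<le> (1 + D + h * (Bint_sup * C)) * (norm (Q e - P 0) + e)"
      proof -
        have "0 \<le> D * norm (Q e - P 0)" "0 \<le> h * (Bint_sup * C) * norm (Q e - P 0)"
          using D(1) mult_nonneg_nonneg[OF mult_nonneg_nonneg[OF less_imp_le[OF h_pos] BC] norm_ge_zero[of "Q e - P 0"]]
          by simp_all
        then show ?thesis using e by (simp add: algebra_simps)
      qed
      then have "(norm (Q e - P 0) + D * e + h * (Bint_sup * C) * e) * exp (L * h)
          \<le> (1 + D + h * (Bint_sup * C)) * (norm (Q e - P 0) + e) * exp (L * h)"
        by (rule mult_right_mono) simp
      moreover have "D * e \<le> D * (norm (Q e - P 0) + e)" using D(1) by (intro mult_left_mono) auto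
      ultimately show ?thesis unfolding c_def by (simp add: algebra_simps)
    qed
    finally show ?thesis .
  qed
  moreover have "c \<ge> 0" unfolding c_def using D BC C Bint_sup_nonneg h_pos by (intro add_nonneg_nonneg mult_nonneg_nonneg) auto
  ultimately show ?thesis using that by blast
qed


text \<open>Identifies \<open>variational_matrix\<close> as the derivative of the right-hand side in
  the state. The limit passes under the integral because the difference quotients of
  \<open>Bint\<close> are bounded by its Lipschitz constant; a matrix of columns applied to an input
  value is then regrouped as a linear map acting on \<open>d\<close>.\<close>

lemma predictor_rhs_gateaux:
  assumes U: "admissible_input U" and r: "ereal r \<le> R" and s: "s \<in> {0..h}" and z: "norm z < r"
    and e: "e \<longlonglongrightarrow> 0" "\<And>k. e k > 0" and ze: "\<And>k. norm (z + e k *\<^sub>R d) \<le> r"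
  shows "(\<lambda>k. (1 / e k) *\<^sub>R (predictor_rhs U 0 s (z + e k *\<^sub>R d) - predictor_rhs U 0 s z))
    \<longlonglongrightarrow> variational s z U *v d"
proof -
  define K where "K = cball (0 :: real^'n) r"
  have K: "K \<subseteq> origin_ball R" "compact K" "convex K"
    using cball_subset_origin_ball[OF r] by (auto simp: K_def)
  let ?W = "\<lambda>k. z + e k *\<^sub>R d"
  have WK: "?W k \<in> K" "z \<in> K" for k using ze z by (auto simp: K_def)
  have Wb: "?W k \<in> origin_ball R" "z \<in> origin_ball R" for k using WK K by blast+
  obtain L where L: "L \<ge> 0"
    "\<And>\<theta> x y. \<theta> \<in> {-h..0} \<Longrightarrow> x \<in> K \<Longrightarrow> y \<in> K \<Longrightarrow> norm (Bint \<theta> x - Bint \<theta> y) \<le> L * norm (x - y)"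
    by (rule lipschitz_on_compact[OF K]) (rule that, assumption, blast)
  obtain C where C: "C \<ge> 0" "\<And>w. norm (U w) \<le> C" using admissible_input_bound[OF U] by blast
  note mv_tendsto = bounded_bilinear.tendsto[OF bounded_bilinear_matrix_vector_mult _ tendsto_const]
  have f: "(\<lambda>k. (1 / e k) *\<^sub>R (f (?W k) - f z)) \<longlonglongrightarrow> A z *v d"
    by (rule difference_quotient_tendsto[OF f_deriv[OF Wb(2)] Wb(1) e])
  have "(\<lambda>k. ((1 / e k) *\<^sub>R (B1 (?W k) - B1 z)) *v U (s - h)) \<longlonglongrightarrow> matrix_of_columns (\<lambda>i. DB1 i z *v d) *v U (s - h)"
    by (intro mv_tendsto difference_quotient_tendsto[OF B1_deriv[OF Wb(2)] Wb(1) e])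
  then have b: "(\<lambda>k. (1 / e k) *\<^sub>R (B1 (?W k) *v U (s - h) - B1 z *v U (s - h))) \<longlonglongrightarrow> (\<Sum>i\<in>UNIV. U (s - h) $ i *\<^sub>R DB1 i z) *v d"
    by (simp add: matrix_of_columns_mult_vec matrix_vector_mult_diff_rdistrib scaleR_matrix_vector_assoc[symmetric]
        bounded_bilinear.sum_left[OF bounded_bilinear_matrix_vector_mult])
  let ?J = "\<lambda>x. integral {-h..-s} (\<lambda>\<theta>. Bint \<theta> x *v U (s + \<theta>))"
  have intB: "(\<lambda>\<theta>. Bint \<theta> x *v U (s + \<theta>)) integrable_on {-h..-s}" if "x \<in> origin_ball R" for x
    by (intro Bint_input_integrable U that) (use s in auto)
  have "(\<lambda>k. integral {-h..-s} (\<lambda>\<theta>. (1 / e k) *\<^sub>R (Bint \<theta> (?W k) *v U (s + \<theta>) - Bint \<theta> z *v U (s + \<theta>))))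
      \<longlonglongrightarrow> integral {-h..-s} (\<lambda>\<theta>. matrix_of_columns (\<lambda>i. DBint i \<theta> z *v d) *v U (s + \<theta>))"
  proof (rule dominated_convergence(2)[where h = "\<lambda>_. L * norm d * C"])
    show "(\<lambda>\<theta>. (1 / e k) *\<^sub>R (Bint \<theta> (?W k) *v U (s + \<theta>) - Bint \<theta> z *v U (s + \<theta>))) integrable_on {-h..-s}" for k
      by (intro integrable_cmul integrable_diff intB Wb)
    fix \<theta> assume "\<theta> \<in> {-h..-s}"
    then have \<theta>: "\<theta> \<in> {-h..0}" using s by auto
    have eq: "(1 / e k) *\<^sub>R (Bint \<theta> (?W k) *v U (s + \<theta>) - Bint \<theta> z *v U (s + \<theta>))
        = ((1 / e k) *\<^sub>R (Bint \<theta> (?W k) - Bint \<theta> z)) *v U (s + \<theta>)" for k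
      by (simp add: matrix_vector_mult_diff_rdistrib scaleR_matrix_vector_assoc[symmetric])
    show "(\<lambda>k. (1 / e k) *\<^sub>R (Bint \<theta> (?W k) *v U (s + \<theta>) - Bint \<theta> z *v U (s + \<theta>)))
        \<longlonglongrightarrow> matrix_of_columns (\<lambda>i. DBint i \<theta> z *v d) *v U (s + \<theta>)"
      unfolding eq by (intro mv_tendsto difference_quotient_tendsto[OF Bint_deriv[OF \<theta> Wb(2)] Wb(1) e])
    show "norm ((1 / e k) *\<^sub>R (Bint \<theta> (?W k) *v U (s + \<theta>) - Bint \<theta> z *v U (s + \<theta>))) \<le> L * norm d * C" for k
    proof -
      have "norm ((1 / e k) *\<^sub>R (Bint \<theta> (?W k) - Bint \<theta> z)) \<le> (1 / e k) * (L * norm (?W k - z))"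
        using mult_left_mono[OF L(2)[OF \<theta> WK(1)[of k] WK(2)], of "1 / e k"] e(2)[of k]
        by (simp only: norm_scaleR) simp
      also have "\<dots> = L * norm d" using e(2)[of k] by simp
      finally show ?thesis
        unfolding eq using C by (intro order_trans[OF norm_matrix_vector_mult_le] mult_mono) (auto simp: L)
    qed
  qed auto
  moreover have "integral {-h..-s} (\<lambda>\<theta>. (1 / e k) *\<^sub>R (Bint \<theta> (?W k) *v U (s + \<theta>) - Bint \<theta> z *v U (s + \<theta>)))
      = (1 / e k) *\<^sub>R (?J (?W k) - ?J z)" for k
    by (simp add: integral_diff[OF intB[OF Wb(1)] intB[OF Wb(2)]])
  moreover have "integral {-h..-s} (\<lambda>\<theta>. matrix_of_columns (\<lambda>i. DBint i \<theta> z *v d) *v U (s + \<theta>))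
      = (\<Sum>i\<in>UNIV. integral {-h..-s} (\<lambda>\<theta>. (U (s + \<theta>) $ i) *\<^sub>R DBint i \<theta> z)) *v d"
  proof -
    have lin: "bounded_linear (\<lambda>M :: real^'n^'n. M *v d)"
      by (rule bounded_bilinear.bounded_linear_left[OF bounded_bilinear_matrix_vector_mult])
    have int: "(\<lambda>\<theta>. (U (s + \<theta>) $ i) *\<^sub>R DBint i \<theta> z) integrable_on {-h..-s}" for i
      by (rule DBint_input_integrable[OF U r z]) (use s in auto)
    have "integral {-h..-s} (\<lambda>\<theta>. matrix_of_columns (\<lambda>i. DBint i \<theta> z *v d) *v U (s + \<theta>))
      = integral {-h..-s} (\<lambda>\<theta>. \<Sum>i\<in>UNIV. ((U (s + \<theta>) $ i) *\<^sub>R DBint i \<theta> z) *v d)"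
      by (simp add: matrix_of_columns_mult_vec scaleR_matrix_vector_assoc)
    also have "\<dots> = (\<Sum>i\<in>UNIV. integral {-h..-s} (\<lambda>\<theta>. ((U (s + \<theta>) $ i) *\<^sub>R DBint i \<theta> z) *v d))"
      using integrable_linear[OF int lin] by (intro integral_sum) (auto simp: o_def)
    also have "\<dots> = (\<Sum>i\<in>UNIV. integral {-h..-s} (\<lambda>\<theta>. (U (s + \<theta>) $ i) *\<^sub>R DBint i \<theta> z) *v d)"
      using integral_linear[OF int lin] by (simp add: o_def)
    finally show ?thesis by (simp add: bounded_bilinear.sum_left[OF bounded_bilinear_matrix_vector_mult])
  qed
  ultimately have J: "(\<lambda>k. (1 / e k) *\<^sub>R (?J (?W k) - ?J z))
      \<longlonglongrightarrow> (\<Sum>i\<in>UNIV. integral {-h..-s} (\<lambda>\<theta>. (U (s + \<theta>) $ i) *\<^sub>R DBint i \<theta> z)) *v d"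
    by (simp only:)
  have "(\<lambda>k. (1 / e k) *\<^sub>R (f (?W k) - f z) + (1 / e k) *\<^sub>R (B1 (?W k) *v U (s - h) - B1 z *v U (s - h))
        + (1 / e k) *\<^sub>R (?J (?W k) - ?J z)) \<longlonglongrightarrow> variational s z U *v d"
    unfolding variational_matrix_def matrix_vector_mult_add_rdistrib
    by (intro tendsto_add f b J)
  then show ?thesis
    by (simp add: predictor_rhs_def algebra_simps)
qed

text \<open>The added window has length \<open>e k\<close> and shrinks to the point
  \<open>\<theta> = -s\<close>, where the input is \<open>U 0\<close>. Its mean value tends to the
  source term of the variational equation; as the state \<open>zk\<close> moves too, joint
  continuity of \<open>Bint\<close> is needed. For \<open>s > 0\<close> the window eventually lies
  in \<open>[-h, 0]\<close>.\<close>

lemma small_window_limit: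
  assumes U: "admissible_input U" "isCont U 0" and r: "ereal r \<le> R" and s: "s \<in> {0<..h}"
    and cont: "continuous (at (-s, z) within ({-h..0} \<times> cball 0 r)) (\<lambda>p. Bint (fst p) (snd p))"
    and z: "norm z \<le> r" "zk \<longlonglongrightarrow> z" "\<And>k. norm (zk k) \<le> r"
    and e: "e \<longlonglongrightarrow> 0" "\<And>k. e k > 0"
  shows "(\<lambda>k. (1 / e k) *\<^sub>R integral {-s..e k - s} (\<lambda>\<theta>. Bint \<theta> (zk k) *v U (s + \<theta>))) \<longlonglongrightarrow> Bint (-s) z *v U 0"
proof (rule LIMSEQ_I)
  fix \<epsilon> :: real assume \<epsilon>: "\<epsilon> > 0"
  have "((\<lambda>p. Bint (fst p) (snd p) *v U (s + fst p)) \<longlongrightarrow> Bint (-s) z *v U (s + - s))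
      (at (-s, z) within ({-h..0} \<times> cball 0 r))"
  proof (rule bounded_bilinear.tendsto[OF bounded_bilinear_matrix_vector_mult])
    show "((\<lambda>p. Bint (fst p) (snd p)) \<longlongrightarrow> Bint (-s) z) (at (-s, z) within ({-h..0} \<times> cball 0 r))"
      using cont by (simp add: continuous_within)
    have "((\<lambda>p. s + fst p) \<longlongrightarrow> s + fst (-s, z)) (at (-s, z) within ({-h..0} \<times> cball 0 r))"
      by (intro tendsto_intros)
    then show "((\<lambda>p. U (s + fst p)) \<longlongrightarrow> U (s + - s)) (at (-s, z) within ({-h..0} \<times> cball 0 r))"
      by (intro isCont_tendsto_compose[where g = U]) (use U(2) in auto)
  qed
  then have "continuous (at (-s, z) within ({-h..0} \<times> cball 0 r)) (\<lambda>p. Bint (fst p) (snd p) *v U (s + fst p))"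
    by (simp add: continuous_within)
  moreover have "\<epsilon> / 2 > 0" using \<epsilon> by simp
  ultimately obtain \<delta> where \<delta>: "\<delta> > 0"
    "\<And>p. p \<in> {-h..0} \<times> cball 0 r \<Longrightarrow> dist p (-s, z) < \<delta> \<Longrightarrow>
       dist (Bint (fst p) (snd p) *v U (s + fst p)) (Bint (fst (-s, z)) (snd (-s, z)) *v U (s + fst (-s, z))) < \<epsilon> / 2"
    unfolding continuous_within_eps_delta by blast
  have "\<forall>\<^sub>F k in sequentially. e k < \<delta> / 2" "\<forall>\<^sub>F k in sequentially. e k < s"
    by (rule order_tendstoD(2)[OF e(1)]; use \<delta>(1) s in simp)+
  moreover have "\<forall>\<^sub>F k in sequentially. dist (zk k) z < \<delta> / 2"
    by (rule tendstoD[OF z(2)]) (use \<delta>(1) in simp)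
  ultimately have "\<forall>\<^sub>F k in sequentially. norm ((1 / e k) *\<^sub>R integral {-s..e k - s} (\<lambda>\<theta>. Bint \<theta> (zk k) *v U (s + \<theta>)) - Bint (-s) z *v U 0) < \<epsilon>"
  proof eventually_elim
    case (elim k)
    have ball: "zk k \<in> origin_ball R" using cball_subset_origin_ball[OF r] z(3)[of k] by auto
    have "norm ((1 / e k) *\<^sub>R integral {-s..-s + e k} (\<lambda>\<theta>. Bint \<theta> (zk k) *v U (s + \<theta>)) - Bint (-s) z *v U 0) \<le> \<epsilon> / 2"
    proof (rule average_approx[OF _ e(2)])
      show "(\<lambda>\<theta>. Bint \<theta> (zk k) *v U (s + \<theta>)) integrable_on {-s..-s + e k}"
        by (rule Bint_input_integrable[OF U(1) ball]) (use s elim in auto)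
      fix \<theta> assume \<theta>: "\<theta> \<in> {-s..-s + e k}"
      have "dist (\<theta>, zk k) (-s, z) \<le> dist \<theta> (-s) + dist (zk k) z"
        by (simp add: dist_Pair_Pair sqrt_sum_squares_le_sum)
      also have "\<dots> < \<delta>" using \<theta> elim by (auto simp: dist_real_def)
      finally show "norm (Bint \<theta> (zk k) *v U (s + \<theta>) - Bint (-s) z *v U 0) \<le> \<epsilon> / 2"
        using \<delta>(2)[of "(\<theta>, zk k)"] \<theta> s elim z(3)[of k] by (auto simp: dist_norm intro!: less_imp_le)
    qed
    then show ?case using \<epsilon> by (simp add: add.commute)
  qed
  then show "\<exists>no. \<forall>n\<ge>no. norm ((1 / e n) *\<^sub>R integral {-s..e n - s} (\<lambda>\<theta>. Bint \<theta> (zk n) *v U (s + \<theta>)) - Bint (-s) z *v U 0) < \<epsilon>"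
    by (simp add: eventually_sequentially)
qed

end

subsection \<open>Differentiability of the predicted state\<close>

context predictor_system
begin

text \<open>At the start only the history value \<open>U (-h)\<close> enters pointwise, so
  continuity of the input there makes the right-hand side continuous at time 0.\<close>

lemma trajectory_right_derivative:
  assumes U: "admissible_input U" "isCont U (-h)" and P: "trajectory U 0 P"
    and e: "e \<longlonglongrightarrow> 0" "\<And>k. e k > 0" "\<And>k. e k \<le> h"
  shows "(\<lambda>k. (1 / e k) *\<^sub>R (P (e k) - P 0)) \<longlonglongrightarrow> predictor_rhs U 0 0 (P 0)"
proof -
  let ?g = "\<lambda>r. predictor_rhs U 0 r (P r)"
  have c: "continuous_on {0..h} P" "P ` {0..h} \<subseteq> origin_ball R"
    using trajectory_continuous_on[OF P] trajectory_in_ball[OF P] by auto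
  have "continuous (at 0 within {0..h}) ?g"
    by (rule predictor_rhs_continuous[OF U(1) _ c(2)])
      (use h_pos U(2) c(1) in \<open>auto simp: continuous_on_eq_continuous_within\<close>)
  moreover have "?g integrable_on {0..h}" by (rule trajectory_integrable[OF U(1) P]) simp
  ultimately have "((\<lambda>u. integral {0..u} ?g) has_vector_derivative ?g 0) (at 0 within {0..h})"
    using h_pos by (intro integral_has_vector_derivative_at) auto
  then have "(\<lambda>k. (1 / e k) *\<^sub>R (integral {0..0 + e k *\<^sub>R 1} ?g - integral {0..0} ?g)) \<longlonglongrightarrow> 1 *\<^sub>R ?g 0"
    unfolding has_vector_derivative_def
    by (rule difference_quotient_tendsto) (use e in \<open>auto intro: less_imp_le\<close>)
  moreover have "P (e k) - P 0 = integral {0..e k} ?g" for k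
    using trajectory_increment[OF U(1) P, of 0 "e k"] e(2,3)[of k] by simp
  ultimately show ?thesis by simp
qed

text \<open>The shifted trajectory \<open>Q k\<close> is compared with the linearised guess \<open>W k = P + e k \<beta> U(0)\<close>;
  the defect of \<open>W k\<close>, divided by \<open>e k\<close>, tends to 0 pointwise and boundedly.\<close>

lemma predictor_linearisation:
  assumes U: "admissible_input U" "isCont U 0" "isCont U (-h)" and r: "ereal r \<le> R"
    and P: "trajectory U 0 P" "\<forall>s\<in>{0..h}. norm (P s) \<le> r'" "r' < r"
    and \<beta>: "variational_solution U P M0 \<beta>"
    and e: "e \<longlonglongrightarrow> 0" "\<And>k. e k > 0" "\<And>k. e k \<le> h"
    and Q: "\<And>k. trajectory U (e k) (Q k)" "\<And>k s. s \<in> {e k..e k + h} \<Longrightarrow> norm (Q k s) \<le> r"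
    and W: "\<And>k s. s \<in> {0..h} \<Longrightarrow> norm (P s + e k *\<^sub>R (\<beta> s *v U 0)) \<le> r"
    and x: "(\<lambda>k. (1 / e k) *\<^sub>R (Q k (e k) - P 0)) \<longlonglongrightarrow> predictor_rhs U 0 0 (P 0) + M0 *v U 0"
  shows "(\<lambda>k. (1 / e k) *\<^sub>R (Q k h - P h)) \<longlonglongrightarrow> \<beta> h *v U 0"
proof -
  have cP: "continuous_on {0..h} P" using trajectory_continuous_on[OF P(1)] by simp
  define K where "K = cball (0 :: real^'n) r"
  have K: "K \<subseteq> origin_ball R" "compact K" "convex K"
    using cball_subset_origin_ball[OF r] by (auto simp: K_def)
  obtain C where C: "C \<ge> 0" "\<And>w. norm (U w) \<le> C" using admissible_input_bound[OF U(1)] by blast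
  obtain L where L: "L \<ge> 0" "\<And>U \<tau> a x y. admissible_input U \<Longrightarrow> (\<And>w. norm (U w) \<le> C) \<Longrightarrow> a \<in> {\<tau>..\<tau>+h} \<Longrightarrow>
      x \<in> K \<Longrightarrow> y \<in> K \<Longrightarrow> norm (predictor_rhs U \<tau> a x - predictor_rhs U \<tau> a y) \<le> L * norm (x - y)"
  proof (rule predictor_rhs_lipschitz[OF K C(1)], goal_cases)
    case 1 show ?case by (rule 1(1)) (fact 1)+
  qed
  obtain E where E: "countable E"
    "\<And>\<beta> s. continuous_on {0..h} \<beta> \<Longrightarrow> s \<in> {0..h} - E \<Longrightarrow>
       continuous (at s within {0..h}) (\<lambda>s. variational s (P s) U ** \<beta> s + Bint (-s) (P s))"
    "\<And>s z0. s \<in> {0..h} - E \<Longrightarrow> norm z0 \<le> r \<Longrightarrow>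
       continuous (at (-s, z0) within ({-h..0} \<times> cball 0 r)) (\<lambda>p. Bint (fst p) (snd p))"
    "\<And>s. s \<in> {0..h} - E \<Longrightarrow> isCont U (s - h)"
  proof (rule variational_rhs_regular[OF U(1) r cP P(2,3)], goal_cases)
    case 1 show ?case by (rule 1(1)) (fact 1)+
  qed
  obtain Dv where Dv: "Dv \<ge> 0" "\<And>s z. s \<in> {0..h} \<Longrightarrow> norm z < r \<Longrightarrow> norm (variational s z U) \<le> Dv"
  proof (rule variational_bound[OF U(1) r], goal_cases)
    case 1 show ?case by (rule 1(1)) (fact 1)+
  qed
  have c\<beta>: "continuous_on {0..h} \<beta>" using \<beta> unfolding variational_solution_def by blast
  define c where "c = U 0"
  \<comment> \<open>Candidate for the derivative at time \<open>s\<close> with respect to the shift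
    of the start; \<open>g\<close>, its time derivative, is the right-hand side of the variational
    equation applied to \<open>c\<close>.\<close>
  define b where "b s = \<beta> s *v c" for s
  define g where "g s = (variational s (P s) U ** \<beta> s + Bint (-s) (P s)) *v c" for s
  define Wk where "Wk k s = P s + e k *\<^sub>R b s" for k s
  have lin: "bounded_linear (\<lambda>M :: real^'m^'n. M *v c)"
    by (rule bounded_bilinear.bounded_linear_left[OF bounded_bilinear_matrix_vector_mult])
  have cb: "continuous_on {0..h} b" unfolding b_def by (rule bounded_linear.continuous_on[OF lin c\<beta>])
  have cW: "continuous_on {0..h} (Wk k)" for k unfolding Wk_def by (intro continuous_intros cP cb)
  have "bounded (b ` {0..h})" by (intro compact_imp_bounded compact_continuous_image cb) auto
  then obtain bm where bm: "bm > 0" "\<And>s. s \<in> {0..h} \<Longrightarrow> norm (b s) \<le> bm" unfolding bounded_pos by blast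
  have PK: "P s \<in> K" "norm (P s) < r" if "s \<in> {0..h}" for s
    using bspec[OF P(2) that] P(3) by (simp_all add: K_def)
  have PB: "P s \<in> origin_ball R" if "s \<in> {0..h}" for s using PK[OF that] K by blast
  have WK: "Wk k s \<in> K" if "s \<in> {0..h}" for k s using W[OF that, of k] by (simp add: K_def Wk_def b_def c_def)
  have QK: "Q k s \<in> K" if "s \<in> {e k..h}" for k s using Q(2)[of s k] that e(2)[of k] by (auto simp: K_def)
  have intF: "(\<lambda>s. variational s (P s) U ** \<beta> s + Bint (- s) (P s)) integrable_on {0..h}"
    by (rule variational_rhs_integrable[OF U(1) r cP P(2,3) c\<beta>])
  have intg: "g integrable_on {0..h}"
    using integrable_linear[OF intF lin] by (simp add: g_def[abs_def] o_def)
  have beq: "b s = M0 *v c + integral {0..s} g" if s: "s \<in> {0..h}" for s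
  proof -
    have "(\<lambda>s. variational s (P s) U ** \<beta> s + Bint (- s) (P s)) integrable_on {0..s}"
      by (rule integrable_on_subinterval[OF intF]) (use s in auto)
    from integral_linear[OF this lin]
    have "integral {0..s} g = integral {0..s} (\<lambda>s. variational s (P s) U ** \<beta> s + Bint (- s) (P s)) *v c"
      by (simp add: g_def[abs_def] o_def)
    moreover have "\<beta> s = M0 + integral {0..s} (\<lambda>s. variational s (P s) U ** \<beta> s + Bint (-s) (P s))"
      using \<beta> s unfolding variational_solution_def by blast
    then have "b s = (M0 + integral {0..s} (\<lambda>s. variational s (P s) U ** \<beta> s + Bint (-s) (P s))) *v c"
      unfolding b_def by (rule arg_cong)
    ultimately show ?thesis by (simp add: matrix_vector_mult_add_rdistrib)
  qed
  have b0: "b 0 = M0 *v c" using beq[of 0] h_pos by simp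
  have binc: "b s - b a = integral {a..s} g" if "0 \<le> a" "a \<le> s" "s \<le> h" for a s
  proof -
    have "integral {0..a} g + integral {a..s} g = integral {0..s} g"
      by (intro Henstock_Kurzweil_Integration.integral_combine integrable_on_subinterval[OF intg]) (use that in auto)
    then show ?thesis using beq[of a] beq[of s] that by (simp add: algebra_simps)
  qed
  have gcont: "continuous (at s within {0..h}) g" if "s \<in> {0..h} - E" for s
    unfolding g_def by (rule bounded_linear.continuous[OF lin E(2)[OF c\<beta> that]])
  have geq: "g s = variational s (P s) U *v b s + Bint (-s) (P s) *v c" for s
    by (simp add: g_def b_def matrix_vector_mult_add_rdistrib matrix_vector_mul_assoc)
  have gle: "norm (g s) \<le> Dv * bm + Bint_sup * C" if s: "s \<in> {0..h}" for s
  proof -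
    have "norm (variational s (P s) U *v b s) \<le> Dv * bm"
      using Dv PK(2)[OF s] bm s by (intro order_trans[OF norm_matrix_vector_mult_le] mult_mono) auto
    moreover have "norm (Bint (-s) (P s) *v c) \<le> Bint_sup * C"
      unfolding c_def by (rule order_trans[OF Bint_mult_le[OF _ PB[OF s]] mult_left_mono[OF C(2) Bint_sup_nonneg]]) (use s in auto)
    ultimately show ?thesis unfolding geq by (intro order_trans[OF norm_triangle_ineq] add_mono)
  qed
  \<comment> \<open>The derivative of \<open>Wk k\<close> is that of \<open>P\<close> plus
    \<open>e k\<close> times \<open>g\<close>, so \<open>e k\<close> times \<open>dl k s\<close> is
    the excess of the shifted right-hand side along \<open>Wk k\<close> over it.\<close>
  define dl where "dl k s = (1 / e k) *\<^sub>R (predictor_rhs U (e k) s (Wk k s) - predictor_rhs U 0 s (P s)) - g s" for k s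
  \<comment> \<open>Change of the state at a fixed start plus change of the start at a fixed state:
    the first gives the homogeneous term of \<open>g\<close>, the second its source term.\<close>
  have dl_lim: "(\<lambda>k. dl k s) \<longlonglongrightarrow> 0" if s: "s \<in> {0<..h}" "s \<notin> E" for s
  proof -
    have s': "s \<in> {0..h}" using s by auto
    have "(\<lambda>k. P s + e k *\<^sub>R b s) \<longlonglongrightarrow> P s + 0 *\<^sub>R b s" by (intro tendsto_intros e)
    then have Wlim: "(\<lambda>k. Wk k s) \<longlonglongrightarrow> P s" by (simp add: Wk_def)
    have 1: "(\<lambda>k. (1 / e k) *\<^sub>R (predictor_rhs U 0 s (Wk k s) - predictor_rhs U 0 s (P s))) \<longlonglongrightarrow> variational s (P s) U *v b s"
      unfolding Wk_def by (rule predictor_rhs_gateaux[OF U(1) r s' PK(2)[OF s'] e(1,2)])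
        (use W[OF s'] in \<open>simp add: b_def c_def\<close>)
    have 2: "(\<lambda>k. (1 / e k) *\<^sub>R integral {-s..e k - s} (\<lambda>\<theta>. Bint \<theta> (Wk k s) *v U (s + \<theta>))) \<longlonglongrightarrow> Bint (-s) (P s) *v U 0"
      by (rule small_window_limit[OF U(1,2) r s(1) E(3) _ Wlim _ e(1,2)])
        (use s' s PK(2)[OF s'] WK[OF s'] in \<open>auto simp: K_def\<close>)
    have "(\<lambda>k. ((1 / e k) *\<^sub>R (predictor_rhs U 0 s (Wk k s) - predictor_rhs U 0 s (P s))
        + (1 / e k) *\<^sub>R integral {-s..e k - s} (\<lambda>\<theta>. Bint \<theta> (Wk k s) *v U (s + \<theta>))) - g s) \<longlonglongrightarrow> g s - g s"
      using tendsto_add[OF 1 2] unfolding geq c_def by (intro tendsto_diff tendsto_const)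
    moreover have "\<forall>\<^sub>F k in sequentially. ((1 / e k) *\<^sub>R (predictor_rhs U 0 s (Wk k s) - predictor_rhs U 0 s (P s))
        + (1 / e k) *\<^sub>R integral {-s..e k - s} (\<lambda>\<theta>. Bint \<theta> (Wk k s) *v U (s + \<theta>))) - g s = dl k s"
    proof -
      have "\<forall>\<^sub>F k in sequentially. e k < s" by (rule order_tendstoD(2)[OF e(1)]) (use s in simp)
      then show ?thesis
      proof eventually_elim
        case (elim k)
        have "predictor_rhs U (e k) s (Wk k s) - predictor_rhs U 0 s (Wk k s) = integral {0-s..e k - s} (\<lambda>\<theta>. Bint \<theta> (Wk k s) *v U (s + \<theta>))"
          by (rule predictor_rhs_later_start[OF U(1)]) (use WK[OF s', of k] K elim e(2)[of k] s in auto)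
        then have "integral {-s..e k - s} (\<lambda>\<theta>. Bint \<theta> (Wk k s) *v U (s + \<theta>)) = predictor_rhs U (e k) s (Wk k s) - predictor_rhs U 0 s (Wk k s)"
          by simp
        then show ?case by (simp add: dl_def scaleR_add_right[symmetric])
      qed
    qed
    ultimately show ?thesis by (auto intro: Lim_transform_eventually)
  qed
  define G where "G = Dv * bm + Bint_sup * C"
  have dl_bound: "norm (dl k s) \<le> L * bm + Bint_sup * C + G" if s: "s \<in> {e k..h}" for k s
  proof -
    have s': "s \<in> {0..h}" "s \<in> {e k..e k + h}" using s e(2)[of k] by auto
    have "norm (predictor_rhs U (e k) s (Wk k s) - predictor_rhs U (e k) s (P s)) \<le> L * norm (Wk k s - P s)"
      by (intro L(2) U(1) C s' WK PK)
    also have "\<dots> \<le> L * (e k * bm)"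
      using bm(2)[OF s'(1)] e(2)[of k] L(1) by (intro mult_left_mono) (auto simp: Wk_def)
    finally have 1: "norm (predictor_rhs U (e k) s (Wk k s) - predictor_rhs U (e k) s (P s)) \<le> L * (e k * bm)" .
    have 2: "norm (predictor_rhs U (e k) s (P s) - predictor_rhs U 0 s (P s)) \<le> (e k - 0) * (Bint_sup * C)"
      by (intro predictor_rhs_later_start_le U(1) C PB) (use s e(2)[of k] in auto)
    have "norm (predictor_rhs U (e k) s (Wk k s) - predictor_rhs U 0 s (P s)) \<le> e k * (L * bm + Bint_sup * C)"
      using norm_triangle_ineq[of "predictor_rhs U (e k) s (Wk k s) - predictor_rhs U (e k) s (P s)"
          "predictor_rhs U (e k) s (P s) - predictor_rhs U 0 s (P s)"] 1 2
      by (simp add: algebra_simps)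
    then have "(1 / e k) * norm (predictor_rhs U (e k) s (Wk k s) - predictor_rhs U 0 s (P s)) \<le> (1 / e k) * (e k * (L * bm + Bint_sup * C))"
      using e(2)[of k] by (intro mult_left_mono) auto
    also have "\<dots> = L * bm + Bint_sup * C" using e(2)[of k] by simp
    also have "(1 / e k) * norm (predictor_rhs U (e k) s (Wk k s) - predictor_rhs U 0 s (P s))
        = norm ((1 / e k) *\<^sub>R (predictor_rhs U (e k) s (Wk k s) - predictor_rhs U 0 s (P s)))"
      using e(2)[of k] by simp
    finally have "norm ((1 / e k) *\<^sub>R (predictor_rhs U (e k) s (Wk k s) - predictor_rhs U 0 s (P s))) \<le> L * bm + Bint_sup * C" .
    then show ?thesis
      unfolding dl_def G_def by (rule order_trans[OF norm_triangle_ineq4 add_mono[OF _ gle[OF s'(1)]]])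
  qed
  have dl_int: "(\<lambda>s. norm (dl k s)) integrable_on {e k..h}" for k
  proof (rule integrable_countable_discontinuities[OF E(1), where C = "L * bm + Bint_sup * C + G"])
    fix s assume s: "s \<in> {e k..h} - E"
    then have s': "s \<in> {0..h} - E" using e(2)[of k] by auto
    have sub: "{e k..h} \<subseteq> {0..h}" "{e k..h} \<subseteq> {0..0 + h}" "{e k..h} \<subseteq> {e k..e k + h}" using e(2)[of k] by auto
    have "continuous (at s within {e k..h}) (\<lambda>s. predictor_rhs U (e k) s (Wk k s))"
    proof (rule predictor_rhs_continuous[OF U(1) sub(3)])
      show "Wk k ` {e k..h} \<subseteq> origin_ball R" using WK K sub by blast
      show "continuous (at s within {e k..h}) (Wk k)"
        using continuous_on_subset[OF cW sub(1)] s by (simp add: continuous_on_eq_continuous_within)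
    qed (use s E(4)[OF s'] in auto)
    moreover have "continuous (at s within {e k..h}) (\<lambda>s. predictor_rhs U 0 s (P s))"
    proof (rule predictor_rhs_continuous[OF U(1) sub(2)])
      show "P ` {e k..h} \<subseteq> origin_ball R" using PB sub by blast
      show "continuous (at s within {e k..h}) P"
        using continuous_on_subset[OF cP sub(1)] s by (simp add: continuous_on_eq_continuous_within)
    qed (use s E(4)[OF s'] in auto)
    moreover have "continuous (at s within {e k..h}) g"
      by (rule continuous_within_subset[OF gcont[OF s'] sub(1)])
    ultimately show "continuous (at s within {e k..h}) (\<lambda>s. norm (dl k s))"
      unfolding dl_def by (intro continuous_intros)
  qed (use dl_bound in auto)
  have neg: "negligible E"
    unfolding negligible_iff_null_sets
    by (intro null_sets_completionI countable_imp_null_set_lborel E(1))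
  \<comment> \<open>The lower limit \<open>e k\<close> moves, so the defect is cut off below it; it
    is also set to 0 on \<open>E\<close>, where its limit is not known.\<close>
  have dl_to0: "(\<lambda>k. integral {e k..h} (\<lambda>s. norm (dl k s))) \<longlonglongrightarrow> 0"
  proof -
    let ?d = "\<lambda>k s. if s \<in> E then 0 else norm (dl k s)"
    let ?f = "\<lambda>k s. if e k \<le> s then ?d k s else 0"
    have int: "?d k integrable_on {e k..h}" for k
      by (rule integrable_spike[OF dl_int neg]) auto
    have eq: "integral {e k..h} (?d k) = integral {e k..h} (\<lambda>s. norm (dl k s))" for k
      by (rule integral_spike[OF neg]) auto
    have "(\<lambda>k. integral {0..h} (?f k)) \<longlonglongrightarrow> integral {0..h} (\<lambda>_. 0)"
    proof (rule dominated_convergence(2)[where h = "\<lambda>_. L * bm + Bint_sup * C + G"])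
      show "?f k integrable_on {0..h}" for k
        by (rule lower_indicator_Icc(1)[OF less_imp_le[OF e(2)] int])
      have nn: "0 \<le> L * bm + Bint_sup * C + G"
        using order_trans[OF norm_ge_zero dl_bound[of h 0]] e(3)[of 0] by simp
      show "norm (?f k s) \<le> L * bm + Bint_sup * C + G" if "s \<in> {0..h}" for k s
        using dl_bound[of s k] that nn by auto
      show "(\<lambda>k. ?f k s) \<longlonglongrightarrow> 0" if s: "s \<in> {0..h}" for s
      proof (cases "s = 0 \<or> s \<in> E")
        case True
        then have "?f k s = 0" for k using e(2)[of k] by auto
        then show ?thesis by simp
      next
        case False
        then have "(\<lambda>k. norm (dl k s)) \<longlonglongrightarrow> 0" using dl_lim[of s] s tendsto_norm_zero by auto
        then show ?thesis
          by (rule tendsto_sandwich[OF _ _ tendsto_const, rotated 2]) (auto intro!: always_eventually)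
      qed
    qed auto
    then show ?thesis
      by (simp only: lower_indicator_Icc(2)[OF less_imp_le[OF e(2)] int] eq integral_0)
  qed
  \<comment> \<open>Gronwall for \<open>Q k - Wk k\<close>, with the scaled defect as
    inhomogeneity.\<close>
  have est: "norm (Q k h - Wk k h) \<le> (norm (Q k (e k) - Wk k (e k)) + e k * integral {e k..h} (\<lambda>s. norm (dl k s))) * exp (L * h)" for k
  proof -
    have ek: "0 < e k" "e k \<le> h" by (rule e)+
    have cQ: "continuous_on {e k..h} (Q k)"
      by (rule continuous_on_subset[OF trajectory_continuous_on[OF Q(1)]]) (use ek in auto)
    have cWk: "continuous_on {e k..h} (Wk k)"
      by (rule continuous_on_subset[OF cW]) (use ek in auto)
    have "norm (Q k h - Wk k h) \<le> (norm (Q k (e k) - Wk k (e k)) + integral {e k..h} (\<lambda>s. e k * norm (dl k s))) * exp (L * (h - e k))"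
    proof (rule gronwall_forward[OF ek(2) _ L(1)])
      show "continuous_on {e k..h} (\<lambda>s. norm (Q k s - Wk k s))" by (intro continuous_intros cQ cWk)
      show "(\<lambda>s. e k * norm (dl k s)) integrable_on {e k..h}" by (intro integrable_on_mult_right dl_int)
      fix t assume t: "t \<in> {e k..h}"
      have iQ: "(\<lambda>s. predictor_rhs U (e k) s (Q k s)) integrable_on {e k..t}"
        by (rule trajectory_integrable[OF U(1) Q(1)]) (use t ek in auto)
      have iP: "(\<lambda>s. predictor_rhs U 0 s (P s)) integrable_on {e k..t}"
        by (rule trajectory_integrable[OF U(1) P(1)]) (use t ek in auto)
      have ig: "(\<lambda>s. e k *\<^sub>R g s) integrable_on {e k..t}"
        by (intro integrable_cmul integrable_on_subinterval[OF intg]) (use t ek in auto)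
      let ?D = "\<lambda>s. predictor_rhs U (e k) s (Q k s) - predictor_rhs U 0 s (P s) - e k *\<^sub>R g s"
      have "integral {e k..t} ?D = (Q k t - Q k (e k)) - (P t - P (e k)) - e k *\<^sub>R (b t - b (e k))"
      proof -
        have "integral {e k..t} ?D = integral {e k..t} (\<lambda>s. predictor_rhs U (e k) s (Q k s))
            - integral {e k..t} (\<lambda>s. predictor_rhs U 0 s (P s)) - integral {e k..t} (\<lambda>s. e k *\<^sub>R g s)"
          by (subst integral_diff[OF integrable_diff[OF iQ iP] ig], subst integral_diff[OF iQ iP]) simp
        then show ?thesis
          using t ek by (simp add: binc trajectory_increment[OF U(1) Q(1)] trajectory_increment[OF U(1) P(1)])
      qed
      then have "Q k t - Wk k t = (Q k (e k) - Wk k (e k)) + integral {e k..t} ?D"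
        by (simp add: Wk_def scaleR_diff_right)
      moreover have "norm (integral {e k..t} ?D) \<le> integral {e k..t} (\<lambda>s. L * norm (Q k s - Wk k s) + e k * norm (dl k s))"
      proof (rule integral_norm_bound_integral)
        show "?D integrable_on {e k..t}" by (intro integrable_diff iQ iP ig)
        have "(\<lambda>s. norm (Q k s - Wk k s)) integrable_on {e k..t}"
          by (intro integrable_continuous_real continuous_intros continuous_on_subset[OF cQ] continuous_on_subset[OF cWk])
            (use t in auto)
        moreover have "(\<lambda>s. norm (dl k s)) integrable_on {e k..t}"
          by (rule integrable_on_subinterval[OF dl_int]) (use t in auto)
        ultimately show "(\<lambda>s. L * norm (Q k s - Wk k s) + e k * norm (dl k s)) integrable_on {e k..t}"
          by (intro integrable_add integrable_on_mult_right)
        fix s assume "s \<in> {e k..t}"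
        then have s: "s \<in> {e k..h}" "s \<in> {0..h}" "s \<in> {e k..e k + h}" using t ek by auto
        have "?D s = (predictor_rhs U (e k) s (Q k s) - predictor_rhs U (e k) s (Wk k s)) + e k *\<^sub>R dl k s"
          using ek by (simp add: dl_def scaleR_diff_right)
        also have "norm \<dots> \<le> L * norm (Q k s - Wk k s) + e k * norm (dl k s)"
          using ek by (intro order_trans[OF norm_triangle_ineq] add_mono L(2) U(1) C s QK WK) auto
        finally show "norm (?D s) \<le> L * norm (Q k s - Wk k s) + e k * norm (dl k s)" .
      qed
      ultimately show "norm (Q k t - Wk k t) \<le> norm (Q k (e k) - Wk k (e k)) + integral {e k..t} (\<lambda>s. L * norm (Q k s - Wk k s) + e k * norm (dl k s))"
        using norm_triangle_ineq[of "Q k (e k) - Wk k (e k)" "integral {e k..t} ?D"] by simp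
    qed (use ek in auto)
    also have "\<dots> \<le> (norm (Q k (e k) - Wk k (e k)) + integral {e k..h} (\<lambda>s. e k * norm (dl k s))) * exp (L * h)"
      using ek L(1) by (intro mult_left_mono add_nonneg_nonneg integral_nonneg integrable_on_mult_right dl_int)
        (auto intro: mult_left_mono)
    finally show ?thesis by simp
  qed
  \<comment> \<open>To first order in \<open>e k\<close>, the shifted trajectory starts above
    \<open>P 0\<close> by the plain right-hand side plus \<open>M0 U(0)\<close>; the old trajectory
    has gained the plain right-hand side, and \<open>Wk\<close> adds \<open>b (e k)\<close>, which
    tends to \<open>M0 U(0)\<close>. Everything cancels.\<close>
  have start: "(\<lambda>k. (1 / e k) *\<^sub>R (Q k (e k) - Wk k (e k))) \<longlonglongrightarrow> 0"
  proof -
    have "(\<lambda>k. b (e k)) \<longlonglongrightarrow> b 0"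
      by (rule continuous_on_tendsto_compose[OF cb e(1)]) (use e h_pos in \<open>auto intro!: always_eventually less_imp_le\<close>)
    then have "(\<lambda>k. (1 / e k) *\<^sub>R (Q k (e k) - P 0) - (1 / e k) *\<^sub>R (P (e k) - P 0) - b (e k))
        \<longlonglongrightarrow> (predictor_rhs U 0 0 (P 0) + M0 *v U 0) - predictor_rhs U 0 0 (P 0) - b 0"
      by (intro tendsto_diff x trajectory_right_derivative[OF U(1,3) P(1) e])
    moreover have "(1 / e k) *\<^sub>R (Q k (e k) - P 0) - (1 / e k) *\<^sub>R (P (e k) - P 0) - b (e k) = (1 / e k) *\<^sub>R (Q k (e k) - Wk k (e k))" for k
      using e(2)[of k] by (simp add: Wk_def scaleR_diff_right scaleR_add_right)
    ultimately show ?thesis by (simp add: b0 c_def)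
  qed
  have "(\<lambda>k. (norm ((1 / e k) *\<^sub>R (Q k (e k) - Wk k (e k))) + integral {e k..h} (\<lambda>s. norm (dl k s))) * exp (L * h)) \<longlonglongrightarrow> (0 + 0) * exp (L * h)"
    by (intro tendsto_intros tendsto_norm_zero start dl_to0)
  then have zero: "(\<lambda>k. (norm ((1 / e k) *\<^sub>R (Q k (e k) - Wk k (e k))) + integral {e k..h} (\<lambda>s. norm (dl k s))) * exp (L * h)) \<longlonglongrightarrow> 0"
    by simp
  have "(\<lambda>k. (1 / e k) *\<^sub>R (Q k h - Wk k h)) \<longlonglongrightarrow> 0"
  proof (rule tendsto_0_le[OF zero, of _ 1])
    show "\<forall>\<^sub>F k in sequentially. norm ((1 / e k) *\<^sub>R (Q k h - Wk k h)) \<le>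
        norm ((norm ((1 / e k) *\<^sub>R (Q k (e k) - Wk k (e k))) + integral {e k..h} (\<lambda>s. norm (dl k s))) * exp (L * h)) * 1"
    proof (rule always_eventually, rule allI)
      fix k
      have ek: "0 < e k" by (rule e)
      have nrm: "norm ((1 / e k) *\<^sub>R v) = (1 / e k) * norm v" for v :: "real^'n" using ek by simp
      have "(1 / e k) * norm (Q k h - Wk k h) \<le> (1 / e k) * ((norm (Q k (e k) - Wk k (e k)) + e k * integral {e k..h} (\<lambda>s. norm (dl k s))) * exp (L * h))"
        using est[of k] ek by (intro mult_left_mono) auto
      also have "\<dots> = (norm ((1 / e k) *\<^sub>R (Q k (e k) - Wk k (e k))) + integral {e k..h} (\<lambda>s. norm (dl k s))) * exp (L * h)"
        unfolding nrm using ek by (simp add: field_simps)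
      finally have "norm ((1 / e k) *\<^sub>R (Q k h - Wk k h)) \<le> (norm ((1 / e k) *\<^sub>R (Q k (e k) - Wk k (e k))) + integral {e k..h} (\<lambda>s. norm (dl k s))) * exp (L * h)"
        by (simp only: nrm)
      then show "norm ((1 / e k) *\<^sub>R (Q k h - Wk k h)) \<le>
        norm ((norm ((1 / e k) *\<^sub>R (Q k (e k) - Wk k (e k))) + integral {e k..h} (\<lambda>s. norm (dl k s))) * exp (L * h)) * 1"
        by (simp only: real_norm_def mult_1_right)
    qed
  qed
  then have "(\<lambda>k. (1 / e k) *\<^sub>R (Q k h - Wk k h) + b h) \<longlonglongrightarrow> 0 + b h" by (intro tendsto_add tendsto_const)
  moreover have "(1 / e k) *\<^sub>R (Q k h - Wk k h) + b h = (1 / e k) *\<^sub>R (Q k h - P h)" for k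
    using e(2)[of k] by (simp add: Wk_def scaleR_diff_right scaleR_add_right)
  ultimately show ?thesis by (simp add: b_def c_def)
qed

text \<open>The increment splits at time \<open>h\<close>. Up to \<open>h\<close> the linearisation
  yields \<open>\<beta> h U(0)\<close>. On the last stretch \<open>[h, h + e k]\<close> the delayed
  input \<open>U (s - h)\<close> is close to \<open>U(0)\<close> and the window of the distributed
  delay is no longer than \<open>e k\<close>, so the mean of the right-hand side tends to
  \<open>f + B1 U(0)\<close> at \<open>P h\<close>.\<close>

lemma predictor_right_derivative:
  assumes U: "admissible_input U" "isCont U 0" "isCont U (-h)" and r: "ereal r \<le> R"
    and P: "trajectory U 0 P" "\<forall>s\<in>{0..h}. norm (P s) \<le> r'" "r' < r"
    and \<beta>: "variational_solution U P M0 \<beta>"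
    and e: "e \<longlonglongrightarrow> 0" "\<And>k. e k > 0" "\<And>k. e k \<le> h"
    and Q: "\<And>k. trajectory U (e k) (Q k)" "\<And>k s. s \<in> {e k..e k + h} \<Longrightarrow> norm (Q k s) \<le> r"
    and x: "(\<lambda>k. (1 / e k) *\<^sub>R (Q k (e k) - P 0)) \<longlonglongrightarrow> predictor_rhs U 0 0 (P 0) + M0 *v U 0"
  shows "(\<lambda>k. (1 / e k) *\<^sub>R (Q k (e k + h) - P h)) \<longlonglongrightarrow> f (P h) + (B1 (P h) + \<beta> h) *v U 0"
proof -
  have c\<beta>: "continuous_on {0..h} \<beta>" using \<beta> unfolding variational_solution_def by blast
  have "continuous_on {0..h} (\<lambda>s. \<beta> s *v U 0)"
    by (rule bounded_linear.continuous_on[OF bounded_bilinear.bounded_linear_left[OF bounded_bilinear_matrix_vector_mult] c\<beta>])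
  then have "bounded ((\<lambda>s. \<beta> s *v U 0) ` {0..h})" by (intro compact_imp_bounded compact_continuous_image) auto
  then obtain bm where bm: "bm > 0" "\<And>s. s \<in> {0..h} \<Longrightarrow> norm (\<beta> s *v U 0) \<le> bm" unfolding bounded_pos by auto
  \<comment> \<open>\<open>predictor_linearisation\<close> wants the linearised guess in the ball of
    radius \<open>r\<close> for every index; this holds once \<open>e k * bm\<close> is below the
    gap \<open>r - r'\<close>, so the first \<open>N\<close> terms are dropped.\<close>
  have "\<forall>\<^sub>F k in sequentially. e k < (r - r') / bm"
    by (rule order_tendstoD(2)[OF e(1)]) (use bm P(3) in simp)
  then obtain N where N: "\<And>k. k \<ge> N \<Longrightarrow> e k < (r - r') / bm" unfolding eventually_sequentially by blast
  have lin: "(\<lambda>k. (1 / e (k + N)) *\<^sub>R (Q (k + N) h - P h)) \<longlonglongrightarrow> \<beta> h *v U 0"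
  proof (rule predictor_linearisation[OF U r P \<beta>, where e = "\<lambda>k. e (k + N)" and Q = "\<lambda>k. Q (k + N)"])
    show "(\<lambda>k. e (k + N)) \<longlonglongrightarrow> 0" by (rule LIMSEQ_ignore_initial_segment[OF e(1)])
    show "(\<lambda>k. (1 / e (k + N)) *\<^sub>R (Q (k + N) (e (k + N)) - P 0)) \<longlonglongrightarrow> predictor_rhs U 0 0 (P 0) + M0 *v U 0"
      by (rule LIMSEQ_ignore_initial_segment[OF x])
    fix k s assume s: "s \<in> {0..h}"
    have "norm (P s + e (k + N) *\<^sub>R (\<beta> s *v U 0)) \<le> r' + e (k + N) * bm"
      using P(2) bm(2)[OF s] s e(2)[of "k + N"] by (intro order_trans[OF norm_triangle_ineq] add_mono) auto
    also have "e (k + N) * bm \<le> r - r'" using N[of "k + N"] bm(1) by (simp add: field_simps)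
    finally show "norm (P s + e (k + N) *\<^sub>R (\<beta> s *v U 0)) \<le> r" by simp
  qed (use e Q in auto)
  then have lin: "(\<lambda>k. (1 / e k) *\<^sub>R (Q k h - P h)) \<longlonglongrightarrow> \<beta> h *v U 0"
    by (rule LIMSEQ_offset)
  have "(\<lambda>k. e k *\<^sub>R ((1 / e k) *\<^sub>R (Q k h - P h))) \<longlonglongrightarrow> 0 *\<^sub>R (\<beta> h *v U 0)"
    by (intro tendsto_scaleR e lin)
  moreover have "e k *\<^sub>R ((1 / e k) *\<^sub>R (Q k h - P h)) = Q k h - P h" for k using e(2)[of k] by simp
  ultimately have q0: "(\<lambda>k. Q k h - P h) \<longlonglongrightarrow> 0" by simp
  define K where "K = cball (0 :: real^'n) r"
  have K: "K \<subseteq> origin_ball R" using cball_subset_origin_ball[OF r] by (auto simp: K_def)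
  obtain C where C: "C \<ge> 0" "\<And>w. norm (U w) \<le> C" using admissible_input_bound[OF U(1)] by blast
  have "0 \<le> norm (P 0)" "norm (P 0) \<le> r'" using P(2) h_pos by auto
  then have r0: "r \<ge> 0" using P(3) by linarith
  obtain D where D: "D \<ge> 0" "\<And>U \<tau> a z. admissible_input U \<Longrightarrow> (\<And>w. norm (U w) \<le> C) \<Longrightarrow> a \<in> {\<tau>..\<tau>+h} \<Longrightarrow>
      z \<in> origin_ball R \<Longrightarrow> norm z \<le> r \<Longrightarrow> norm (predictor_rhs U \<tau> a z) \<le> D"
  proof (rule predictor_rhs_bound[OF r0 C(1)], goal_cases)
    case 1 show ?case by (rule 1(1)) (fact 1)+
  qed
  have QK: "Q k s \<in> K" "Q k s \<in> origin_ball R" if "s \<in> {e k..e k + h}" for k s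
    using Q(2)[OF that] K by (auto simp: K_def)
  let ?l = "f (P h) + B1 (P h) *v U 0"
  have tail: "(\<lambda>k. (1 / e k) *\<^sub>R (Q k (e k + h) - Q k h)) \<longlonglongrightarrow> ?l"
  proof (rule LIMSEQ_I)
    fix \<epsilon> :: real assume \<epsilon>: "\<epsilon> > 0"
    have PK: "P h \<in> K" using bspec[OF P(2), of h] P(3) h_pos by (simp add: K_def)
    have fst_cont: "continuous (at (P h, U 0) within (K \<times> UNIV)) (\<lambda>p. G (fst p))" if "continuous_on (origin_ball R) G"
      for G :: "real^'n \<Rightarrow> 'b::topological_space"
    proof -
      have "continuous_on (K \<times> (UNIV :: (real^'m) set)) (\<lambda>p. G (fst p))"
        by (rule continuous_on_compose2[OF that continuous_on_fst[OF continuous_on_id]]) (use K in auto)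
      then show ?thesis using PK by (simp add: continuous_on_eq_continuous_within)
    qed
    have "continuous (at (P h, U 0) within (K \<times> UNIV)) (\<lambda>p. f (fst p) + B1 (fst p) *v snd p)"
      by (intro continuous_add fst_cont f_cont B1_cont bounded_bilinear.continuous[OF bounded_bilinear_matrix_vector_mult]
          continuous_snd continuous_ident)
    moreover have "\<epsilon> / 4 > 0" using \<epsilon> by simp
    ultimately obtain \<delta> where \<delta>: "\<delta> > 0" "\<And>p. p \<in> K \<times> UNIV \<Longrightarrow> dist p (P h, U 0) < \<delta> \<Longrightarrow>
        dist (f (fst p) + B1 (fst p) *v snd p) (f (fst (P h, U 0)) + B1 (fst (P h, U 0)) *v snd (P h, U 0)) < \<epsilon> / 4"
      unfolding continuous_within_eps_delta by blast
    obtain \<delta>' where \<delta>': "\<delta>' > 0" "\<And>w. dist w 0 < \<delta>' \<Longrightarrow> dist (U w) (U 0) < \<delta> / 2"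
      using U(2) \<delta>(1) unfolding continuous_at_eps_delta by (meson half_gt_zero)
    have "(\<lambda>k. D * e k + norm (Q k h - P h)) \<longlonglongrightarrow> D * 0 + 0"
      by (intro tendsto_intros e tendsto_norm_zero q0)
    then have "\<forall>\<^sub>F k in sequentially. D * e k + norm (Q k h - P h) < \<delta> / 2"
      by (rule order_tendstoD(2)) (use \<delta> in simp)
    moreover have "(\<lambda>k. e k * (Bint_sup * C)) \<longlonglongrightarrow> 0 * (Bint_sup * C)" by (intro tendsto_intros e)
    then have "\<forall>\<^sub>F k in sequentially. e k * (Bint_sup * C) < \<epsilon> / 4"
      by (rule order_tendstoD(2)) (use \<epsilon> in simp)
    moreover have "\<forall>\<^sub>F k in sequentially. e k < \<delta>'" by (rule order_tendstoD(2)[OF e(1) \<delta>'(1)])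
    ultimately have "\<forall>\<^sub>F k in sequentially. norm ((1 / e k) *\<^sub>R (Q k (e k + h) - Q k h) - ?l) < \<epsilon>"
    proof eventually_elim
      case (elim k)
      have ek: "0 < e k" "e k \<le> h" by (rule e)+
      have int: "(\<lambda>s. predictor_rhs U (e k) s (Q k s)) integrable_on {a..b}" if "{a..b} \<subseteq> {e k..e k + h}" for a b
        by (rule trajectory_integrable[OF U(1) Q(1) that])
      have "norm ((1 / e k) *\<^sub>R integral {h..h + e k} (\<lambda>s. predictor_rhs U (e k) s (Q k s)) - ?l) \<le> \<epsilon> / 2"
      proof (rule average_approx[OF int ek(1)])
        fix s assume s: "s \<in> {h..h + e k}"
        then have s': "s \<in> {e k..e k + h}" using ek by auto
        have "norm (Q k s - Q k h) \<le> integral {h..s} (\<lambda>_. D)"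
          unfolding trajectory_increment[OF U(1) Q(1), of k h s, OF ek(2) s[THEN atLeastAtMost_iff[THEN iffD1], THEN conjunct1] s'[THEN atLeastAtMost_iff[THEN iffD1], THEN conjunct2]]
        proof (rule integral_norm_bound_integral)
          fix t assume "t \<in> {h..s}"
          then have t: "t \<in> {e k..e k + h}" using s' ek by auto
          show "norm (predictor_rhs U (e k) t (Q k t)) \<le> D"
            by (intro D(2) U(1) C t QK Q(2))
        qed (use s s' ek in \<open>auto intro!: int\<close>)
        also have "\<dots> \<le> D * e k" using s D(1) by (simp add: mult.commute mult_left_mono)
        finally have "norm (Q k s - P h) \<le> D * e k + norm (Q k h - P h)"
          using norm_triangle_ineq[of "Q k s - Q k h" "Q k h - P h"] by simp
        then have d1: "dist (Q k s) (P h) < \<delta> / 2" using elim by (simp add: dist_norm)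
        have d2: "dist (U (s - h)) (U 0) < \<delta> / 2"
          by (rule \<delta>'(2)) (use s elim in \<open>auto simp: dist_real_def\<close>)
        have "dist (Q k s, U (s - h)) (P h, U 0) \<le> dist (Q k s) (P h) + dist (U (s - h)) (U 0)"
          by (simp add: dist_Pair_Pair sqrt_sum_squares_le_sum)
        then have "dist (Q k s, U (s - h)) (P h, U 0) < \<delta>" using d1 d2 by linarith
        then have 1: "norm (f (Q k s) + B1 (Q k s) *v U (s - h) - ?l) < \<epsilon> / 4"
          using \<delta>(2)[of "(Q k s, U (s - h))"] QK[OF s'] by (simp add: dist_norm)
        \<comment> \<open>For a start at \<open>s - h\<close>, the window at time \<open>s\<close>
          has length 0 and the right-hand side is just \<open>f + B1 U(s - h)\<close>.\<close>
        have "norm (predictor_rhs U (e k) s (Q k s) - predictor_rhs U (s - h) s (Q k s)) \<le> (e k - (s - h)) * (Bint_sup * C)"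
          by (rule predictor_rhs_later_start_le[OF U(1) C(2) QK(2)[OF s']]) (use s s' ek in auto)
        also have "\<dots> \<le> e k * (Bint_sup * C)"
          using s C Bint_sup_nonneg by (intro mult_right_mono) auto
        finally have 2: "norm (predictor_rhs U (e k) s (Q k s) - (f (Q k s) + B1 (Q k s) *v U (s - h))) < \<epsilon> / 4"
          using elim by (simp add: predictor_rhs_def[of U "s - h"])
        show "norm (predictor_rhs U (e k) s (Q k s) - ?l) \<le> \<epsilon> / 2"
          by (rule norm_diff_triangle_le[OF less_imp_le[OF 2] less_imp_le[OF 1], THEN order_trans]) (use \<epsilon> in simp)
      qed (use ek in auto)
      moreover have "Q k (e k + h) - Q k h = integral {h..h + e k} (\<lambda>s. predictor_rhs U (e k) s (Q k s))"
        using trajectory_increment[OF U(1) Q(1), of k h "e k + h"] ek by (simp add: add.commute)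
      ultimately show ?case using \<epsilon> by simp
    qed
    then show "\<exists>no. \<forall>n\<ge>no. norm ((1 / e n) *\<^sub>R (Q n (e n + h) - Q n h) - ?l) < \<epsilon>"
      by (simp add: eventually_sequentially)
  qed
  have "(\<lambda>k. (1 / e k) *\<^sub>R (Q k (e k + h) - Q k h) + (1 / e k) *\<^sub>R (Q k h - P h)) \<longlonglongrightarrow> ?l + \<beta> h *v U 0"
    by (intro tendsto_add tail lin)
  then show ?thesis
    by (simp add: scaleR_add_right[symmetric] matrix_vector_mult_add_rdistrib add.assoc)
qed

end

subsection \<open>The gain of the predictor transformation\<close>

lemma right_derivative_sequentially:
  fixes y :: "real \<Rightarrow> 'a::real_normed_vector"
  assumes "\<And>e. e \<longlonglongrightarrow> 0 \<Longrightarrow> (\<And>k. 0 < e k) \<Longrightarrow> (\<And>k. e k \<le> d) \<Longrightarrow>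
    (\<lambda>k. (1 / e k) *\<^sub>R (y (t + e k) - y t)) \<longlonglongrightarrow> v"
  shows "(y has_vector_derivative v) (at t within {t..t+d})"
  unfolding has_vector_derivative_def has_derivative_within
proof
  show "bounded_linear (\<lambda>x. x *\<^sub>R v)" by (rule bounded_linear_scaleR_left)
  show "((\<lambda>s. (1 / norm (s - t)) *\<^sub>R (y s - (y t + (s - t) *\<^sub>R v))) \<longlongrightarrow> 0) (at t within {t..t+d})"
    unfolding tendsto_at_iff_sequentially
  proof (intro allI impI)
    fix X assume X: "\<forall>i. X i \<in> {t..t+d} - {t}" and lim: "X \<longlonglongrightarrow> t"
    define e where "e k = X k - t" for k
    have e: "0 < e k" "e k \<le> d" for k using X[rule_format, of k] by (auto simp: e_def)
    have "(\<lambda>k. X k - t) \<longlonglongrightarrow> t - t" by (intro tendsto_intros lim)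
    then have "e \<longlonglongrightarrow> 0" by (simp add: e_def[abs_def])
    then have "(\<lambda>k. (1 / e k) *\<^sub>R (y (t + e k) - y t) - v) \<longlonglongrightarrow> v - v"
      by (intro tendsto_diff tendsto_const assms e)
    moreover have "(1 / e k) *\<^sub>R (y (t + e k) - y t) - v = (1 / norm (X k - t)) *\<^sub>R (y (X k) - (y t + (X k - t) *\<^sub>R v))" for k
    proof -
      have "X k = t + e k" "norm (X k - t) = e k" using e(1)[of k] by (auto simp: e_def)
      then show ?thesis using e(1)[of k] by (simp add: scaleR_diff_right scaleR_add_right)
    qed
    ultimately show "((\<lambda>s. (1 / norm (s - t)) *\<^sub>R (y s - (y t + (s - t) *\<^sub>R v))) \<circ> X) \<longlonglongrightarrow> 0"
      by (simp add: o_def)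
  qed
qed

lemma dini_bound_of_derivative:
  fixes g :: "real \<Rightarrow> real"
  assumes der: "(g has_real_derivative D) (at t within {t..t+d})" and d: "d > 0" and D: "D \<le> 0" and e: "e > 0"
  shows "\<forall>\<^sub>F s in at_right t. g s - g t \<le> e * (s - t)"
proof -
  obtain \<delta> where \<delta>: "\<delta> > 0" "\<And>s. s \<in> {t..t+d} \<Longrightarrow> norm (s - t) < \<delta> \<Longrightarrow> norm (g s - g t - D * (s - t)) \<le> e * norm (s - t)"
    using der e unfolding has_field_derivative_def has_derivative_within_alt by blast
  have "\<forall>\<^sub>F s in at_right t. s \<in> {t<..<t + min d \<delta>}"
    by (rule eventually_at_right_real) (use d \<delta> in auto)
  then show ?thesis
  proof eventually_elim
    case (elim s)
    have "norm (g s - g t - D * (s - t)) \<le> e * norm (s - t)" by (rule \<delta>(2)) (use elim in auto)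
    moreover have "D * (s - t) \<le> 0" using D elim by (intro mult_nonpos_nonneg) auto
    ultimately show ?case using elim by (auto simp: abs_le_iff)
  qed
qed

context predictor_system
begin

text \<open>Time enters the predictor equation only through the input and the starting time, so a
  translate of the input translates its trajectories.\<close>

lemma trajectory_shift:
  assumes U: "admissible_input U" and P: "trajectory (\<lambda>w. U (e + w)) 0 P"
  shows "trajectory U e (\<lambda>a. P (a - e))"
proof -
  have eq: "predictor_rhs (\<lambda>w. U (e + w)) 0 s z = predictor_rhs U e (s + e) z" for s z
    by (simp add: predictor_rhs_def algebra_simps)
  have c: "continuous_on {e..e+h} (\<lambda>a. P (a - e))"
    by (rule continuous_on_compose2[OF trajectory_continuous_on[OF P]]) (auto intro!: continuous_intros)
  show ?thesis
    unfolding trajectory_def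
  proof (intro conjI ballI c)
    show "(\<lambda>a. P (a - e)) ` {e..e + h} \<subseteq> origin_ball R"
      using trajectory_in_ball[OF P] by (auto simp: image_subset_iff)
    fix a assume a: "a \<in> {e..e+h}"
    have "P (a - e) = P 0 + integral {0..a-e} (\<lambda>r. predictor_rhs U e (r + e) (P r))"
      using trajectory_eq[OF P, of "a - e"] a by (simp add: eq)
    also have "integral {0..a-e} (\<lambda>r. predictor_rhs U e (r + e) (P r)) = integral {e..a} (\<lambda>r. predictor_rhs U e r (P (r - e)))"
      using integral_shift_real_ivl[of e e a "\<lambda>r. predictor_rhs U e r (P (r - e))"] by simp
    finally show "P (a - e) = P (e - e) + integral {e..a} (\<lambda>r. predictor_rhs U e r (P (r - e)))" by simp
  qed
qed

abbreviation rho :: real where "rho \<equiv> transform_gain h R M_f B1 Bint"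

lemma rho_eq: "rho = sqrt 2 * exp (M_f * h) * max 1 (max 1 (sqrt h) * history_gain)"
  unfolding transform_gain_def history_gain_def B1_sup_def Bint_sup_def by (simp add: add.commute)

text \<open>This lower bound is what makes the constant 5/8 in the first-exit argument
  admissible.\<close>

lemma rho_ge: "rho \<ge> sqrt 2"
proof -
  have "sqrt 2 * 1 * 1 \<le> sqrt 2 * exp (M_f * h) * max 1 (max 1 (sqrt h) * history_gain)"
    using M_f_nonneg h_pos by (intro mult_mono) auto
  then show ?thesis by (simp add: rho_eq)
qed

lemma rho_pos: "rho > 0"
  using rho_ge real_sqrt_gt_0_iff[of 2] by linarith

lemma rho_sq_ge: "rho\<^sup>2 \<ge> 2"
  using power_mono[OF rho_ge, of 2] by simp

text \<open>The L1 norm is exchanged for the L2 norm, at the price \<open>sqrt h\<close> inside the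
  maximum. The factor \<open>sqrt 2\<close> of \<open>rho\<close> is divided out because it is
  reserved for squaring the sum on the right.\<close>

lemma gain_le_rho:
  assumes U: "admissible_input U" and p: "p \<ge> 0"
  shows "exp (M_f * h) * (p + history_gain * integral {-h..0} (\<lambda>w. norm (U w)))
    \<le> rho / sqrt 2 * (p + sqrt (integral {-h..0} (\<lambda>w. (norm (U w))\<^sup>2)))"
proof -
  let ?q = "sqrt (integral {-h..0} (\<lambda>w. (norm (U w))\<^sup>2))"
  have q: "?q \<ge> 0" by (simp add: integral_nonneg admissible_input_sqnorm_integrable U)
  have "history_gain * integral {-h..0} (\<lambda>w. norm (U w)) \<le> history_gain * (sqrt h * ?q)"
    using L1_le_L2_norm[OF U, of "-h" 0] h_pos history_gain_nonneg by (intro mult_left_mono) auto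
  also have "\<dots> = (sqrt h * history_gain) * ?q" by simp
  also have "\<dots> \<le> max 1 (max 1 (sqrt h) * history_gain) * ?q"
    using history_gain_nonneg q by (intro mult_right_mono) (auto intro: order_trans[OF mult_right_mono[of "sqrt h" "max 1 (sqrt h)"]])
  finally have 1: "history_gain * integral {-h..0} (\<lambda>w. norm (U w)) \<le> max 1 (max 1 (sqrt h) * history_gain) * ?q" .
  have "1 * p \<le> max 1 (max 1 (sqrt h) * history_gain) * p" using p by (intro mult_right_mono) auto
  with 1 have "p + history_gain * integral {-h..0} (\<lambda>w. norm (U w)) \<le> max 1 (max 1 (sqrt h) * history_gain) * (p + ?q)"
    by (simp add: distrib_left)
  then have "exp (M_f * h) * (p + history_gain * integral {-h..0} (\<lambda>w. norm (U w)))
      \<le> exp (M_f * h) * (max 1 (max 1 (sqrt h) * history_gain) * (p + ?q))"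
    by (rule mult_left_mono) simp
  then show ?thesis by (simp add: rho_eq mult.assoc)
qed

lemma trajectory_rho_estimate:
  assumes U: "admissible_input U" and P: "trajectory U 0 P" and t: "t \<in> {0..h}"
  shows "norm (P t) \<le> rho / sqrt 2 * (norm (P 0) + sqrt (integral {-h..0} (\<lambda>w. (norm (U w))\<^sup>2)))"
    and "norm (P t) \<le> rho / sqrt 2 * (norm (P h) + sqrt (integral {-h..0} (\<lambda>w. (norm (U w))\<^sup>2)))"
  using trajectory_estimate[OF U P t] gain_le_rho[OF U norm_ge_zero[of "P 0"]] gain_le_rho[OF U norm_ge_zero[of "P h"]]
  by linarith+

end

text \<open>Adding \<open>q^2\<close> to the first bound would give the constant
  \<open>\<rho>^2 + 1\<close>, too large for the first-exit argument, which needs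
  \<open>(\<rho>^2 + c)^2 < 2 \<rho>^4\<close> for all \<open>\<rho>^2 \<ge> 2\<close>, that is
  \<open>c < 2 sqrt 2 - 2\<close>. Semidefiniteness of the quadratic form for all
  \<open>a \<ge> 1\<close> needs \<open>c^2 + c \<ge> 1\<close>, that is
  \<open>c \<ge> (sqrt 5 - 1) / 2\<close>. The fraction 5/8 lies between.\<close>

lemma two_term_square:
  fixes p q z \<rho> :: real
  assumes z: "0 \<le> z" "z \<le> \<rho> / sqrt 2 * (p + q)"
  shows "z\<^sup>2 \<le> \<rho>\<^sup>2 * (p\<^sup>2 + q\<^sup>2)"
    and "\<rho>\<^sup>2 \<ge> 2 \<Longrightarrow> z\<^sup>2 + q\<^sup>2 \<le> (\<rho>\<^sup>2 + 5/8) * (p\<^sup>2 + q\<^sup>2)"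
proof -
  define a where "a = \<rho>\<^sup>2 / 2"
  have "z\<^sup>2 \<le> (\<rho> / sqrt 2 * (p + q))\<^sup>2" using z by (intro power_mono) auto
  then have za: "z\<^sup>2 \<le> a * (p + q)\<^sup>2" by (simp add: a_def power_mult_distrib power_divide)
  have "a \<ge> 0" by (simp add: a_def)
  have "(p + q)\<^sup>2 \<le> 2 * (p\<^sup>2 + q\<^sup>2)" using zero_le_power2[of "p - q"] by (simp add: power2_eq_square algebra_simps)
  from mult_left_mono[OF this \<open>a \<ge> 0\<close>] za have "z\<^sup>2 \<le> a * (2 * (p\<^sup>2 + q\<^sup>2))" by linarith
  also have "\<dots> = \<rho>\<^sup>2 * (p\<^sup>2 + q\<^sup>2)" by (simp add: a_def algebra_simps)
  finally show "z\<^sup>2 \<le> \<rho>\<^sup>2 * (p\<^sup>2 + q\<^sup>2)" .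
  assume "\<rho>\<^sup>2 \<ge> 2"
  then have a1: "a \<ge> 1" by (simp add: a_def)
  \<comment> \<open>the discriminant of the quadratic form \<open>(a + 5/8) p\<^sup>2 - 2 a p q + (a - 3/8) q\<^sup>2\<close> is nonpositive\<close>
  have "0 \<le> (a + 5/8) * ((a + 5/8) * p\<^sup>2 - 2 * a * p * q + (a - 3/8) * q\<^sup>2)"
  proof -
    have "(a + 5/8) * ((a + 5/8) * p\<^sup>2 - 2 * a * p * q + (a - 3/8) * q\<^sup>2)
        = ((a + 5/8) * p - a * q)\<^sup>2 + (a / 4 - 15/64) * q\<^sup>2"
      by (simp add: power2_eq_square field_simps)
    also have "\<dots> \<ge> 0" using a1 by (intro add_nonneg_nonneg mult_nonneg_nonneg) auto
    finally show ?thesis .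
  qed
  then have "0 \<le> (a + 5/8) * p\<^sup>2 - 2 * a * p * q + (a - 3/8) * q\<^sup>2"
    using a1 by (simp add: zero_le_mult_iff)
  then have "a * (p + q)\<^sup>2 + q\<^sup>2 \<le> (2 * a + 5/8) * (p\<^sup>2 + q\<^sup>2)"
    by (simp add: power2_eq_square field_simps)
  with za show "z\<^sup>2 + q\<^sup>2 \<le> (\<rho>\<^sup>2 + 5/8) * (p\<^sup>2 + q\<^sup>2)" by (simp add: a_def)
qed

subsection \<open>Lyapunov decay along the closed loop\<close>

context predictor_system
begin

section \<open>The predicted state as a function of time\<close>

text \<open>\<open>P t\<close> is the predictor trajectory at time \<open>t\<close>, in time
  relative to \<open>t\<close>; the predicted state is \<open>P t h\<close>. The bound concerns
  whole trajectories, not only end values, because the variational matrix is evaluated along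
  them.\<close>

definition predicted :: "(real \<Rightarrow> real^'m) \<Rightarrow> (real \<Rightarrow> real^'n) \<Rightarrow> real \<Rightarrow> real \<Rightarrow> (real \<Rightarrow> real \<Rightarrow> real^'n) \<Rightarrow> bool" where
  "predicted U x b r P \<longleftrightarrow> admissible_input U \<and>
     (\<forall>t\<in>{0..b}. trajectory (\<lambda>w. U (t + w)) 0 (P t) \<and> P t 0 = x t \<and> (\<forall>s\<in>{0..h}. norm (P t s) \<le> r))"

lemma predicted_exists:
  assumes U: "admissible_input U" and r: "ereal r \<le> R"
    and small: "\<And>t. t \<in> {0..b} \<Longrightarrow> rho / sqrt 2 * (norm (x t) + sqrt (integral {t-h..t} (\<lambda>w. (norm (U w))\<^sup>2))) \<le> r"
  obtains P where "predicted U x b r P"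
proof -
  have "\<exists>Pt. trajectory (\<lambda>w. U (t + w)) 0 Pt \<and> Pt 0 = x t \<and> (\<forall>s\<in>{0..h}. norm (Pt s) \<le> r)" if t: "t \<in> {0..b}" for t
  proof -
    note Ut = admissible_input_shift[OF U, of t]
    have I: "integral {-h..0} (\<lambda>w. (norm (U (t + w)))\<^sup>2) = integral {t-h..t} (\<lambda>w. (norm (U w))\<^sup>2)"
      using integral_shift_real_ivl[of "t-h" t t "\<lambda>w. (norm (U w))\<^sup>2"] by (simp add: add.commute)
    have le: "rho / sqrt 2 * (norm (x t) + sqrt (integral {-h..0} (\<lambda>w. (norm (U (t + w)))\<^sup>2))) \<le> r"
      unfolding I by (rule small[OF t])
    obtain Pt where Pt: "trajectory (\<lambda>w. U (t + w)) 0 Pt" "Pt 0 = x t"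
      by (rule trajectory_exists[OF Ut order_trans[OF gain_le_rho[OF Ut norm_ge_zero] le] r])
    have "norm (Pt s) \<le> r" if "s \<in> {0..h}" for s
      using trajectory_rho_estimate(1)[OF Ut Pt(1) that] le Pt(2) by simp
    then show ?thesis using Pt by blast
  qed
  then have "\<forall>t\<in>{0..b}. \<exists>Pt. trajectory (\<lambda>w. U (t + w)) 0 Pt \<and> Pt 0 = x t \<and> (\<forall>s\<in>{0..h}. norm (Pt s) \<le> r)"
    by blast
  then obtain P where "\<forall>t\<in>{0..b}. trajectory (\<lambda>w. U (t + w)) 0 (P t) \<and> P t 0 = x t \<and> (\<forall>s\<in>{0..h}. norm (P t s) \<le> r)"
    unfolding bchoice_iff by blast
  then show ?thesis using that U unfolding predicted_def by blast
qed

lemma predictedD: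
  assumes "predicted U x b r P"
  shows "admissible_input U"
    and "t \<in> {0..b} \<Longrightarrow> admissible_input (\<lambda>w. U (t + w))"
    and "t \<in> {0..b} \<Longrightarrow> trajectory (\<lambda>w. U (t + w)) 0 (P t)"
    and "t \<in> {0..b} \<Longrightarrow> P t 0 = x t"
    and "t \<in> {0..b} \<Longrightarrow> s \<in> {0..h} \<Longrightarrow> norm (P t s) \<le> r"
  using assms admissible_input_shift unfolding predicted_def by blast+

text \<open>Puts the trajectory of time \<open>t + e\<close> on the clock of time \<open>t\<close>,
  where it shares the input with \<open>P t\<close>.\<close>

lemma predicted_shift:
  assumes P: "predicted U x b r P" and t: "0 \<le> t" "0 \<le> e" "t + e \<le> b"
  shows "trajectory (\<lambda>w. U (t + w)) e (\<lambda>a. P (t + e) (a - e))"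
proof (rule trajectory_shift)
  show "admissible_input (\<lambda>w. U (t + w))" by (rule predictedD(2)[OF P]) (use t in auto)
  show "trajectory (\<lambda>w. U (t + (e + w))) 0 (P (t + e))"
    using predictedD(3)[OF P, of "t + e"] t by (simp add: add.assoc)
qed

lemma predicted_state_continuous:
  assumes P: "predicted U x b r P" and r: "ereal r \<le> R" "r \<ge> 0" and x: "continuous_on {0..b} x"
  shows "continuous_on {0..b} (\<lambda>t. P t h)"
proof -
  obtain C where C: "C \<ge> 0" "\<And>w. norm (U w) \<le> C" using admissible_input_bound[OF predictedD(1)[OF P]] by blast
  obtain c where c: "c \<ge> 0"
    "\<And>U P Q e. admissible_input U \<Longrightarrow> (\<And>w. norm (U w) \<le> C) \<Longrightarrow> trajectory U 0 P \<Longrightarrow> trajectory U e Q \<Longrightarrow>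
       0 \<le> e \<Longrightarrow> e \<le> h \<Longrightarrow> (\<And>s. s \<in> {0..h} \<Longrightarrow> norm (P s) \<le> r) \<Longrightarrow> (\<And>s. s \<in> {e..e+h} \<Longrightarrow> norm (Q s) \<le> r) \<Longrightarrow>
       norm (Q (e + h) - P h) \<le> c * (norm (Q e - P 0) + e)"
  proof (rule trajectory_shift_estimate[OF r C(1)], goal_cases)
    case 1 show ?case by (rule 1(1)) (fact 1)+
  qed
  have fwd: "norm (P (t + e) h - P t h) \<le> c * (norm (x (t + e) - x t) + e)"
    if te: "0 \<le> t" "0 \<le> e" "t + e \<le> b" "e \<le> h" for t e
  proof -
    have "norm ((\<lambda>a. P (t + e) (a - e)) (e + h) - P t h) \<le> c * (norm ((\<lambda>a. P (t + e) (a - e)) e - P t 0) + e)"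
    proof (rule c(2)[where U = "\<lambda>w. U (t + w)"])
      show "admissible_input (\<lambda>w. U (t + w))" "trajectory (\<lambda>w. U (t + w)) 0 (P t)"
        by (rule predictedD(2,3)[OF P]; use te in simp)+
      show "trajectory (\<lambda>w. U (t + w)) e (\<lambda>a. P (t + e) (a - e))" by (rule predicted_shift[OF P te(1-3)])
      show "norm (P t s) \<le> r" if "s \<in> {0..h}" for s by (rule predictedD(5)[OF P _ that]) (use te in simp)
      show "norm (P (t + e) (s - e)) \<le> r" if "s \<in> {e..e+h}" for s
        by (rule predictedD(5)[OF P]) (use te that in auto)
    qed (use C te in auto)
    then show ?thesis
      using predictedD(4)[OF P, of t] predictedD(4)[OF P, of "t + e"] te by simp
  qed
  \<comment> \<open>The shift estimate runs forward only; exchanging the two times covers the other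
    side.\<close>
  have both: "norm (P s h - P t h) \<le> c * (norm (x s - x t) + \<bar>s - t\<bar>)"
    if "s \<in> {0..b}" "t \<in> {0..b}" "\<bar>s - t\<bar> \<le> h" for s t
  proof (cases "t \<le> s")
    case True
    then show ?thesis using fwd[of t "s - t"] that by simp
  next
    case False
    then show ?thesis using fwd[of s "t - s"] that by (simp add: norm_minus_commute)
  qed
  show ?thesis
    unfolding continuous_on_def
  proof
    fix t assume t: "t \<in> {0..b}"
    have "(x \<longlongrightarrow> x t) (at t within {0..b})" using x t unfolding continuous_on_def by blast
    then have "((\<lambda>s. c * (norm (x s - x t) + \<bar>s - t\<bar>)) \<longlongrightarrow> c * (norm (x t - x t) + \<bar>t - t\<bar>)) (at t within {0..b})"
      by (intro tendsto_intros)
    then have lim: "((\<lambda>s. c * (norm (x s - x t) + \<bar>s - t\<bar>)) \<longlongrightarrow> 0) (at t within {0..b})" by simp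
    have "\<forall>\<^sub>F s in at t within {0..b}. norm (P s h - P t h) \<le> c * (norm (x s - x t) + \<bar>s - t\<bar>)"
      unfolding eventually_at by (rule exI[of _ h]) (use h_pos both t in \<open>auto simp: dist_real_def\<close>)
    then have "((\<lambda>s. P s h - P t h) \<longlongrightarrow> 0) (at t within {0..b})"
      by (rule Lim_null_comparison[OF _ lim])
    then show "((\<lambda>t. P t h) \<longlongrightarrow> P t h) (at t within {0..b})" by (simp add: LIM_zero_iff)
  qed
qed

text \<open>The state equation is the predictor right-hand side at its start plus
  \<open>B0 u(t)\<close>, so the start values move as \<open>predictor_right_derivative\<close>
  demands, with \<open>B0 (x t)\<close> as initial value of \<open>\<beta>\<close>. The step is at
  most \<open>h\<close>, so that the compared trajectories overlap, and at most
  \<open>b - t\<close>, the span on which they are given.\<close>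

lemma predicted_state_derivative:
  assumes P: "predicted U x b r' P" and r: "r' < r" "ereal r \<le> R" and t: "t \<in> {0..<b}"
    and U: "isCont U t" "isCont U (t - h)"
    and x: "(x has_vector_derivative predictor_rhs (\<lambda>w. U (t + w)) 0 0 (x t) + B0 (x t) *v U t) (at t within {0..b})"
    and \<phi>: "\<And>\<theta>. \<theta> \<in> {-h..<0} \<Longrightarrow> \<phi> \<theta> = U (t + \<theta>)"
  shows "((\<lambda>s. P s h) has_vector_derivative
      f (P t h) + input_matrix h R f A B0 B1 DB1 Bint DBint (P t h) \<phi> *v U t) (at t within {t..t + min h (b - t)})"
proof (rule right_derivative_sequentially)
  fix e :: "nat \<Rightarrow> real"
  assume e: "e \<longlonglongrightarrow> 0" "\<And>k. 0 < e k" and "\<And>k. e k \<le> min h (b - t)"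
  then have eh: "e k \<le> h" "t + e k \<le> b" for k by (auto simp: le_diff_eq add.commute)
  have t': "t \<in> {0..b}" using t by simp
  note Ut = predictedD(2)[OF P t'] and Pt = predictedD(3)[OF P t'] and P0 = predictedD(4)[OF P t']
  have Pr: "\<forall>s\<in>{0..h}. norm (P t s) \<le> r'" using predictedD(5)[OF P t'] by blast
  have cP: "continuous_on {0..h} (P t)" using trajectory_continuous_on[OF Pt] by simp
  obtain \<beta> where \<beta>: "variational_solution (\<lambda>w. U (t + w)) (P t) (B0 (P t 0)) \<beta>"
    by (rule variational_solution_exists[OF Ut r(2) cP Pr r(1)])
  have B: "input_matrix h R f A B0 B1 DB1 Bint DBint (P t h) \<phi> = B1 (P t h) + \<beta> h"
    by (rule input_matrix_eq[where ?B0.0 = B0 and U = "\<lambda>w. U (t + w)" and P = "P t", OF Ut _ Pt r(2) Pr r(1) \<beta>]) (rule \<phi>)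
  let ?Q = "\<lambda>k a. P (t + e k) (a - e k)"
  have "(\<lambda>k. (1 / e k) *\<^sub>R (?Q k (e k + h) - P t h)) \<longlonglongrightarrow> f (P t h) + (B1 (P t h) + \<beta> h) *v U (t + 0)"
  proof (rule predictor_right_derivative[OF Ut _ _ r(2) Pt Pr r(1) \<beta> e eh(1)])
    show "isCont (\<lambda>w. U (t + w)) 0"
      by (rule isCont_o2[where f = "\<lambda>w. t + w" and g = U]) (use U in auto)
    show "isCont (\<lambda>w. U (t + w)) (- h)"
      by (rule isCont_o2[where f = "\<lambda>w. t + w" and g = U]) (use U in auto)
    show "trajectory (\<lambda>w. U (t + w)) (e k) (?Q k)" for k
      by (rule predicted_shift[OF P]) (use t e(2)[of k] eh in auto)
    show "norm (?Q k s) \<le> r" if "s \<in> {e k..e k + h}" for k s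
      by (rule order_trans[OF predictedD(5)[OF P] less_imp_le[OF r(1)]]) (use that t e(2)[of k] eh[of k] in auto)
    have "(\<lambda>k. (1 / e k) *\<^sub>R (x (t + e k *\<^sub>R 1) - x t)) \<longlonglongrightarrow> 1 *\<^sub>R (predictor_rhs (\<lambda>w. U (t + w)) 0 0 (x t) + B0 (x t) *v U t)"
      by (rule difference_quotient_tendsto[OF x[unfolded has_vector_derivative_def] _ e])
        (use t e eh in \<open>auto intro: add_nonneg_nonneg less_imp_le\<close>)
    moreover have "P (t + e k) 0 = x (t + e k)" for k
      by (rule predictedD(4)[OF P]) (use t e(2)[of k] eh in auto)
    ultimately show "(\<lambda>k. (1 / e k) *\<^sub>R (?Q k (e k) - P t 0)) \<longlonglongrightarrow>
        predictor_rhs (\<lambda>w. U (t + w)) 0 0 (P t 0) + B0 (P t 0) *v U (t + 0)"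
      by (simp add: P0)
  qed
  then show "(\<lambda>k. (1 / e k) *\<^sub>R (P (t + e k) h - P t h)) \<longlonglongrightarrow>
      f (P t h) + input_matrix h R f A B0 B1 DB1 Bint DBint (P t h) \<phi> *v U t"
    by (simp add: B)
qed

end

section \<open>The Lyapunov estimate for the closed loop\<close>

text \<open>\<open>decrease\<close> is imposed only where some predictor trajectory ends at
  \<open>y\<close>, since elsewhere \<open>input_matrix\<close> is an undetermined description;
  along the loop \<open>P t\<close> is such a trajectory.\<close>

locale closed_loop_system = predictor_system h R M_f f A B1 DB1 Bint DBint
  for h :: real and R :: ereal and M_f :: real
    and f :: "real^'n \<Rightarrow> real^'n" and A :: "real^'n \<Rightarrow> real^'n^'n"
    and B1 :: "real^'n \<Rightarrow> real^'m^'n" and DB1 :: "'m::finite \<Rightarrow> real^'n \<Rightarrow> real^'n^'n"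
    and Bint :: "real \<Rightarrow> real^'n \<Rightarrow> real^'m^'n" and DBint :: "'m \<Rightarrow> real \<Rightarrow> real^'n \<Rightarrow> real^'n^'n" +
  fixes B0 :: "real^'n \<Rightarrow> real^'m^'n" and v0 w0 :: "real^'n \<Rightarrow> real" and grad_v0 :: "real^'n \<Rightarrow> real^'n"
    and \<kappa> :: "real^'n \<Rightarrow> (real \<Rightarrow> real^'m) \<Rightarrow> real^'m" and m_v0 M_v0 m_w0 M_\<kappa> \<gamma> \<sigma> :: real
  assumes v0_deriv: "\<And>y. y \<in> origin_ball R \<Longrightarrow> (v0 has_derivative (\<lambda>d. grad_v0 y \<bullet> d)) (at y within origin_ball R)"
    and constants: "m_v0 > 0" "m_w0 > 0" "M_\<kappa> > 0"
    and v0_bounds: "\<And>y. y \<in> origin_ball R \<Longrightarrow> m_v0 * (norm y)\<^sup>2 \<le> v0 y \<and> v0 y \<le> M_v0 * (norm y)\<^sup>2"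
    and w0_bound: "\<And>y. y \<in> origin_ball R \<Longrightarrow> w0 y \<ge> m_w0 * (norm y)\<^sup>2"
    and \<kappa>_bound: "\<And>y \<phi>. (y, \<phi>) \<in> state_ball h R \<Longrightarrow> norm (\<kappa> y \<phi>) \<le> M_\<kappa> * norm y"
    and decrease: "\<And>y \<phi>. (y, \<phi>) \<in> state_ball h R \<Longrightarrow>
          \<exists>\<xi>. predictor_trajectory h R f B1 Bint \<phi> \<xi> \<and> \<xi> h = y \<Longrightarrow>
          (f y + input_matrix h R f A B0 B1 DB1 Bint DBint y \<phi> *v \<kappa> y \<phi>) \<bullet> grad_v0 y \<le> - w0 y"
    and \<gamma>: "\<gamma> = m_w0 / (2 * M_\<kappa>\<^sup>2)"
    and \<sigma>: "\<sigma> = m_w0 / (2 * M_v0)"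
begin

text \<open>Compares the two bounds on \<open>v0\<close> at a nonzero point of the ball; it makes
  \<open>M_v0\<close> positive and \<open>\<sigma>\<close> meaningful.\<close>

lemma M_v0_ge: "m_v0 \<le> M_v0"
proof -
  obtain r where r: "0 < ereal r" "ereal r < R" using R_pos ereal_dense2 by blast
  define y :: "real^'n" where "y = r *\<^sub>R axis undefined 1"
  have ny: "norm y = r" "r > 0" using r by (simp_all add: y_def)
  then have "y \<in> origin_ball R" using cball_subset_origin_ball[OF less_imp_le[OF r(2)]] by auto
  from v0_bounds[OF this] have "m_v0 * r\<^sup>2 \<le> M_v0 * r\<^sup>2" by (simp add: ny)
  then show ?thesis using ny by simp
qed

lemma M_v0_pos: "M_v0 > 0" and \<gamma>_pos: "\<gamma> > 0" and \<sigma>_pos: "\<sigma> > 0"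
  using M_v0_ge constants by (simp_all add: \<gamma> \<sigma>)

text \<open>This split determines \<open>\<gamma>\<close> and \<open>\<sigma>\<close>: of the
  available decrease \<open>m_w0 |y|^2\<close>, one half pays for \<open>\<sigma> v0\<close> and the
  other half for the input term \<open>\<gamma> |k|^2\<close>.\<close>

lemma lyapunov_derivative_nonpos:
  assumes y: "y \<in> origin_ball R" and Y': "Y' \<bullet> grad_v0 y \<le> - w0 y" and k: "norm k \<le> M_\<kappa> * norm y"
  shows "\<sigma> * v0 y + grad_v0 y \<bullet> Y' + \<gamma> * (norm k)\<^sup>2 \<le> 0"
proof -
  have "\<sigma> * v0 y \<le> \<sigma> * (M_v0 * (norm y)\<^sup>2)"
    using v0_bounds[OF y] \<sigma>_pos by (intro mult_left_mono) auto
  also have "\<dots> = m_w0 / 2 * (norm y)\<^sup>2" using M_v0_pos by (simp add: \<sigma>)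
  finally have 1: "\<sigma> * v0 y \<le> m_w0 / 2 * (norm y)\<^sup>2" .
  have "\<gamma> * (norm k)\<^sup>2 \<le> \<gamma> * (M_\<kappa> * norm y)\<^sup>2"
    using k \<gamma>_pos by (intro mult_left_mono power_mono) auto
  also have "\<dots> = m_w0 / 2 * (norm y)\<^sup>2" using constants by (simp add: \<gamma> power_mult_distrib)
  finally have 2: "\<gamma> * (norm k)\<^sup>2 \<le> m_w0 / 2 * (norm y)\<^sup>2" .
  have "grad_v0 y \<bullet> Y' \<le> - (m_w0 * (norm y)\<^sup>2)" using Y' w0_bound[OF y] by (simp add: inner_commute)
  with 1 2 show ?thesis by (simp add: field_simps)
qed

text \<open>The function shown to be nonincreasing is \<open>exp (\<sigma> t) V(t)\<close> with
  \<open>V = v0(y) + \<gamma> \<integral> exp (\<sigma> \<theta>) |u(t+\<theta>)|\<^sup>2 d\<theta>\<close>; a right derivative off a countable set suffices.\<close>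

lemma lyapunov_decay:
  assumes sol: "closed_loop_solution h R f B0 B1 Bint \<kappa> T x u" and b: "0 \<le> b" "ereal b < T"
    and r: "0 \<le> r'" "r' < r" "ereal r \<le> R"
    and small: "\<And>t. t \<in> {0..b} \<Longrightarrow> rho / sqrt 2 * (norm (x t) + sqrt (hist_sqnorm h (segment h u t))) \<le> r'"
    and ball: "\<And>t (y :: real^'n). t \<in> {0..b} \<Longrightarrow> norm y \<le> rho / sqrt 2 * (norm (x t) + sqrt (hist_sqnorm h (segment h u t))) \<Longrightarrow>
       (y, segment h u t) \<in> state_ball h R"
  obtains y :: "real^'n" where "norm (x b) \<le> rho / sqrt 2 * (norm y + sqrt (hist_sqnorm h (segment h u b)))"
    "m_v0 * (norm y)\<^sup>2 + \<gamma> * exp (- \<sigma> * h) * hist_sqnorm h (segment h u b)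
      \<le> (\<gamma> + rho\<^sup>2 * M_v0) * exp (- \<sigma> * b) * state_sqnorm h (x 0) (segment h u 0)"
proof -
  have pc: "piecewise_continuous_on {-h..b} u"
    and cl: "\<And>t. t \<in> {0..b} \<Longrightarrow> u t = \<kappa> (predictor_map h R f B1 Bint (x t) (segment h u t)) (segment h u t)"
  proof -
    show "piecewise_continuous_on {-h..b} u" using sol b unfolding closed_loop_solution_def by blast
    fix t assume "t \<in> {0..b}"
    then have "0 \<le> t" "ereal t < T" using b by (auto intro: le_less_trans[of _ "ereal b"])
    then show "u t = \<kappa> (predictor_map h R f B1 Bint (x t) (segment h u t)) (segment h u t)"
      using sol unfolding closed_loop_solution_def by blast
  qed
  \<comment> \<open>Beyond \<open>b\<close> the input is cut to 0, which makes it admissible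
    whatever the solution does later; the histories up to time \<open>b\<close> are
    unchanged.\<close>
  define U where "U w = (if w \<in> {-h..b} then u w else 0)" for w
  have U: "admissible_input U"
    unfolding U_def by (rule piecewise_continuous_on_admissible[OF pc]) auto
  have seg: "segment h u t \<theta> = U (t + \<theta>)" if "t \<in> {0..b}" "\<theta> \<in> {-h..<0}" for t \<theta>
    using that by (simp add: segment_def U_def)
  have hist: "hist_sqnorm h (segment h u t) = integral {t-h..t} (\<lambda>w. (norm (U w))\<^sup>2)" if "t \<in> {0..b}" for t
    by (rule hist_sqnorm_cong) (simp add: seg[OF that])
  have r'R: "ereal r' \<le> R" using r by (metis ereal_less_eq(3) less_imp_le order_trans)
  obtain P where P: "predicted U x b r' P"
    by (rule predicted_exists[OF U r'R, of b x]) (use small hist in auto)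
  define y where "y t = P t h" for t
  have pm: "predictor_map h R f B1 Bint (x t) (segment h u t) = y t" if t: "t \<in> {0..b}" for t
  proof -
    have "predictor_map h R f B1 Bint (P t 0) (segment h u t) = P t h"
      by (rule predictor_map_eq[OF predictedD(2)[OF P t] _ predictedD(3)[OF P t]]) (rule seg[OF t])
    then show ?thesis by (simp add: y_def predictedD(4)[OF P t])
  qed
  have shiftI: "integral {-h..0} (\<lambda>w. (norm (U (t + w)))\<^sup>2) = integral {t-h..t} (\<lambda>w. (norm (U w))\<^sup>2)" for t
    using integral_shift_real_ivl[of "t-h" t t "\<lambda>w. (norm (U w))\<^sup>2"] by (simp add: add.commute)
  have yx: "norm (y t) \<le> rho / sqrt 2 * (norm (x t) + sqrt (hist_sqnorm h (segment h u t)))"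
    and xy: "norm (x t) \<le> rho / sqrt 2 * (norm (y t) + sqrt (hist_sqnorm h (segment h u t)))" if t: "t \<in> {0..b}" for t
  proof -
    note est = trajectory_rho_estimate[OF predictedD(2)[OF P t] predictedD(3)[OF P t]]
    show "norm (y t) \<le> rho / sqrt 2 * (norm (x t) + sqrt (hist_sqnorm h (segment h u t)))"
      using est(1)[of h] h_pos by (simp add: y_def hist[OF t] shiftI predictedD(4)[OF P t])
    show "norm (x t) \<le> rho / sqrt 2 * (norm (y t) + sqrt (hist_sqnorm h (segment h u t)))"
      using est(2)[of 0] h_pos by (simp add: y_def hist[OF t] shiftI predictedD(4)[OF P t])
  qed
  have sb: "(y t, segment h u t) \<in> state_ball h R" if "t \<in> {0..b}" for t by (rule ball[OF that yx[OF that]])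
  have yball: "y t \<in> origin_ball R" if t: "t \<in> {0..b}" for t
    using predictedD(5)[OF P t, of h] cball_subset_origin_ball[OF r'R] h_pos by (auto simp: y_def)
  obtain S where S: "countable S" "continuous_on {t. 0 \<le> t \<and> ereal t < T} x"
    "\<And>t. t \<in> {t. 0 \<le> t \<and> ereal t < T} - S \<Longrightarrow> (x has_vector_derivative f (x t) + B0 (x t) *v u t + B1 (x t) *v u (t - h)
         + integral {-h..0} (\<lambda>\<theta>. Bint \<theta> (x t) *v u (t + \<theta>))) (at t within {t. 0 \<le> t \<and> ereal t < T})"
    using sol unfolding closed_loop_solution_def solves_on_def by blast
  have sub: "{0..b} \<subseteq> {t. 0 \<le> t \<and> ereal t < T}" using b by (auto intro: le_less_trans[of _ "ereal b"])
  have cx: "continuous_on {0..b} x" by (rule continuous_on_subset[OF S(2) sub])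
  have cy: "continuous_on {0..b} y"
    unfolding y_def by (rule predicted_state_continuous[OF P r'R r(1) cx])
  have xder: "(x has_vector_derivative predictor_rhs (\<lambda>w. U (t + w)) 0 0 (x t) + B0 (x t) *v U t) (at t within {0..b})"
    if t: "t \<in> {0..b} - S" for t
  proof -
    have "integral {-h..0} (\<lambda>\<theta>. Bint \<theta> (x t) *v u (t + \<theta>)) = integral {-h..0} (\<lambda>\<theta>. Bint \<theta> (x t) *v U (t + \<theta>))"
      by (rule integral_cong) (use t in \<open>auto simp: U_def\<close>)
    moreover have "u t = U t" "u (t - h) = U (t + - h)" using t h_pos by (auto simp: U_def)
    ultimately have "f (x t) + B0 (x t) *v u t + B1 (x t) *v u (t - h) + integral {-h..0} (\<lambda>\<theta>. Bint \<theta> (x t) *v u (t + \<theta>))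
        = predictor_rhs (\<lambda>w. U (t + w)) 0 0 (x t) + B0 (x t) *v U t"
      by (simp add: predictor_rhs_def)
    moreover have "(x has_vector_derivative f (x t) + B0 (x t) *v u t + B1 (x t) *v u (t - h)
         + integral {-h..0} (\<lambda>\<theta>. Bint \<theta> (x t) *v u (t + \<theta>))) (at t within {0..b})"
      by (rule has_vector_derivative_within_subset[OF S(3) sub]) (use t sub in blast)
    ultimately show ?thesis by simp
  qed
  let ?q = "\<lambda>w. exp (\<sigma> * w) * (norm (U w))\<^sup>2"
  obtain C where C: "\<And>w. norm (U w) \<le> C" using admissible_input_bound[OF U] by blast
  have qint: "?q integrable_on {a..c}" for a c
  proof (rule admissible_input_integrable[OF U, of "\<lambda>w z. exp (\<sigma> * w) * (norm z)\<^sup>2" _ _ "exp (\<sigma> * c) * C\<^sup>2"])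
    show "norm (exp (\<sigma> * w) * (norm (U w))\<^sup>2) \<le> exp (\<sigma> * c) * C\<^sup>2" if "w \<in> {a..c}" for w
    proof -
      have "exp (\<sigma> * w) \<le> exp (\<sigma> * c)" using that \<sigma>_pos by simp
      moreover have "(norm (U w))\<^sup>2 \<le> C\<^sup>2" by (rule power_mono[OF C]) simp
      ultimately show ?thesis by (simp add: abs_mult mult_mono)
    qed
  qed (intro continuous_intros)
  \<comment> \<open>With this weight the history term of \<open>exp (\<sigma> t) V(t)\<close> is
    \<open>\<gamma> (J t - J (t - h))\<close>, so its derivative is read off at the two ends of the
    window.\<close>
  define J where "J s = integral {-h..s} ?q" for s
  have Jint: "J s - J (s - h) = integral {s-h..s} ?q" if "s \<in> {0..b}" for s
    using Henstock_Kurzweil_Integration.integral_combine[OF _ _ qint, of "-h" "s-h" s] that h_pos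
    by (simp add: J_def)
  have cJ: "continuous_on {-h..b} J"
    unfolding J_def by (rule indefinite_integral_continuous_1[OF qint])
  have Jder: "(J has_real_derivative ?q t) (at t within {-h..b})" if t: "t \<in> {-h..b}" "isCont U t" for t
  proof -
    have "isCont ?q t" by (intro continuous_intros t(2))
    then have "continuous (at t within {-h..b}) ?q" by (rule continuous_at_imp_continuous_at_within)
    then have "((\<lambda>s. integral {-h..s} ?q) has_vector_derivative ?q t) (at t within {-h..b})"
      by (rule integral_has_vector_derivative_at[OF qint t(1)])
    then show ?thesis
      by (simp only: J_def[abs_def] has_real_derivative_iff_has_vector_derivative)
  qed
  define g where "g s = exp (\<sigma> * s) * v0 (y s) + \<gamma> * (J s - J (s - h))" for s
  \<comment> \<open>Besides the exceptions of the state equation, the times at which the input jumps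
    at either end of the window, \<open>t\<close> or \<open>t - h\<close>.\<close>
  define Sx where "Sx = S \<union> {w. \<not> isCont U (w + 0)} \<union> {w. \<not> isCont U (w + - h)}"
  have "g b \<le> g 0"
  proof (rule dini_nonincreasing[OF b(1), where S = Sx])
    show "countable Sx"
      unfolding Sx_def by (intro countable_Un S(1) countable_finite finite_shifted_discontinuities U)
    have "continuous_on (origin_ball R) v0" by (rule has_derivative_continuous_on[OF v0_deriv])
    then have "continuous_on {0..b} (\<lambda>s. v0 (y s))"
      by (rule continuous_on_compose2[OF _ cy]) (use yball in auto)
    moreover have "continuous_on {0..b} J" by (rule continuous_on_subset[OF cJ]) (use h_pos in auto)
    moreover have "continuous_on {0..b} (\<lambda>s. J (s - h))"
      by (rule continuous_on_compose2[OF cJ]) (use h_pos in \<open>auto intro!: continuous_intros\<close>)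
    ultimately show "continuous_on {0..b} g" unfolding g_def by (intro continuous_intros)
  next
    fix t \<epsilon> :: real assume t: "t \<in> {0..<b} - Sx" and \<epsilon>: "\<epsilon> > 0"
    have t': "t \<in> {0..b}" "t \<in> {0..<b}" "t \<in> {0..b} - S" and Ut: "isCont U t" "isCont U (t - h)"
      using t by (auto simp: Sx_def)
    define d where "d = min h (b - t)"
    have d: "d > 0" "t + d \<le> b" using t' h_pos by (auto simp: d_def)
    let ?Y = "f (y t) + input_matrix h R f A B0 B1 DB1 Bint DBint (y t) (segment h u t) *v U t"
    have yder: "(y has_vector_derivative ?Y) (at t within {t..t+d})"
      unfolding d_def y_def
      by (rule predicted_state_derivative[where ?B0.0 = B0 and t = t, OF P r(2,3) t'(2) Ut xder[OF t'(3)]]) (rule seg[OF t'(1)])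
    have vder: "((\<lambda>s. v0 (y s)) has_real_derivative grad_v0 (y t) \<bullet> ?Y) (at t within {t..t+d})"
    proof -
      have "y ` {t..t+d} \<subseteq> origin_ball R" using yball t' d by auto
      then have "(v0 has_derivative (\<lambda>d. grad_v0 (y t) \<bullet> d)) (at (y t) within y ` {t..t+d})"
        by (rule has_derivative_subset[OF v0_deriv[OF yball[OF t'(1)]]])
      from vector_derivative_diff_chain_within[OF yder this]
      show ?thesis by (simp add: has_real_derivative_iff_has_vector_derivative o_def)
    qed
    have J1: "(J has_real_derivative ?q t) (at t within {t..t+d})"
      by (rule DERIV_subset[OF Jder[OF _ Ut(1)]]) (use t' d h_pos in auto)
    have J2: "((\<lambda>s. J (s - h)) has_real_derivative ?q (t - h)) (at t within {t..t+d})"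
    proof -
      have "(J has_real_derivative ?q (t - h)) (at (t - h) within (\<lambda>s. s - h) ` {t..t+d})"
        by (rule DERIV_subset[OF Jder[OF _ Ut(2)]]) (use t' d h_pos in auto)
      then have "((J \<circ> (\<lambda>s. s - h)) has_real_derivative ?q (t - h) * 1) (at t within {t..t+d})"
        by (rule DERIV_image_chain) (auto intro!: derivative_eq_intros)
      then show ?thesis by (simp add: o_def)
    qed
    have E: "((\<lambda>s. exp (\<sigma> * s)) has_real_derivative \<sigma> * exp (\<sigma> * t)) (at t within {t..t+d})"
      by (auto intro!: derivative_eq_intros)
    \<comment> \<open>The contribution of the far end of the window, the term at
      \<open>t - h\<close>, has the favourable sign and is discarded.\<close>
    let ?D = "exp (\<sigma> * t) * (\<sigma> * v0 (y t) + grad_v0 (y t) \<bullet> ?Y + \<gamma> * (norm (U t))\<^sup>2) - \<gamma> * ?q (t - h)"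
    have gder: "(g has_real_derivative ?D) (at t within {t..t+d})"
    proof -
      have "(g has_real_derivative (\<sigma> * exp (\<sigma> * t)) * v0 (y t) + (grad_v0 (y t) \<bullet> ?Y) * exp (\<sigma> * t) + \<gamma> * (?q t - ?q (t - h))) (at t within {t..t+d})"
        unfolding g_def by (intro DERIV_add DERIV_mult DERIV_cmult DERIV_diff E vder J1 J2)
      then show ?thesis by (simp add: algebra_simps)
    qed
    have UK: "U t = \<kappa> (y t) (segment h u t)"
      using cl[OF t'(1)] pm[OF t'(1)] t' h_pos by (simp add: U_def)
    have "predictor_trajectory h R f B1 Bint (segment h u t) (P t)"
    proof -
      have "predictor_trajectory h R f B1 Bint (segment h u t) (P t) \<longleftrightarrow> trajectory (\<lambda>w. U (t + w)) 0 (P t)"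
        by (rule predictor_trajectory_iff[OF predictedD(2)[OF P t'(1)]]) (rule seg[OF t'(1)])
      then show ?thesis using predictedD(3)[OF P t'(1)] by blast
    qed
    then have dec: "?Y \<bullet> grad_v0 (y t) \<le> - w0 (y t)"
      unfolding UK by (intro decrease sb[OF t'(1)]) (auto simp: y_def)
    have "norm (U t) \<le> M_\<kappa> * norm (y t)" unfolding UK by (rule \<kappa>_bound[OF sb[OF t'(1)]])
    from lyapunov_derivative_nonpos[OF yball[OF t'(1)] dec this]
    have "exp (\<sigma> * t) * (\<sigma> * v0 (y t) + grad_v0 (y t) \<bullet> ?Y + \<gamma> * (norm (U t))\<^sup>2) \<le> 0"
      by (intro mult_nonneg_nonpos) auto
    moreover have "0 \<le> \<gamma> * ?q (t - h)" using \<gamma>_pos by simp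
    ultimately have "?D \<le> 0" by linarith
    then show "\<forall>\<^sub>F s in at_right t. g s - g t \<le> \<epsilon> * (s - t)"
      by (rule dini_bound_of_derivative[OF gder d(1) _ \<epsilon>])
  qed
  have b': "b \<in> {0..b}" "0 \<in> {0..b}" using b by auto
  have sqint: "(\<lambda>w. (norm (U w))\<^sup>2) integrable_on {a..c}" for a c by (rule admissible_input_sqnorm_integrable[OF U])
  let ?H = "\<lambda>t. hist_sqnorm h (segment h u t)"
  \<comment> \<open>On \<open>[b - h, b]\<close> the weight is at least
    \<open>exp (\<sigma> (b - h))\<close>, the origin of \<open>exp (- \<sigma> h)\<close> in
    \<open>m_v\<close>.\<close>
  have lower: "exp (\<sigma> * b) * (m_v0 * (norm (y b))\<^sup>2 + \<gamma> * exp (- \<sigma> * h) * ?H b) \<le> g b"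
  proof -
    have "exp (\<sigma> * (b - h)) * ?H b = integral {b-h..b} (\<lambda>w. exp (\<sigma> * (b - h)) * (norm (U w))\<^sup>2)"
      by (simp add: hist[OF b'(1)])
    also have "\<dots> \<le> integral {b-h..b} ?q"
      using \<sigma>_pos by (intro integral_le qint integrable_on_mult_right sqint) (auto intro!: mult_right_mono)
    finally have "\<gamma> * (exp (\<sigma> * (b - h)) * ?H b) \<le> \<gamma> * integral {b-h..b} ?q"
      using \<gamma>_pos by (intro mult_left_mono) auto
    moreover have "exp (\<sigma> * b) * (m_v0 * (norm (y b))\<^sup>2) \<le> exp (\<sigma> * b) * v0 (y b)"
      using v0_bounds[OF yball[OF b'(1)]] by (intro mult_left_mono) auto
    moreover have "exp (\<sigma> * (b - h)) = exp (\<sigma> * b) * exp (- \<sigma> * h)"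
      by (simp add: exp_add[symmetric] algebra_simps)
    then have "\<gamma> * (exp (\<sigma> * (b - h)) * ?H b) = exp (\<sigma> * b) * (\<gamma> * exp (- \<sigma> * h) * ?H b)" by simp
    ultimately show ?thesis unfolding g_def Jint[OF b'(1)] distrib_left by linarith
  qed
  \<comment> \<open>On \<open>[-h, 0]\<close> the weight is at most 1.\<close>
  have upper: "g 0 \<le> (\<gamma> + rho\<^sup>2 * M_v0) * state_sqnorm h (x 0) (segment h u 0)"
  proof -
    have "integral {0-h..0} ?q \<le> integral {0-h..0} (\<lambda>w. (norm (U w))\<^sup>2)"
      using \<sigma>_pos by (intro integral_le qint sqint) (auto intro!: mult_left_le_one_le mult_nonneg_nonpos)
    then have 1: "\<gamma> * integral {0-h..0} ?q \<le> \<gamma> * ?H 0"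
      using \<gamma>_pos hist[OF b'(2)] by (intro mult_left_mono) auto
    have Hn: "?H 0 \<ge> 0" unfolding hist[OF b'(2)] by (intro integral_nonneg sqint) auto
    have "(norm (y 0))\<^sup>2 \<le> rho\<^sup>2 * ((norm (x 0))\<^sup>2 + (sqrt (?H 0))\<^sup>2)"
      by (rule two_term_square(1)[OF norm_ge_zero yx[OF b'(2)]])
    then have "(norm (y 0))\<^sup>2 \<le> rho\<^sup>2 * state_sqnorm h (x 0) (segment h u 0)"
      using Hn by (simp add: state_sqnorm_def)
    then have "M_v0 * (norm (y 0))\<^sup>2 \<le> M_v0 * (rho\<^sup>2 * state_sqnorm h (x 0) (segment h u 0))"
      using M_v0_pos by (intro mult_left_mono) auto
    moreover have "v0 (y 0) \<le> M_v0 * (norm (y 0))\<^sup>2" using v0_bounds[OF yball[OF b'(2)]] by blast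
    moreover have "\<gamma> * ?H 0 \<le> \<gamma> * state_sqnorm h (x 0) (segment h u 0)"
      using \<gamma>_pos by (intro mult_left_mono) (auto simp: state_sqnorm_def)
    ultimately show ?thesis using 1 unfolding g_def Jint[OF b'(2)] by (simp add: algebra_simps)
  qed
  let ?L = "m_v0 * (norm (y b))\<^sup>2 + \<gamma> * exp (- \<sigma> * h) * ?H b"
  have "?L = exp (- \<sigma> * b) * (exp (\<sigma> * b) * ?L)" by (simp add: exp_minus)
  also have "\<dots> \<le> exp (- \<sigma> * b) * ((\<gamma> + rho\<^sup>2 * M_v0) * state_sqnorm h (x 0) (segment h u 0))"
    by (rule mult_left_mono[OF order_trans[OF lower order_trans[OF \<open>g b \<le> g 0\<close> upper]]]) simp
  also have "\<dots> = (\<gamma> + rho\<^sup>2 * M_v0) * exp (- \<sigma> * b) * state_sqnorm h (x 0) (segment h u 0)"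
    by (simp only: mult_ac)
  finally have "?L \<le> (\<gamma> + rho\<^sup>2 * M_v0) * exp (- \<sigma> * b) * state_sqnorm h (x 0) (segment h u 0)" .
  with xy[OF b'(1)] show ?thesis by (rule that)
qed

end

text \<open>A history that is not square integrable is covered as well, since its integral defaults
  to 0.\<close>

lemma hist_sqnorm_nonneg: "hist_sqnorm h \<phi> \<ge> 0"
  unfolding hist_sqnorm_def
  by (cases "(\<lambda>\<theta>. (norm (\<phi> \<theta>))\<^sup>2) integrable_on {-h..0}") (auto intro: integral_nonneg simp: not_integrable_integral)

lemma state_sqnorm_nonneg: "state_sqnorm h z \<phi> \<ge> 0"
  by (simp add: state_sqnorm_def hist_sqnorm_nonneg)

text \<open>The history part is a difference of two values of one indefinite integral, hence
  continuous although the input jumps.\<close>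

lemma state_sqnorm_continuous:
  assumes h: "h > 0" and pc: "piecewise_continuous_on {-h..b} u" and x: "continuous_on {0..b} x"
  shows "continuous_on {0..b} (\<lambda>t. state_sqnorm h (x t) (segment h u t))"
proof -
  define U where "U w = (if w \<in> {-h..b} then u w else 0)" for w
  have U: "admissible_input U"
    unfolding U_def by (rule piecewise_continuous_on_admissible[OF pc]) auto
  note int = admissible_input_sqnorm_integrable[OF U]
  let ?J = "\<lambda>s. integral {-h..s} (\<lambda>w. (norm (U w))\<^sup>2)"
  have eq: "hist_sqnorm h (segment h u t) = ?J t - ?J (t - h)" if t: "t \<in> {0..b}" for t
  proof -
    have "hist_sqnorm h (segment h u t) = integral {t-h..t} (\<lambda>w. (norm (U w))\<^sup>2)"
      by (rule hist_sqnorm_cong) (use t in \<open>auto simp: segment_def U_def\<close>)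
    then show ?thesis
      using Henstock_Kurzweil_Integration.integral_combine[OF _ _ int, of "-h" "t-h" t] t h by simp
  qed
  have "continuous_on {-h..b} ?J" by (rule indefinite_integral_continuous_1[OF int])
  then have "continuous_on {0..b} ?J" "continuous_on {0..b} (\<lambda>t. ?J (t - h))"
    by (rule continuous_on_subset continuous_on_compose2; use h in \<open>auto intro!: continuous_intros\<close>)+
  then have "continuous_on {0..b} (\<lambda>t. (norm (x t))\<^sup>2 + (?J t - ?J (t - h)))"
    by (intro continuous_intros x)
  then show ?thesis
    by (rule continuous_on_eq) (simp only: state_sqnorm_def eq)
qed

section \<open>From the Lyapunov estimate to norm decay and first exit\<close>

context closed_loop_system
begin

text \<open>\<open>lower_gain\<close> and \<open>upper_gain\<close> are the constants
  \<open>m_v\<close> and \<open>M_v\<close> of the theorem.\<close>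

definition lower_gain :: real where
  "lower_gain = 1 / (2 * rho\<^sup>2) * min m_v0 (min (\<gamma> * exp (- \<sigma> * h)) (rho\<^sup>2 * \<gamma> * exp (- \<sigma> * h)))"

definition upper_gain :: real where
  "upper_gain = \<gamma> + rho\<^sup>2 * M_v0"

lemma gains_pos: "lower_gain > 0" "upper_gain > 0"
  using constants M_v0_pos \<gamma>_pos rho_pos by (auto simp: lower_gain_def upper_gain_def intro!: add_pos_pos mult_pos_pos)

text \<open>Each entry of the minimum covers one term of the norm bound: \<open>|y|^2\<close>, the
  history amplified by \<open>rho^2\<close>, and the plain history.\<close>

lemma lower_gain_le:
  "2 * rho\<^sup>2 * lower_gain \<le> m_v0" "2 * rho\<^sup>2 * lower_gain \<le> \<gamma> * exp (- \<sigma> * h)" "2 * lower_gain \<le> \<gamma> * exp (- \<sigma> * h)"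
proof -
  have r: "rho\<^sup>2 > 0" using rho_pos by simp
  define m where "m = min m_v0 (min (\<gamma> * exp (- \<sigma> * h)) (rho\<^sup>2 * \<gamma> * exp (- \<sigma> * h)))"
  have eq: "2 * rho\<^sup>2 * lower_gain = m" using r by (simp add: lower_gain_def m_def)
  show "2 * rho\<^sup>2 * lower_gain \<le> m_v0" "2 * rho\<^sup>2 * lower_gain \<le> \<gamma> * exp (- \<sigma> * h)"
    unfolding eq by (simp_all add: m_def)
  have "rho\<^sup>2 * (2 * lower_gain) \<le> rho\<^sup>2 * (\<gamma> * exp (- \<sigma> * h))"
    using eq by (simp add: m_def mult_ac)
  then show "2 * lower_gain \<le> \<gamma> * exp (- \<sigma> * h)" using r by (simp add: mult_le_cancel_left_pos)
qed

text \<open>Used to put the initial ball strictly inside the region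
  \<open>|x|^2 + |u_t|^2 < R^2 / (rho^2 + 5/8)\<close> of the first-exit argument.\<close>

lemma gain_ratio_le: "lower_gain / upper_gain \<le> 1 / (2 * rho\<^sup>2)"
proof -
  have r: "rho\<^sup>2 > 0" using rho_pos by simp
  have "2 * rho\<^sup>2 * lower_gain \<le> \<gamma> * 1"
    using \<gamma>_pos \<sigma>_pos h_pos by (intro order_trans[OF lower_gain_le(2)] mult_left_mono) auto
  also have "\<dots> \<le> upper_gain" using M_v0_pos by (simp add: upper_gain_def)
  finally show ?thesis using gains_pos(2) r by (simp add: divide_simps mult_ac)
qed

text \<open>While the squared norm stays at most \<open>n\<close>, the predicted pair stays in the
  ball of radius \<open>R\<close>, so the Lyapunov estimate is available. The first conclusion is
  the decay stated in the theorem. The second gains the factor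
  \<open>(rho^2 + 5/8) / (2 rho^2) < 1\<close>; without it the bound at an exit time would be
  \<open>R^2 / rho^2\<close>, above the exit level \<open>R^2 / (rho^2 + 5/8)\<close>.\<close>

lemma predicted_decay:
  assumes sol: "closed_loop_solution h R f B0 B1 Bint \<kappa> T x u" and b: "0 \<le> b" "ereal b < T"
    and n: "n > 0" "ereal ((rho\<^sup>2 + 5/8) * n) \<le> R\<^sup>2"
    and small: "\<And>t. t \<in> {0..b} \<Longrightarrow> state_sqnorm h (x t) (segment h u t) \<le> n"
  shows "state_sqnorm h (x b) (segment h u b)
      \<le> upper_gain / lower_gain * exp (- \<sigma> * b) * state_sqnorm h (x 0) (segment h u 0)"
    and "2 * rho\<^sup>2 * lower_gain * state_sqnorm h (x b) (segment h u b)
      \<le> (rho\<^sup>2 + 5/8) * (upper_gain * exp (- \<sigma> * b) * state_sqnorm h (x 0) (segment h u 0))"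
proof -
  let ?H = "\<lambda>t. hist_sqnorm h (segment h u t)"
  have Hs: "(sqrt (?H t))\<^sup>2 = ?H t" for t by (simp add: hist_sqnorm_nonneg)
  \<comment> \<open>The summand 5/8 leaves room between \<open>rho * sqrt n\<close> and a finite
    \<open>R\<close>, the strict gap that the variational equation needs.\<close>
  obtain r where r: "rho * sqrt n < r" "ereal r \<le> R"
  proof (cases R)
    case (real r)
    have rp: "r > 0" using R_pos real by simp
    have "(rho * sqrt n)\<^sup>2 = rho\<^sup>2 * n" using n by (simp add: power_mult_distrib)
    also have "\<dots> < (rho\<^sup>2 + 5/8) * n" using n by simp
    also have "\<dots> \<le> r\<^sup>2" using n(2) real by simp
    finally have "rho * sqrt n < r" by (rule power_less_imp_less_base) (use rp in simp)
    then show ?thesis using that real by simp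
  next
    case PInf
    then show ?thesis using that[of "rho * sqrt n + 1"] by simp
  next
    case MInf
    then show ?thesis using R_pos by simp
  qed
  obtain y :: "real^'n" where y: "norm (x b) \<le> rho / sqrt 2 * (norm y + sqrt (?H b))"
    "m_v0 * (norm y)\<^sup>2 + \<gamma> * exp (- \<sigma> * h) * ?H b
      \<le> (\<gamma> + rho\<^sup>2 * M_v0) * exp (- \<sigma> * b) * state_sqnorm h (x 0) (segment h u 0)"
  proof (rule lyapunov_decay[OF sol b _ r], goal_cases)
    case 1 show ?case using rho_pos n by simp
  next
    case (2 t)
    have "(rho / sqrt 2 * (norm (x t) + sqrt (?H t)))\<^sup>2 \<le> rho\<^sup>2 * ((norm (x t))\<^sup>2 + (sqrt (?H t))\<^sup>2)"
      by (rule two_term_square(1)[OF _ order_refl]) (use rho_pos in \<open>simp add: hist_sqnorm_nonneg\<close>)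
    also have "\<dots> \<le> rho\<^sup>2 * n"
      using small[OF 2(2)] by (intro mult_left_mono) (auto simp: Hs state_sqnorm_def)
    finally have "rho / sqrt 2 * (norm (x t) + sqrt (?H t)) \<le> sqrt (rho\<^sup>2 * n)" by (rule real_le_rsqrt)
    then show ?case using rho_pos by (simp add: real_sqrt_mult)
  next
    case (3 t y)
    have "0 \<le> t" "ereal t < T" using 3(2) b by (auto intro: le_less_trans[of _ "ereal b"])
    then have "piecewise_continuous_on {-h..t} u" using sol unfolding closed_loop_solution_def by blast
    then have seg: "segment h u t \<in> PC_hist h" by (rule segment_in_PC_hist[OF _ \<open>0 \<le> t\<close> h_pos])
    have "(norm y)\<^sup>2 + (sqrt (?H t))\<^sup>2 \<le> (rho\<^sup>2 + 5/8) * ((norm (x t))\<^sup>2 + (sqrt (?H t))\<^sup>2)"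
      by (rule two_term_square(2)[OF norm_ge_zero 3(3) rho_sq_ge])
    also have "\<dots> \<le> (rho\<^sup>2 + 5/8) * n"
      using small[OF 3(2)] by (intro mult_left_mono) (auto simp: Hs state_sqnorm_def)
    finally have "state_sqnorm h y (segment h u t) \<le> (rho\<^sup>2 + 5/8) * n" by (simp add: Hs state_sqnorm_def)
    then have "ereal (state_sqnorm h y (segment h u t)) \<le> R\<^sup>2" using n(2) by (meson ereal_less_eq(3) order_trans)
    then show ?case using seg by (simp add: state_ball_def)
  next
    case (4 y) show ?case by (rule 4(1)) (fact 4)+
  qed
  define V where "V = upper_gain * exp (- \<sigma> * b) * state_sqnorm h (x 0) (segment h u 0)"
  have V: "m_v0 * (norm y)\<^sup>2 + \<gamma> * exp (- \<sigma> * h) * ?H b \<le> V" using y(2) by (simp add: V_def upper_gain_def)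
  have H0: "?H b \<ge> 0" by (rule hist_sqnorm_nonneg)
  have x2: "(norm (x b))\<^sup>2 \<le> rho\<^sup>2 * ((norm y)\<^sup>2 + ?H b)"
    using two_term_square(1)[OF norm_ge_zero y(1)] by (simp add: Hs)
  have x2k: "state_sqnorm h (x b) (segment h u b) \<le> (rho\<^sup>2 + 5/8) * ((norm y)\<^sup>2 + ?H b)"
    using two_term_square(2)[OF norm_ge_zero y(1) rho_sq_ge] by (simp add: Hs state_sqnorm_def)
  have g1: "2 * rho\<^sup>2 * lower_gain * (norm y)\<^sup>2 \<le> m_v0 * (norm y)\<^sup>2"
    and g2: "2 * rho\<^sup>2 * lower_gain * ?H b \<le> \<gamma> * exp (- \<sigma> * h) * ?H b"
    and g3: "2 * lower_gain * ?H b \<le> \<gamma> * exp (- \<sigma> * h) * ?H b"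
    by (intro mult_right_mono lower_gain_le H0 zero_le_power2)+
  \<comment> \<open>Here the factor 1/2 in \<open>m_v\<close> is spent: the history appears twice,
    once through the bound on \<open>x\<close> and once by itself, and the halves add up to the
    single history term of \<open>V\<close>.\<close>
  have "lower_gain * state_sqnorm h (x b) (segment h u b) \<le> lower_gain * (rho\<^sup>2 * ((norm y)\<^sup>2 + ?H b) + ?H b)"
    using x2 gains_pos(1) by (intro mult_left_mono) (auto simp: state_sqnorm_def)
  also have "\<dots> = (2 * rho\<^sup>2 * lower_gain * (norm y)\<^sup>2) / 2 + (2 * rho\<^sup>2 * lower_gain * ?H b) / 2 + (2 * lower_gain * ?H b) / 2"
    by (simp add: algebra_simps)
  also have "\<dots> \<le> m_v0 * (norm y)\<^sup>2 + \<gamma> * exp (- \<sigma> * h) * ?H b"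
  proof -
    have "0 \<le> m_v0 * (norm y)\<^sup>2" using constants by simp
    then show ?thesis using g1 g2 g3 by linarith
  qed
  finally have "lower_gain * state_sqnorm h (x b) (segment h u b) \<le> V" using V by linarith
  then show "state_sqnorm h (x b) (segment h u b)
      \<le> upper_gain / lower_gain * exp (- \<sigma> * b) * state_sqnorm h (x 0) (segment h u 0)"
    using gains_pos(1) by (simp add: V_def field_simps)
  \<comment> \<open>Here state and history are bounded jointly by \<open>two_term_square\<close>, so
    the factor 2 can be kept.\<close>
  have "2 * rho\<^sup>2 * lower_gain * state_sqnorm h (x b) (segment h u b)
      \<le> 2 * rho\<^sup>2 * lower_gain * ((rho\<^sup>2 + 5/8) * ((norm y)\<^sup>2 + ?H b))"
    using x2k gains_pos(1) by (intro mult_left_mono) auto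
  also have "\<dots> = (rho\<^sup>2 + 5/8) * (2 * rho\<^sup>2 * lower_gain * (norm y)\<^sup>2 + 2 * rho\<^sup>2 * lower_gain * ?H b)"
    by (simp add: algebra_simps)
  also have "\<dots> \<le> (rho\<^sup>2 + 5/8) * V"
    using g1 g2 V by (intro mult_left_mono) auto
  finally show "2 * rho\<^sup>2 * lower_gain * state_sqnorm h (x b) (segment h u b)
      \<le> (rho\<^sup>2 + 5/8) * (upper_gain * exp (- \<sigma> * b) * state_sqnorm h (x 0) (segment h u 0))"
    by (simp add: V_def)
qed

lemma sol_state_continuous:
  assumes sol: "closed_loop_solution h R f B0 B1 Bint \<kappa> T x u" and b: "0 \<le> b" "ereal b < T"
  shows "continuous_on {0..b} (\<lambda>t. state_sqnorm h (x t) (segment h u t))"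
proof (rule state_sqnorm_continuous[OF h_pos])
  show "piecewise_continuous_on {-h..b} u" using sol b unfolding closed_loop_solution_def by blast
  have "continuous_on {t. 0 \<le> t \<and> ereal t < T} x"
    using sol unfolding closed_loop_solution_def solves_on_def by blast
  then show "continuous_on {0..b} x"
    by (rule continuous_on_subset) (use b in \<open>auto intro: le_less_trans[of _ "ereal b"]\<close>)
qed

text \<open>For finite \<open>R\<close>, at a first time with \<open>N(t) = R\<^sup>2 / k\<close>, \<open>k = rho\<^sup>2 + 5/8\<close>, the decrease of \<open>V\<close> on
  \<open>[0, t]\<close> would give \<open>N(t) \<le> k R\<^sup>2 / (2 rho\<^sup>4) < R\<^sup>2 / k\<close>.\<close>

theorem exponential_decay:
  assumes sol: "closed_loop_solution h R f B0 B1 Bint \<kappa> T x u"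
    and init: "(x 0, segment h u 0) \<in> state_ball h (ereal (sqrt (lower_gain / upper_gain)) * (R / ereal rho))"
    and t: "0 \<le> t" "ereal t < T"
  shows "state_sqnorm h (x t) (segment h u t)
      \<le> upper_gain / lower_gain * exp (- \<sigma> * t) * state_sqnorm h (x 0) (segment h u 0)"
proof -
  let ?N = "\<lambda>t. state_sqnorm h (x t) (segment h u t)"
  let ?k = "rho\<^sup>2 + 5/8"
  have k: "?k > 0" using rho_pos by (simp add: add_pos_pos)
  have cont: "continuous_on {0..t} ?N" by (rule sol_state_continuous[OF sol t])
  show ?thesis
  proof (cases R)
    \<comment> \<open>For infinite \<open>R\<close> every level \<open>n\<close> is admissible, and
      continuity on the compact interval supplies one.\<close>
    case PInf
    have "bounded (?N ` {0..t})" by (intro compact_imp_bounded compact_continuous_image cont) auto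
    then obtain n where "n > 0" "\<And>s. s \<in> {0..t} \<Longrightarrow> norm (?N s) \<le> n" unfolding bounded_pos by blast
    then have n: "n > 0" "\<And>s. s \<in> {0..t} \<Longrightarrow> ?N s \<le> n"
      by (simp, metis abs_le_D1 real_norm_def)
    show ?thesis
      by (rule predicted_decay(1)[OF sol t n(1) _ n(2)]) (simp_all add: PInf power2_eq_square)
  next
    case MInf
    then show ?thesis using R_pos by simp
  next
    case (real R0)
    have R0: "R0 > 0" using R_pos real by simp
    define n where "n = R0\<^sup>2 / ?k"
    have n: "n > 0" "ereal (?k * n) \<le> R\<^sup>2" using R0 k by (auto simp: n_def real)
    have N0: "?N 0 \<le> lower_gain / upper_gain * (R0\<^sup>2 / rho\<^sup>2)"
    proof -
      have "ereal (?N 0) \<le> (ereal (sqrt (lower_gain / upper_gain)) * (R / ereal rho))\<^sup>2"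
        using init by (simp add: state_ball_def)
      also have "\<dots> = ereal ((sqrt (lower_gain / upper_gain) * (R0 / rho))\<^sup>2)"
        using rho_pos by (simp add: real)
      also have "(sqrt (lower_gain / upper_gain) * (R0 / rho))\<^sup>2 = lower_gain / upper_gain * (R0\<^sup>2 / rho\<^sup>2)"
        using gains_pos by (simp add: power_mult_distrib power_divide)
      finally show ?thesis by simp
    qed
    have r2: "rho\<^sup>2 \<ge> 2" by (rule rho_sq_ge)
    \<comment> \<open>For \<open>rho^2 \<ge> 2\<close> one has
      \<open>2 rho^4 - (rho^2 + 5/8)^2 \<ge> (3/4) rho^2 - 25/64 > 0\<close>.\<close>
    have k2: "?k * ?k < 2 * rho\<^sup>2 * rho\<^sup>2"
    proof -
      have "0 \<le> (rho\<^sup>2 - 2) * rho\<^sup>2" using r2 by (intro mult_nonneg_nonneg) auto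
      then show ?thesis using r2 by (simp add: field_simps)
    qed
    have N0n: "?N 0 < n"
    proof -
      have "lower_gain / upper_gain * (R0\<^sup>2 / rho\<^sup>2) \<le> 1 / (2 * rho\<^sup>2) * (R0\<^sup>2 / rho\<^sup>2)"
        by (intro mult_right_mono gain_ratio_le) auto
      also have "\<dots> = R0\<^sup>2 / (2 * rho\<^sup>2 * rho\<^sup>2)" by simp
      also have "\<dots> < R0\<^sup>2 / ?k"
      proof (rule divide_strict_left_mono)
        have "2 * rho\<^sup>2 \<le> rho\<^sup>2 * rho\<^sup>2" using r2 by (intro mult_right_mono) auto
        then show "?k < 2 * rho\<^sup>2 * rho\<^sup>2" using r2 by linarith
      qed (use R0 k rho_pos in auto)
      finally show ?thesis using N0 by (simp add: n_def)
    qed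
    have below: "?N s \<le> n" if s: "s \<in> {0..t}" for s
    proof (rule ccontr)
      assume "\<not> ?N s \<le> n"
      then have Ns: "?N s > n" by simp
      have cs: "continuous_on {0..s} ?N" by (rule continuous_on_subset[OF cont]) (use s in auto)
      \<comment> \<open>Times at which the level \<open>n\<close> is hit; the least of them is the
        exit time, up to which the estimate is available.\<close>
      define Z where "Z = {a \<in> {0..s}. ?N a = n}"
      have "closed Z" unfolding Z_def by (rule continuous_closed_preimage_constant[OF cs closed_atLeastAtMost])
      moreover have "bounded Z" by (rule bounded_subset[of "{0..s}"]) (auto simp: Z_def)
      ultimately have cZ: "compact Z" by (simp add: compact_eq_bounded_closed)
      \<comment> \<open>As the squared norm starts below \<open>n\<close>, a value at or above
        \<open>n\<close> is preceded by a hit; so nothing exceeds \<open>n\<close> before the first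
        hit.\<close>
      have reach: "\<exists>a'\<in>Z. a' \<le> a" if a: "a \<in> {0..s}" "?N a \<ge> n" for a
      proof -
        have "\<exists>a'. 0 \<le> a' \<and> a' \<le> a \<and> ?N a' = n"
          by (rule IVT') (use a N0n in \<open>auto intro: continuous_on_subset[OF cs]\<close>)
        then show ?thesis using a by (auto simp: Z_def)
      qed
      then have "Z \<noteq> {}" using Ns s by fastforce
      then obtain a where a: "a \<in> Z" "\<And>a'. a' \<in> Z \<Longrightarrow> a \<le> a'" using compact_attains_inf[OF cZ] by blast
      have a': "0 \<le> a" "a \<le> s" "?N a = n" using a(1) by (auto simp: Z_def)
      have aT: "ereal a < T" using a' s t by (auto intro: le_less_trans[of _ "ereal t"])
      have le: "?N c \<le> n" if c: "c \<in> {0..a}" for c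
      proof (rule ccontr)
        assume "\<not> ?N c \<le> n"
        then obtain c' where "c' \<in> Z" "c' \<le> c" using reach[of c] c a' by auto
        then have "c = a" using a(2)[of c'] c by auto
        then show False using \<open>\<not> ?N c \<le> n\<close> a' by simp
      qed
      have "2 * rho\<^sup>2 * lower_gain * n \<le> ?k * (upper_gain * exp (- \<sigma> * a) * ?N 0)"
        using predicted_decay(2)[OF sol a'(1) aT n le] a'(3) by simp
      also have "\<dots> \<le> ?k * (upper_gain * (lower_gain / upper_gain * (R0\<^sup>2 / rho\<^sup>2)))"
      proof (rule mult_left_mono)
        have "exp (- \<sigma> * a) * ?N 0 \<le> 1 * ?N 0"
          using \<sigma>_pos a'(1) by (intro mult_right_mono state_sqnorm_nonneg) auto
        then have "upper_gain * (exp (- \<sigma> * a) * ?N 0) \<le> upper_gain * (lower_gain / upper_gain * (R0\<^sup>2 / rho\<^sup>2))"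
          using N0 gains_pos(2) by (intro mult_left_mono) auto
        then show "upper_gain * exp (- \<sigma> * a) * ?N 0 \<le> upper_gain * (lower_gain / upper_gain * (R0\<^sup>2 / rho\<^sup>2))"
          by (simp only: mult.assoc)
      qed (use k in simp)
      also have "\<dots> = lower_gain * (?k * (R0\<^sup>2 / rho\<^sup>2))" using gains_pos(2) by simp
      finally have "lower_gain * (2 * rho\<^sup>2 * n) \<le> lower_gain * (?k * (R0\<^sup>2 / rho\<^sup>2))" by (simp add: mult_ac)
      then have "2 * rho\<^sup>2 * n \<le> ?k * (R0\<^sup>2 / rho\<^sup>2)" using gains_pos(1) by (rule mult_left_le_imp_le)
      then have "2 * rho\<^sup>2 * n * rho\<^sup>2 \<le> ?k * (R0\<^sup>2 / rho\<^sup>2) * rho\<^sup>2" by (rule mult_right_mono) simp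
      also have "\<dots> = ?k * R0\<^sup>2" using rho_pos by simp
      also have "R0\<^sup>2 = ?k * n" using k by (simp add: n_def)
      finally have "2 * rho\<^sup>2 * rho\<^sup>2 * n \<le> ?k * ?k * n" by (simp add: mult_ac)
      then have "2 * rho\<^sup>2 * rho\<^sup>2 \<le> ?k * ?k" using n(1) by (rule mult_right_le_imp_le)
      then show False using k2 by simp
    qed
    show ?thesis by (rule predicted_decay(1)[OF sol t n below])
  qed
qed

text \<open>The linear bounds force \<open>f\<close> and \<open>\<kappa>\<close> to vanish at
  \<open>y = 0\<close>, and the predictor trajectory from 0 under zero input is 0, so the feedback
  is 0 and the equation holds whatever the value of \<open>B0\<close> at 0.\<close>

lemma zero_solution: "closed_loop_solution h R f B0 B1 Bint \<kappa> \<infinity> (\<lambda>_. 0) (\<lambda>_. 0)"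
proof -
  have f0: "f 0 = 0" using f_growth[OF zero_in_ball] by simp
  have pc: "piecewise_continuous_on {-h..t} (\<lambda>_. 0 :: real^'m)" for t
    unfolding piecewise_continuous_on_def by (auto intro!: exI[of _ 0])
  have adm: "admissible_input (\<lambda>_. 0 :: real^'m)" by (simp add: admissible_input_def)
  have rhs0: "predictor_rhs (\<lambda>_. 0) 0 s 0 = 0" for s by (simp add: predictor_rhs_def f0)
  have tr: "trajectory (\<lambda>_. 0) 0 (\<lambda>_. 0)"
    unfolding trajectory_def using zero_in_ball by (auto simp: rhs0)
  have seg: "segment h (\<lambda>_. 0) t \<theta> = (0 :: real^'m)" if "\<theta> \<in> {-h..<0}" for t \<theta>
    using that by (simp add: segment_def)
  have pm: "predictor_map h R f B1 Bint 0 (segment h (\<lambda>_. 0) t) = 0" for t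
    using predictor_map_eq[OF adm _ tr, of "segment h (\<lambda>_. 0) t"] seg by simp
  have k0: "\<kappa> 0 (segment h (\<lambda>_. 0) t) = 0" if t: "0 \<le> t" for t
  proof -
    have "hist_sqnorm h (segment h (\<lambda>_. 0 :: real^'m) t) = integral {t-h..t} (\<lambda>w. (norm (0 :: real^'m))\<^sup>2)"
      by (rule hist_sqnorm_cong) (simp add: seg)
    moreover have "0 \<le> R\<^sup>2" using R_pos by (cases R) (simp_all add: power2_eq_square)
    ultimately have "(0, segment h (\<lambda>_. 0 :: real^'m) t) \<in> state_ball h R"
      using segment_in_PC_hist[OF pc t h_pos] by (simp add: state_ball_def state_sqnorm_def zero_ereal_def[symmetric])
    from \<kappa>_bound[OF this] show ?thesis by simp
  qed
  have "solves_on {t. 0 \<le> t \<and> ereal t < \<infinity>}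
       (\<lambda>t z. f z + B0 z *v 0 + B1 z *v 0 + integral {-h..0} (\<lambda>\<theta>. Bint \<theta> z *v 0)) (\<lambda>_. 0)"
    unfolding solves_on_def by (auto simp: f0 intro!: exI[of _ "{}"])
  then show ?thesis
    unfolding closed_loop_solution_def using pc pm k0 by simp
qed

end

theorem theorem2:
  fixes h M_f m_v0 M_v0 m_w0 M_\<kappa> \<rho> \<gamma> \<sigma> m_v M_v :: real
    and R :: ereal
    and f :: "real^'n \<Rightarrow> real^'n"
    and A :: "real^'n \<Rightarrow> real^'n^'n"
    and B0 B1 :: "real^'n \<Rightarrow> real^'m^'n"
    and DB1 :: "'m \<Rightarrow> real^'n \<Rightarrow> real^'n^'n"
    and Bint :: "real \<Rightarrow> real^'n \<Rightarrow> real^'m^'n"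
    and DBint :: "'m \<Rightarrow> real \<Rightarrow> real^'n \<Rightarrow> real^'n^'n"
    and v0 w0 :: "real^'n \<Rightarrow> real"
    and grad_v0 grad_w0 :: "real^'n \<Rightarrow> real^'n"
    and \<kappa> :: "real^'n \<Rightarrow> (real \<Rightarrow> real^'m) \<Rightarrow> real^'m"
    and loop :: "ereal \<Rightarrow> (real \<Rightarrow> real^'n) \<Rightarrow> (real \<Rightarrow> real^'m) \<Rightarrow> bool"
  assumes standing: "standing_assumptions h R M_f f A B1 DB1 Bint DBint"
    and v0_smooth: "C1_with_gradient (origin_ball R) v0 grad_v0"
    and w0_smooth: "C1_with_gradient (origin_ball R) w0 grad_w0"
    and constants: "m_v0 > 0" "m_w0 > 0" "M_\<kappa> > 0"
    and v0_bounds: "\<And>y. y \<in> origin_ball R \<Longrightarrow>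
          m_v0 * (norm y)\<^sup>2 \<le> v0 y \<and> v0 y \<le> M_v0 * (norm y)\<^sup>2"
    and w0_bound: "\<And>y. y \<in> origin_ball R \<Longrightarrow> w0 y \<ge> m_w0 * (norm y)\<^sup>2"
    and \<kappa>_bound: "\<And>y \<phi>. (y, \<phi>) \<in> state_ball h R \<Longrightarrow> norm (\<kappa> y \<phi>) \<le> M_\<kappa> * norm y"
    and decrease: "\<And>y \<phi>. (y, \<phi>) \<in> state_ball h R \<Longrightarrow>
          \<exists>\<xi>. predictor_trajectory h R f B1 Bint \<phi> \<xi> \<and> \<xi> h = y \<Longrightarrow>
          (f y + input_matrix h R f A B0 B1 DB1 Bint DBint y \<phi> *v \<kappa> y \<phi>) \<bullet> grad_v0 y \<le> - w0 y"
    and \<rho>: "\<rho> = transform_gain h R M_f B1 Bint"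
    and \<gamma>: "\<gamma> = m_w0 / (2 * M_\<kappa>\<^sup>2)"
    and \<sigma>: "\<sigma> = m_w0 / (2 * M_v0)"
    and m_v: "m_v = 1 / (2 * \<rho>\<^sup>2) *
          min m_v0 (min (\<gamma> * exp (- \<sigma> * h)) (\<rho>\<^sup>2 * \<gamma> * exp (- \<sigma> * h)))"
    and M_v: "M_v = \<gamma> + \<rho>\<^sup>2 * M_v0"
    and loop: "loop = closed_loop_solution h R f B0 B1 Bint \<kappa>"
  shows "exponentially_stable h loop \<and>
    (R = \<infinity> \<longrightarrow> globally_exponentially_stable h loop) \<and>
    (R < \<infinity> \<longrightarrow>
       state_ball h (ereal (sqrt (m_v / M_v)) * (R / ereal \<rho>)) \<subseteq> region_of_attraction h loop) \<and>
    (\<forall>T x u. loop T x u \<and>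
       (x 0, segment h u 0) \<in> state_ball h (ereal (sqrt (m_v / M_v)) * (R / ereal \<rho>)) \<longrightarrow>
       (\<forall>t\<ge>0. ereal t < T \<longrightarrow>
          (norm (x t))\<^sup>2 + hist_sqnorm h (segment h u t)
            \<le> M_v / m_v * exp (- \<sigma> * t) * ((norm (x 0))\<^sup>2 + hist_sqnorm h (segment h u 0))))"
proof -
  interpret closed_loop_system h R M_f f A B1 DB1 Bint DBint B0 v0 w0 grad_v0 \<kappa> m_v0 M_v0 m_w0 M_\<kappa> \<gamma> \<sigma>
    by unfold_locales
      (use standing v0_smooth constants v0_bounds w0_bound \<kappa>_bound decrease \<gamma> \<sigma> in \<open>auto simp: C1_with_gradient_def\<close>)
  have mv: "m_v = lower_gain" and Mv: "M_v = upper_gain"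
    by (simp_all add: m_v M_v \<rho> lower_gain_def upper_gain_def)
  define \<delta> where "\<delta> = ereal (sqrt (m_v / M_v)) * (R / ereal \<rho>)"
  have \<rho>_pos: "\<rho> > 0" using rho_pos by (simp add: \<rho>)
  have s_pos: "sqrt (m_v / M_v) > 0" using gains_pos by (simp add: mv Mv)
  \<comment> \<open>A positive multiple of \<infinity> is \<infinity>, so for infinite
    \<open>R\<close> the ball of radius \<open>\<delta>\<close> contains every state with every
    piecewise continuous history, and the same estimate gives the global statement.\<close>
  have \<delta>_inf: "\<delta> = \<infinity>" if "R = \<infinity>"
  proof -
    have "R / ereal \<rho> = \<infinity>" using \<rho>_pos by (simp add: that divide_ereal_def)
    then show ?thesis using s_pos gains_pos by (simp only: \<delta>_def times_ereal.simps) (simp add: mv Mv)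
  qed
  have \<delta>_pos: "\<delta> > 0"
  proof (cases R)
    case (real r)
    then have "r > 0" using R_pos by simp
    then have "sqrt (m_v / M_v) * (r / \<rho>) > 0" using s_pos \<rho>_pos by (intro mult_pos_pos divide_pos_pos)
    moreover have "\<delta> = ereal (sqrt (m_v / M_v) * (r / \<rho>))" using \<rho>_pos by (simp add: \<delta>_def real)
    ultimately show ?thesis by (simp only: ereal_less(2))
  next
    case PInf
    then show ?thesis by (simp add: \<delta>_inf)
  next
    case MInf
    then show ?thesis using R_pos by simp
  qed
  have decay: "state_sqnorm h (x t) (segment h u t) \<le> M_v / m_v * exp (- \<sigma> * t) * state_sqnorm h (x 0) (segment h u 0)"
    if "loop T x u" "(x 0, segment h u 0) \<in> state_ball h \<delta>" "0 \<le> t" "ereal t < T" for T x u t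
    using exponential_decay[of T x u t] that by (simp add: mv Mv \<rho> \<delta>_def loop)
  have zero: "loop \<infinity> (\<lambda>_. 0) (\<lambda>_. 0)" unfolding loop by (rule zero_solution)
  have C: "sqrt (M_v / m_v) > 0" using gains_pos by (simp add: mv Mv)
  have \<sigma>2: "\<sigma> / 2 > 0" using \<sigma>_pos by simp
  \<comment> \<open>\<open>exp_estimate\<close> measures the norm itself, \<open>decay\<close> its
    square; hence the factor \<open>sqrt (M_v / m_v)\<close> and the rate
    \<open>\<sigma> / 2\<close>.\<close>
  have est: "exp_estimate h loop \<delta> (sqrt (M_v / m_v)) (\<sigma> / 2)"
    unfolding exp_estimate_def
  proof (intro allI impI, elim conjE)
    fix T x u t assume "loop T x u" "(x 0, segment h u 0) \<in> state_ball h \<delta>" "0 \<le> t" "ereal t < T"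
    from decay[OF this]
    have "sqrt (state_sqnorm h (x t) (segment h u t)) \<le> sqrt (M_v / m_v * exp (- \<sigma> * t) * state_sqnorm h (x 0) (segment h u 0))"
      by (rule real_sqrt_le_mono)
    also have "\<dots> = sqrt (M_v / m_v) * sqrt (exp (- \<sigma> * t)) * sqrt (state_sqnorm h (x 0) (segment h u 0))"
      by (simp only: real_sqrt_mult)
    also have "sqrt (exp (- \<sigma> * t)) = exp (- (\<sigma> / 2) * t)"
      by (rule real_sqrt_unique) (simp_all add: power2_eq_square exp_add[symmetric])
    finally show "sqrt (state_sqnorm h (x t) (segment h u t)) \<le> sqrt (M_v / m_v) * exp (- (\<sigma> / 2) * t) * sqrt (state_sqnorm h (x 0) (segment h u 0))" .
  qed
  have "state_ball h \<delta> \<subseteq> region_of_attraction h loop"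
  proof
    fix p :: "(real^'n) \<times> (real \<Rightarrow> real^'m)" assume p: "p \<in> state_ball h \<delta>"
    obtain x0 \<phi> where p_eq: "p = (x0, \<phi>)" by (cases p)
    have "((\<lambda>t. state_sqnorm h (x t) (segment h u t)) \<longlongrightarrow> 0) at_top"
      if "loop \<infinity> x u" "x 0 = x0" "segment h u 0 = \<phi>" for x u
    proof (rule tendsto_sandwich[OF _ _ tendsto_const])
      show "\<forall>\<^sub>F t in at_top. 0 \<le> state_sqnorm h (x t) (segment h u t)"
        by (simp add: state_sqnorm_nonneg)
      show "\<forall>\<^sub>F t in at_top. state_sqnorm h (x t) (segment h u t) \<le> M_v / m_v * exp (- \<sigma> * t) * state_sqnorm h (x 0) (segment h u 0)"
        using eventually_ge_at_top[of 0]
        by eventually_elim (rule decay[OF that(1)], use that p p_eq in auto)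
      have "filterlim (\<lambda>t. \<sigma> * t) at_top at_top"
        by (rule filterlim_tendsto_pos_mult_at_top[OF tendsto_const \<sigma>_pos filterlim_ident])
      then have "((\<lambda>t. exp (- \<sigma> * t)) \<longlongrightarrow> 0) at_top"
        using filterlim_compose[OF exp_at_bot filterlim_compose[OF filterlim_uminus_at_bot_at_top]] by simp
      then have "((\<lambda>t. M_v / m_v * exp (- \<sigma> * t) * state_sqnorm h (x 0) (segment h u 0)) \<longlongrightarrow> M_v / m_v * 0 * state_sqnorm h (x 0) (segment h u 0)) at_top"
        by (intro tendsto_intros)
      then show "((\<lambda>t. M_v / m_v * exp (- \<sigma> * t) * state_sqnorm h (x 0) (segment h u 0)) \<longlongrightarrow> 0) at_top"
        by simp
    qed
    then show "p \<in> region_of_attraction h loop"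
      using p p_eq by (auto simp: region_of_attraction_def state_ball_def)
  qed
  moreover have "exponentially_stable h loop"
    unfolding exponentially_stable_def using zero \<delta>_pos C \<sigma>2 est by blast
  moreover have "globally_exponentially_stable h loop" if "R = \<infinity>"
    unfolding globally_exponentially_stable_def using zero C \<sigma>2 est[unfolded \<delta>_inf[OF that]] by blast
  ultimately show ?thesis
    using decay unfolding state_sqnorm_def \<delta>_def by blast
qed

end
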